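(* Let $X$ be a complete metric space equipped with a doubling measure $\mu$ supporting a $p$-Poincar\'e inequality, $1<p<\infty$. Let $\Omega\subset X$ be a nonempty bounded open set with $C_p(X\setminus\Omega)>0$. Let $E\subset\Omega$ be such that $\operatorname{cap}_p(E,\Omega)<\infty$, let $u_E$ be the Cheeger capacitary potential of $E$ in $\Omega$, and let $\nu_E=Tu_E$ be the corresponding Radon measure on $\Omega$. Let $U\subset\Omega$ be quasiopen and $v\in N^{1,p}(\Omega)$. Then the following are true: (a) If $u\in N^{1,p}(\Omega)$ and either $u$ is bounded from below or belongs to $L^1(\nu_E)$, and $u=v$ q.e. in $U\cap E$, then \[ \int_U u\,d\nu_E=\int_U v\,d\nu_E. \] (b) If $v=1$ q.e. in $U\cap E$, then \[ \nu_E(U)=\int_U v\,d\nu_E=\int_U u_E\,d\nu_E. \] (c) If $C_p(U\cap E)=0$, then $\nu_E(U)=0$.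
   Context: Setting. $1<p<\infty$ and $X=(X,d,\mu)$ is a complete metric space with a positive complete Borel measure $\mu$ (defined on the completion of the Borel $\sigma$-algebra) with $0<\mu(B)<\infty$ for all open balls $B$. $\mu$ is doubling: there is $C>0$ with $\mu(B(x,2r))\le C\mu(B(x,r))$ for all $x\in X$, $r>0$. Curves are nonconstant, compact and rectifiable, parameterized by arc length. A Borel function $g:X\to[0,\infty]$ is an upper gradient of $f:X\to[-\infty,\infty]$ if $|f(\gamma(0))-f(\gamma(l_\gamma))|\le\int_\gamma g\,ds$ for all curves $\gamma:[0,l_\gamma]\to X$ (the left-hand side being $\infty$ if at least one of its terms is infinite). A measurable $g\ge0$ is a $p$-weak upper gradient of $f$ if this holds for $p$-almost every curve, i.e. for all curves outside a family $\Gamma$ for which there is $0\le\rho\in L^p(X)$ with $\int_\gamma\rho\,ds=\infty$ for every $\gamma\in\Gamma$. If $f$ has an upper gradient in $L^p_{\rm loc}(X)$, then $g_f$ denotes its minimal $p$-weak upper gradient (smallest a.e. among those in $L^p_{\rm loc}(X)$). $X$ supports a $p$-Poincar\'e inequality: there are $C>0$, $\lambda\ge1$ such that for all balls $B$, all integrable $f$ on $X$ and all upper gradients $g$ of $f$, $\frac1{\mu(B)}\int_B|f-f_B|\,d\mu\le C\operatorname{diam}(B)\bigl(\frac1{\mu(\lambda B)}\int_{\lambda B}g^p\,d\mu\bigr)^{1/p}$, where $f_B=\frac1{\mu(B)}\int_Bf\,d\mu$ and $\lambda B$ is the ball with the same centre and $\lambda$ times the radius. Newtonian spaces and capacities. $N^{1,p}(X)$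 is the set of measurable, everywhere defined $f:X\to[-\infty,\infty]$ with $\|f\|_{N^{1,p}(X)}=\bigl(\int_X|f|^p\,d\mu+\inf_g\int_Xg^p\,d\mu\bigr)^{1/p}<\infty$, infimum over all upper gradients $g$ of $f$. For measurable $E\subset X$, $N^{1,p}(E)$ is defined by regarding $(E,d|_E,\mu|_E)$ as a metric space on its own. For any $A\subset X$, $N^{1,p}_0(A)=\{f|_A: f\in N^{1,p}(X),\ f=0\text{ on }X\setminus A\}$ (functions extended by zero outside $A$ when needed). The Sobolev capacity is $C_p(E)=\inf\|u\|^p_{N^{1,p}(X)}$ over $u\in N^{1,p}(X)$ with $u\ge1$ on $E$; a property holds q.e. if it fails only on a set of Sobolev capacity zero. For $E\subset\Omega$, $\Omega$ open, $\operatorname{cap}_p(E,\Omega)=\inf\int_Xg_u^p\,d\mu$ over $u\in N^{1,p}_0(\Omega)$ with $u\ge1$ on $E$. A set $U\subset X$ is quasiopen if for every $\varepsilon>0$ there is an open $G\subset X$ with $C_p(G)<\varepsilon$ and $G\cup U$ open. Cheeger gradients. By a theorem of Cheeger there are countably many pairwise disjoint measurable sets $U_\alpha$ covering $X$ up to measure zero, Lipschitz functions $X^\alpha:X\to\mathbf R^{k(\alpha)}$, $1\le k(\alpha)\le N$, such that every Lipschitz $f:X\to\mathbf R$ has unique bounded $d^\alpha f:U_\alpha\to\mathbf R^{k(\alpha)}$ with $\lim_{r\to0}\sup_{y\in B(x,r)}\frac{|f(y)-f(x)-d^\alpha f(x)\cdot(X^\alpha(y)-X^\alpha(x))|}{r}=0$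 for a.e. $x\in U_\alpha$ (usual inner product), and for a.e. $x\in U_\alpha$ an inner product norm $|\cdot|_x$ on $\mathbf R^{k(\alpha)}$ with $\frac1Cg_f(x)\le|d^\alpha f(x)|_x\le Cg_f(x)$, $C$ independent of $f$ and $x$. Fix such a structure and write $Df=d^\alpha f$ on $U_\alpha$; $D$ extends uniquely to $N^{1,p}(X)$ (and locally to Newtonian functions on open sets) with the same comparability; $|Df|$ denotes $|Df(x)|_x$ and in $Du\cdot D\varphi$ the dot is the inner product giving rise to $|\cdot|_x$. Capacitary potential and measure. The Cheeger capacitary potential $u_E$ of $E$ in $\Omega$ is the unique function minimizing $\int_\Omega|Du|^p\,d\mu$ among all $u\in N^{1,p}_0(\Omega)$ with $u\ge\chi_E$ q.e. in $\Omega$ and which is lsc-regularized, i.e. $u_E(x)=\lim_{r\to0}\operatorname{ess\,inf}_{B(x,r)}u_E$ for all $x\in\Omega$. A Radon measure is a positive complete Borel measure finite on compact sets; $\nu\in N^{1,p}_0(\Omega)'$ means that $\varphi\mapsto\int_\Omega\varphi\,d\nu$ is a bounded linear functional on $N^{1,p}_0(\Omega)$. It is known that there is a Radon measure $\nu_E=Tu_E\in N^{1,p}_0(\Omega)'$ on $\Omega$ such that $\int_\Omega|Du_E|^{p-2}Du_E\cdot D\varphi\,d\mu=\int_\Omega\varphi\,d\nu_E$ for all $\varphi\in N^{1,p}_0(\Omega)$. *)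

theory Defs
  imports "HOL-Analysis.Analysis"
begin

section \<open>Extended-valued integration\<close>

text \<open>Nonnegative extended functions take values in \<open>ennreal\<close>, general ones in \<open>ereal\<close>.\<close>

definition epowr :: "ennreal \<Rightarrow> real \<Rightarrow> ennreal" where
  "epowr x q = (if x = \<infinity> then \<infinity> else ennreal (enn2real x powr q))"

text \<open>Note that \<open>e2ennreal\<close> sends negative numbers to \<open>0\<close>, so the two terms below are the integrals of
  the positive and the negative part. Since \<open>\<infinity> - \<infinity> = \<infinity>\<close> in \<open>ereal\<close>, the value is
  meaningful only under \<open>ext_integral_exists\<close>.\<close>

definition ext_integral :: "'a measure \<Rightarrow> 'a set \<Rightarrow> ('a \<Rightarrow> ereal) \<Rightarrow> ereal" where
  "ext_integral M A f =
     enn2ereal (\<integral>\<^sup>+x\<in>A. e2ennreal (f x) \<partial>M) - enn2ereal (\<integral>\<^sup>+x\<in>A. e2ennreal (- f x) \<partial>M)"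

definition ext_integral_exists :: "'a measure \<Rightarrow> 'a set \<Rightarrow> ('a \<Rightarrow> ereal) \<Rightarrow> bool" where
  "ext_integral_exists M A f \<longleftrightarrow>
     A \<in> sets M \<and> f \<in> borel_measurable (restrict_space M A) \<and>
     ((\<integral>\<^sup>+x\<in>A. e2ennreal (f x) \<partial>M) < \<infinity> \<or> (\<integral>\<^sup>+x\<in>A. e2ennreal (- f x) \<partial>M) < \<infinity>)"

definition ext_integrable :: "'a measure \<Rightarrow> 'a set \<Rightarrow> ('a \<Rightarrow> ereal) \<Rightarrow> bool" where
  "ext_integrable M A f \<longleftrightarrow>
     f \<in> borel_measurable (restrict_space M A) \<and> (\<integral>\<^sup>+x\<in>A. e2ennreal \<bar>f x\<bar> \<partial>M) < \<infinity>"

text \<open>A complete Borel measure on the subspace \<open>S\<close>, living exactly on the completion of the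
  Borel \<open>\<sigma>\<close>-algebra of \<open>S\<close>.\<close>

definition complete_borel_measure :: "'a::topological_space set \<Rightarrow> 'a measure \<Rightarrow> bool" where
  "complete_borel_measure S M \<longleftrightarrow>
     (\<exists>N. sets N = sets (restrict_space borel S) \<and> M = completion N)"

definition radon_measure :: "'a::topological_space set \<Rightarrow> 'a measure \<Rightarrow> bool" where
  "radon_measure S M \<longleftrightarrow>
     complete_borel_measure S M \<and> (\<forall>K. compact K \<and> K \<subseteq> S \<longrightarrow> emeasure M K < \<infinity>)"

definition ess_inf :: "'a measure \<Rightarrow> 'a set \<Rightarrow> ('a \<Rightarrow> ereal) \<Rightarrow> ereal" where
  "ess_inf M A f = Sup {c. AE x in M. x \<in> A \<longrightarrow> c \<le> f x}"

section \<open>Curves and upper gradients\<close>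

definition curve_length :: "(real \<Rightarrow> 'a::metric_space) \<Rightarrow> real \<Rightarrow> real \<Rightarrow> ennreal" where
  "curve_length \<gamma> a b =
     (SUP ts\<in>{ts. sorted ts \<and> set ts \<subseteq> {a..b}}.
        \<Sum>i<length ts - 1. ennreal (dist (\<gamma> (ts ! i)) (\<gamma> (ts ! Suc i))))"

text \<open>A nonconstant compact rectifiable curve in \<open>S\<close>, parameterized by arc length on \<open>{0..l}\<close>
  (nonconstant means \<open>0 < l\<close>). Values of \<open>\<gamma>\<close> outside \<open>{0..l}\<close> are irrelevant.\<close>

definition arc_length_curve :: "'a::metric_space set \<Rightarrow> real \<Rightarrow> (real \<Rightarrow> 'a) \<Rightarrow> bool" where
  "arc_length_curve S l \<gamma> \<longleftrightarrow>
     0 < l \<and> continuous_on {0..l} \<gamma> \<and> \<gamma> ` {0..l} \<subseteq> S \<and>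
     (\<forall>t\<in>{0..l}. curve_length \<gamma> 0 t = ennreal t)"

definition line_integral :: "real \<Rightarrow> (real \<Rightarrow> 'a) \<Rightarrow> ('a \<Rightarrow> ennreal) \<Rightarrow> ennreal" where
  "line_integral l \<gamma> g = (\<integral>\<^sup>+t\<in>{0..l}. g (\<gamma> t) \<partial>lborel)"

definition ext_diff :: "ereal \<Rightarrow> ereal \<Rightarrow> ennreal" where
  "ext_diff a b = (if \<bar>a\<bar> = \<infinity> \<or> \<bar>b\<bar> = \<infinity> then \<infinity> else e2ennreal \<bar>a - b\<bar>)"

definition upper_gradient ::
  "'a::metric_space set \<Rightarrow> ('a \<Rightarrow> ereal) \<Rightarrow> ('a \<Rightarrow> ennreal) \<Rightarrow> bool" where
  "upper_gradient S f g \<longleftrightarrow>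
     g \<in> borel_measurable (restrict_space borel S) \<and>
     (\<forall>l \<gamma>. arc_length_curve S l \<gamma> \<longrightarrow> ext_diff (f (\<gamma> 0)) (f (\<gamma> l)) \<le> line_integral l \<gamma> g)"

text \<open>As usual, the function \<open>\<rho>\<close> witnessing that a family of curves is exceptional is Borel, so
  that its line integrals are defined. For the merely measurable \<open>g\<close>, \<open>line_integral\<close> is a lower
  integral; \<open>g \<circ> \<gamma>\<close> is measurable for \<open>p\<close>-almost every curve.\<close>

definition weak_upper_gradient ::
  "real \<Rightarrow> 'a::metric_space measure \<Rightarrow> ('a \<Rightarrow> ereal) \<Rightarrow> ('a \<Rightarrow> ennreal) \<Rightarrow> bool" where
  "weak_upper_gradient p M f g \<longleftrightarrow>
     g \<in> borel_measurable M \<and>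
     (\<exists>\<rho>\<in>borel_measurable borel. (\<integral>\<^sup>+x. epowr (\<rho> x) p \<partial>M) < \<infinity> \<and>
       (\<forall>l \<gamma>. arc_length_curve UNIV l \<gamma> \<longrightarrow>
          ext_diff (f (\<gamma> 0)) (f (\<gamma> l)) \<le> line_integral l \<gamma> g \<or> line_integral l \<gamma> \<rho> = \<infinity>))"

definition Lp_loc :: "real \<Rightarrow> 'a::metric_space measure \<Rightarrow> ('a \<Rightarrow> ennreal) set" where
  "Lp_loc p M = {g \<in> borel_measurable M. \<forall>x. \<exists>r>0. (\<integral>\<^sup>+y\<in>ball x r. epowr (g y) p \<partial>M) < \<infinity>}"

text \<open>The minimal \<open>p\<close>-weak upper gradient is only determined almost everywhere, hence a predicate.\<close>

definition is_min_weak_upper_gradient ::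
  "real \<Rightarrow> 'a::metric_space measure \<Rightarrow> ('a \<Rightarrow> ereal) \<Rightarrow> ('a \<Rightarrow> ennreal) \<Rightarrow> bool" where
  "is_min_weak_upper_gradient p M f g \<longleftrightarrow>
     g \<in> Lp_loc p M \<and> weak_upper_gradient p M f g \<and>
     (\<forall>h\<in>Lp_loc p M. weak_upper_gradient p M f h \<longrightarrow> (AE x in M. g x \<le> h x))"

section \<open>Standing assumptions on the space\<close>

definition doubling :: "'a::metric_space measure \<Rightarrow> bool" where
  "doubling M \<longleftrightarrow>
     (\<exists>C>0. \<forall>x. \<forall>r>0. emeasure M (ball x (2 * r)) \<le> ennreal C * emeasure M (ball x r))"

definition mean :: "'a measure \<Rightarrow> 'a set \<Rightarrow> ('a \<Rightarrow> ereal) \<Rightarrow> real" where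
  "mean M B f = real_of_ereal (ext_integral M B f) / measure M B"

definition poincare :: "real \<Rightarrow> 'a::metric_space measure \<Rightarrow> bool" where
  "poincare p M \<longleftrightarrow>
     (\<exists>C>0. \<exists>lam\<ge>1. \<forall>z. \<forall>r>0. \<forall>f g. ext_integrable M UNIV f \<and> upper_gradient UNIV f g \<longrightarrow>
        (\<integral>\<^sup>+x\<in>ball z r. e2ennreal \<bar>f x - ereal (mean M (ball z r) f)\<bar> \<partial>M) / emeasure M (ball z r)
        \<le> ennreal (C * diameter (ball z r)) *
          epowr ((\<integral>\<^sup>+x\<in>ball z (lam * r). epowr (g x) p \<partial>M) / emeasure M (ball z (lam * r))) (1 / p))"

section \<open>Newtonian spaces and capacities\<close>

text \<open>The space \<open>S\<close> is regarded as a metric measure space on its own; values of \<open>f\<close> outside \<open>S\<close>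
  are irrelevant.\<close>

definition newton_norm :: "real \<Rightarrow> 'a::metric_space measure \<Rightarrow> 'a set \<Rightarrow> ('a \<Rightarrow> ereal) \<Rightarrow> ennreal" where
  "newton_norm p M S f =
     epowr ((\<integral>\<^sup>+x\<in>S. epowr (e2ennreal \<bar>f x\<bar>) p \<partial>M) +
            (INF g\<in>{g. upper_gradient S f g}. \<integral>\<^sup>+x\<in>S. epowr (g x) p \<partial>M)) (1 / p)"

definition newtonian :: "real \<Rightarrow> 'a::metric_space measure \<Rightarrow> 'a set \<Rightarrow> ('a \<Rightarrow> ereal) set" where
  "newtonian p M S = {f \<in> borel_measurable (restrict_space M S). newton_norm p M S f < \<infinity>}"

text \<open>Elements of \<open>N\<^sub>0\<close> are represented by their extension by zero.\<close>

definition newtonian0 :: "real \<Rightarrow> 'a::metric_space measure \<Rightarrow> 'a set \<Rightarrow> ('a \<Rightarrow> ereal) set" where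
  "newtonian0 p M A = {f \<in> newtonian p M UNIV. \<forall>x. x \<notin> A \<longrightarrow> f x = 0}"

definition sobolev_cap :: "real \<Rightarrow> 'a::metric_space measure \<Rightarrow> 'a set \<Rightarrow> ennreal" where
  "sobolev_cap p M E =
     (INF u\<in>{u \<in> newtonian p M UNIV. \<forall>x\<in>E. 1 \<le> u x}. epowr (newton_norm p M UNIV u) p)"

definition holds_qe :: "real \<Rightarrow> 'a::metric_space measure \<Rightarrow> 'a set \<Rightarrow> ('a \<Rightarrow> bool) \<Rightarrow> bool" where
  "holds_qe p M A P \<longleftrightarrow> sobolev_cap p M {x \<in> A. \<not> P x} = 0"

definition variational_cap ::
  "real \<Rightarrow> 'a::metric_space measure \<Rightarrow> 'a set \<Rightarrow> 'a set \<Rightarrow> ennreal" where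
  "variational_cap p M E \<Omega> =
     Inf {\<integral>\<^sup>+x. epowr (g x) p \<partial>M | u g.
            u \<in> newtonian0 p M \<Omega> \<and> (\<forall>x\<in>E. 1 \<le> u x) \<and> is_min_weak_upper_gradient p M u g}"

definition quasiopen :: "real \<Rightarrow> 'a::metric_space measure \<Rightarrow> 'a set \<Rightarrow> bool" where
  "quasiopen p M U \<longleftrightarrow> (\<forall>\<epsilon>>0. \<exists>G. open G \<and> sobolev_cap p M G < ennreal \<epsilon> \<and> open (G \<union> U))"

section \<open>Cheeger's differentiable structure\<close>

text \<open>The charts are \<open>(W \<alpha>, Y \<alpha>)\<close>, \<open>\<alpha> \<in> I\<close>. A vector of \<open>\<real>\<^bsup>k \<alpha>\<^esup>\<close> is a function
  \<open>nat \<Rightarrow> real\<close> of which only the coordinates \<open>i < k \<alpha>\<close> matter.\<close>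

definition lipschitz :: "('a::metric_space \<Rightarrow> real) \<Rightarrow> bool" where
  "lipschitz f \<longleftrightarrow> (\<exists>L. L-lipschitz_on UNIV f)"

definition is_differential ::
  "'a::metric_space measure \<Rightarrow> 'a set \<Rightarrow> nat \<Rightarrow> ('a \<Rightarrow> nat \<Rightarrow> real) \<Rightarrow> ('a \<Rightarrow> real) \<Rightarrow> ('a \<Rightarrow> nat \<Rightarrow> real) \<Rightarrow> bool"
where
  "is_differential M W k Y f d \<longleftrightarrow>
     (\<exists>K. \<forall>x\<in>W. L2_set (d x) {..<k} \<le> K) \<and>
     (AE x in M. x \<in> W \<longrightarrow>
        ((\<lambda>r. SUP y\<in>ball x r. ereal (\<bar>f y - f x - (\<Sum>i<k. d x i * (Y y i - Y x i))\<bar> / r)) \<longlongrightarrow> 0)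
          (at_right 0))"

definition inner_product_on :: "nat \<Rightarrow> ((nat \<Rightarrow> real) \<Rightarrow> (nat \<Rightarrow> real) \<Rightarrow> real) \<Rightarrow> bool" where
  "inner_product_on k b \<longleftrightarrow>
     (\<forall>v w w'. (\<forall>i<k. w i = w' i) \<longrightarrow> b v w = b v w') \<and>
     (\<forall>v w. b v w = b w v) \<and>
     (\<forall>a v w z. b v (\<lambda>i. a * w i + z i) = a * b v w + b v z) \<and>
     (\<forall>v. (\<exists>i<k. v i \<noteq> 0) \<longrightarrow> 0 < b v v)"

definition ip_norm :: "((nat \<Rightarrow> real) \<Rightarrow> (nat \<Rightarrow> real) \<Rightarrow> real) \<Rightarrow> (nat \<Rightarrow> real) \<Rightarrow> real" where
  "ip_norm b v = sqrt (b v v)"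

text \<open>The measurability of \<open>x \<mapsto> ip x v w\<close> is needed for the energy integrals to make sense.\<close>

definition cheeger_structure ::
  "real \<Rightarrow> 'a::metric_space measure \<Rightarrow> nat set \<Rightarrow> (nat \<Rightarrow> 'a set) \<Rightarrow> (nat \<Rightarrow> nat) \<Rightarrow>
   (nat \<Rightarrow> 'a \<Rightarrow> nat \<Rightarrow> real) \<Rightarrow> ('a \<Rightarrow> (nat \<Rightarrow> real) \<Rightarrow> (nat \<Rightarrow> real) \<Rightarrow> real) \<Rightarrow> bool" where
  "cheeger_structure p M I W k Y ip \<longleftrightarrow>
     disjoint_family_on W I \<and> (\<forall>\<alpha>\<in>I. W \<alpha> \<in> sets M) \<and> (AE x in M. x \<in> (\<Union>\<alpha>\<in>I. W \<alpha>)) \<and>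
     (\<exists>N. \<forall>\<alpha>\<in>I. 1 \<le> k \<alpha> \<and> k \<alpha> \<le> N) \<and>
     (\<forall>\<alpha>\<in>I. \<exists>L. \<forall>x y. L2_set (\<lambda>i. Y \<alpha> x i - Y \<alpha> y i) {..<k \<alpha>} \<le> L * dist x y) \<and>
     (\<forall>f. lipschitz f \<longrightarrow> (\<forall>\<alpha>\<in>I.
        (\<exists>d. is_differential M (W \<alpha>) (k \<alpha>) (Y \<alpha>) f d) \<and>
        (\<forall>d d'. is_differential M (W \<alpha>) (k \<alpha>) (Y \<alpha>) f d \<and> is_differential M (W \<alpha>) (k \<alpha>) (Y \<alpha>) f d' \<longrightarrow>
           (AE x in M. x \<in> W \<alpha> \<longrightarrow> (\<forall>i<k \<alpha>. d x i = d' x i))))) \<and>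
     (\<forall>\<alpha>\<in>I. AE x in M. x \<in> W \<alpha> \<longrightarrow> inner_product_on (k \<alpha>) (ip x)) \<and>
     (\<forall>\<alpha>\<in>I. \<forall>v w. (\<lambda>x. ip x v w) \<in> borel_measurable (restrict_space M (W \<alpha>))) \<and>
     (\<exists>C>0. \<forall>f g. lipschitz f \<and> is_min_weak_upper_gradient p M (\<lambda>x. ereal (f x)) g \<longrightarrow>
        (\<forall>\<alpha>\<in>I. \<forall>d. is_differential M (W \<alpha>) (k \<alpha>) (Y \<alpha>) f d \<longrightarrow>
           (AE x in M. x \<in> W \<alpha> \<longrightarrow>
              ennreal (1 / C) * g x \<le> ennreal (ip_norm (ip x) (d x)) \<and>
              ennreal (ip_norm (ip x) (d x)) \<le> ennreal C * g x)))"

text \<open>The extension of the differential to \<open>N\<close>: a linear operator that agrees with the differential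
  on Lipschitz functions and has the same comparability with minimal weak upper gradients. Since
  Lipschitz functions are dense in \<open>N\<close>, these properties determine it almost everywhere.
  Functions in \<open>N\<close> are extended-valued but finite almost everywhere, so linearity is expressed
  through almost everywhere identities.\<close>

definition cheeger_gradient ::
  "real \<Rightarrow> 'a::metric_space measure \<Rightarrow> nat set \<Rightarrow> (nat \<Rightarrow> 'a set) \<Rightarrow> (nat \<Rightarrow> nat) \<Rightarrow>
   (nat \<Rightarrow> 'a \<Rightarrow> nat \<Rightarrow> real) \<Rightarrow> ('a \<Rightarrow> (nat \<Rightarrow> real) \<Rightarrow> (nat \<Rightarrow> real) \<Rightarrow> real) \<Rightarrow>
   (('a \<Rightarrow> ereal) \<Rightarrow> 'a \<Rightarrow> nat \<Rightarrow> real) \<Rightarrow> bool" where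
  "cheeger_gradient p M I W k Y ip D \<longleftrightarrow>
     (\<forall>u\<in>newtonian p M UNIV. \<forall>\<alpha>\<in>I. \<forall>i<k \<alpha>.
        (\<lambda>x. D u x i) \<in> borel_measurable (restrict_space M (W \<alpha>))) \<and>
     (\<forall>f. lipschitz f \<and> (\<lambda>x. ereal (f x)) \<in> newtonian p M UNIV \<longrightarrow>
        (\<forall>\<alpha>\<in>I. \<forall>d. is_differential M (W \<alpha>) (k \<alpha>) (Y \<alpha>) f d \<longrightarrow>
           (AE x in M. x \<in> W \<alpha> \<longrightarrow> (\<forall>i<k \<alpha>. D (\<lambda>x. ereal (f x)) x i = d x i)))) \<and>
     (\<forall>u\<in>newtonian p M UNIV. \<forall>v\<in>newtonian p M UNIV. \<forall>w\<in>newtonian p M UNIV. \<forall>a b.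
        (AE x in M. w x = ereal a * u x + ereal b * v x) \<longrightarrow>
        (\<forall>\<alpha>\<in>I. AE x in M. x \<in> W \<alpha> \<longrightarrow> (\<forall>i<k \<alpha>. D w x i = a * D u x i + b * D v x i))) \<and>
     (\<exists>C>0. \<forall>u\<in>newtonian p M UNIV. \<forall>g. is_min_weak_upper_gradient p M u g \<longrightarrow>
        (AE x in M.
           ennreal (1 / C) * g x \<le> ennreal (ip_norm (ip x) (D u x)) \<and>
           ennreal (ip_norm (ip x) (D u x)) \<le> ennreal C * g x))"

section \<open>Capacitary potential and capacitary measure\<close>

definition obstacle_class ::
  "real \<Rightarrow> 'a::metric_space measure \<Rightarrow> 'a set \<Rightarrow> 'a set \<Rightarrow> ('a \<Rightarrow> ereal) set" where
  "obstacle_class p M \<Omega> E = {u \<in> newtonian0 p M \<Omega>. holds_qe p M \<Omega> (\<lambda>x. indicator E x \<le> u x)}"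

definition capacitary_potential ::
  "real \<Rightarrow> 'a::metric_space measure \<Rightarrow> ('a \<Rightarrow> (nat \<Rightarrow> real) \<Rightarrow> (nat \<Rightarrow> real) \<Rightarrow> real) \<Rightarrow>
   (('a \<Rightarrow> ereal) \<Rightarrow> 'a \<Rightarrow> nat \<Rightarrow> real) \<Rightarrow> 'a set \<Rightarrow> 'a set \<Rightarrow> ('a \<Rightarrow> ereal) \<Rightarrow> bool" where
  "capacitary_potential p M ip D \<Omega> E u \<longleftrightarrow>
     u \<in> obstacle_class p M \<Omega> E \<and>
     (\<forall>w\<in>obstacle_class p M \<Omega> E.
        (\<integral>\<^sup>+x\<in>\<Omega>. ennreal (ip_norm (ip x) (D u x) powr p) \<partial>M) \<le>
        (\<integral>\<^sup>+x\<in>\<Omega>. ennreal (ip_norm (ip x) (D w x) powr p) \<partial>M)) \<and>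
     (\<forall>x\<in>\<Omega>. ((\<lambda>r. ess_inf M (ball x r) u) \<longlongrightarrow> u x) (at_right 0))"

text \<open>Linearity of \<open>\<phi> \<mapsto> \<integral> \<phi> d\<nu>\<close> is automatic once all \<open>\<phi>\<close> are \<open>\<nu>\<close>-integrable.\<close>

definition in_dual_newtonian0 ::
  "real \<Rightarrow> 'a::metric_space measure \<Rightarrow> 'a set \<Rightarrow> 'a measure \<Rightarrow> bool" where
  "in_dual_newtonian0 p M \<Omega> \<nu> \<longleftrightarrow>
     (\<forall>\<phi>\<in>newtonian0 p M \<Omega>. ext_integrable \<nu> \<Omega> \<phi>) \<and>
     (\<exists>C. \<forall>\<phi>\<in>newtonian0 p M \<Omega>.
        e2ennreal \<bar>ext_integral \<nu> \<Omega> \<phi>\<bar> \<le> ennreal C * newton_norm p M UNIV \<phi>)"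

text \<open>The measure \<open>\<nu> = Tu\<close>. Where \<open>Du = 0\<close> the integrand on the left vanishes, also if \<open>p < 2\<close>.\<close>

definition is_T_measure ::
  "real \<Rightarrow> 'a::metric_space measure \<Rightarrow> ('a \<Rightarrow> (nat \<Rightarrow> real) \<Rightarrow> (nat \<Rightarrow> real) \<Rightarrow> real) \<Rightarrow>
   (('a \<Rightarrow> ereal) \<Rightarrow> 'a \<Rightarrow> nat \<Rightarrow> real) \<Rightarrow> 'a set \<Rightarrow> ('a \<Rightarrow> ereal) \<Rightarrow> 'a measure \<Rightarrow> bool" where
  "is_T_measure p M ip D \<Omega> u \<nu> \<longleftrightarrow>
     radon_measure \<Omega> \<nu> \<and> in_dual_newtonian0 p M \<Omega> \<nu> \<and>
     (\<forall>\<phi>\<in>newtonian0 p M \<Omega>.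
        ereal (LINT x:\<Omega>|M. ip_norm (ip x) (D u x) powr (p - 2) * ip x (D u x) (D \<phi> x)) =
        ext_integral \<nu> \<Omega> \<phi>)"

end

theory Submission
  imports Defs
begin

text \<open>
  The whole statement rests on one fact: if two functions of \<open>N(\<Omega>)\<close> agree
  q.e. on \<open>U \<inter> E\<close>, then they agree \<open>\<nu>\<close>-almost everywhere on the quasiopen set \<open>U\<close> (lemma
  \<open>agree_\<nu>\<close>). Part (a) follows at once, part (c) is the case of the functions \<open>1\<close> and \<open>0\<close>, and
  part (b) is the comparison with \<open>1\<close> together with \<open>u\<^sub>E = 1\<close> \<open>\<nu>\<close>-almost everywhere.
  The latter also makes \<open>\<nu>\<close> finite, because \<open>u\<^sub>E\<close> is \<open>\<nu>\<close>-integrable; so a function that is bounded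
  from below has an integral.

  To see that fact, take first a function \<open>f \<ge> 0\<close> in \<open>N\<^sub>0(\<Omega>)\<close> that vanishes q.e. on \<open>E\<close>. For \<open>t > 0\<close>
  the function \<open>max 0 (u\<^sub>E - t f)\<close> is still admissible in the obstacle problem, and taking positive
  parts does not increase \<open>|Dw|\<close>. Hence the energy of \<open>u\<^sub>E - t f\<close> is at least that of \<open>u\<^sub>E\<close>, the
  derivative of the energy at \<open>u\<^sub>E\<close> in direction \<open>- f\<close> is nonnegative, and by the definition of
  \<open>\<nu> = T u\<^sub>E\<close> this says \<open>- \<integral> f d\<nu> \<ge> 0\<close>, so \<open>f = 0\<close> \<open>\<nu>\<close>-almost everywhere (lemma \<open>\<nu>_null_off_E\<close>).
  Testing with the direction \<open>- max 0 (u\<^sub>E - 1)\<close> instead gives \<open>u\<^sub>E \<le> 1\<close> \<open>\<nu>\<close>-almost everywhere. For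
  general \<open>u\<close> and \<open>v\<close> apply this to \<open>f = \<psi> |u\<^sub>n - v\<^sub>n|\<close>, where \<open>u\<^sub>n\<close>, \<open>v\<^sub>n\<close> are truncations and \<open>\<psi>\<close>
  is a bounded function of \<open>N\<^sub>0(U)\<close>. A quasiopen set carries countably many such \<open>\<psi>\<close> whose
  common zeros in \<open>U\<close> form a set of capacity zero (lemma \<open>quasiopen_cutoffs\<close>), and
  \<open>\<nu>\<close> does not charge sets of capacity zero, since their indicators have Newtonian norm zero.

  Three pieces of the theory of Newtonian spaces carry this argument. The first one is that a set has
  capacity zero exactly when it is \<open>\<mu>\<close>-null and \<open>p\<close>-almost no curve meets it. The second is the
  existence of minimal \<open>p\<close>-weak upper gradients and the fact that they vanish almost everywhere on the
  zero set of the function: the size of the Cheeger gradient of a general Newtonian function is known only by comparison with a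
  minimal weak upper gradient, so integrability of \<open>|Du|\<^sup>p\<close> and locality of \<open>D\<close> both
  have to come from there. The third is the one-sided derivative of the energy,
  which follows from convexity of \<open>|\<xi>|\<^sup>p\<close> and dominated convergence.
\<close>

section \<open>Powers and energies of extended nonnegative functions\<close>

lemma epowr_0 [simp]: "epowr 0 q = 0"
  by (simp add: epowr_def)

lemma epowr_top [simp]: "epowr \<infinity> q = \<infinity>" "epowr top q = \<infinity>"
  by (simp_all add: epowr_def)

lemma epowr_ennreal [simp]: "0 \<le> x \<Longrightarrow> epowr (ennreal x) q = ennreal (x powr q)"
  by (simp add: epowr_def)

lemma epowr_lt_top_iff [simp]: "epowr x q < \<infinity> \<longleftrightarrow> x < \<infinity>" "epowr x q < top \<longleftrightarrow> x < top"
  by (simp_all add: epowr_def less_top)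

lemma epowr_eq_0_iff [simp]: "epowr x q = 0 \<longleftrightarrow> x = 0"
  by (cases x rule: ennreal_cases) (simp_all)

lemma epowr_mono: "0 < q \<Longrightarrow> x \<le> y \<Longrightarrow> epowr x q \<le> epowr y q"
  by (cases x rule: ennreal_cases; cases y rule: ennreal_cases)
     (auto simp: powr_mono2 top_unique)

lemma epowr_inverse: "q \<noteq> 0 \<Longrightarrow> epowr (epowr x (1 / q)) q = x"
  by (cases x rule: ennreal_cases) (simp_all add: powr_powr)

lemma epowr_inverse': "q \<noteq> 0 \<Longrightarrow> epowr (epowr x q) (1 / q) = x"
  using epowr_inverse[of "1/q" x] by simp

lemma epowr_le_iff: assumes "0 < q" shows "epowr x q \<le> epowr y q \<longleftrightarrow> x \<le> y"
  using epowr_mono[OF assms, of x y] epowr_mono[of "1/q" "epowr x q" "epowr y q"] assms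
  by (auto simp: epowr_inverse')

lemma epowr_mult: "0 < c \<Longrightarrow> epowr (ennreal c * x) q = ennreal (c powr q) * epowr x q"
  by (cases x rule: ennreal_cases)
     (simp_all add: powr_mult ennreal_mult_top flip: ennreal_mult)

lemma epowr_add_le:
  assumes "0 < q"
  shows "epowr (a + b) q \<le> ennreal (2 powr q) * (epowr a q + epowr b q)"
proof -
  have "a + b \<le> 2 * max a b"
    by (simp add: mult_2 add_mono)
  then have "epowr (a + b) q \<le> epowr (ennreal 2 * max a b) q"
    using assms by (intro epowr_mono) auto
  also have "\<dots> = ennreal (2 powr q) * epowr (max a b) q"
    by (rule epowr_mult) simp
  also have "\<dots> \<le> ennreal (2 powr q) * (epowr a q + epowr b q)"
    by (intro mult_left_mono) (auto simp: max_def)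
  finally show ?thesis .
qed

text \<open>
  Countable families are combined with suprema rather than sums below, because the \<open>p\<close>-th power commutes
  with suprema: the \<open>p\<close>-energy of a supremum is at most the sum of the \<open>p\<close>-energies.
\<close>
lemma epowr_SUP_le:
  fixes f :: "nat \<Rightarrow> ennreal"
  assumes "0 < q"
  shows "epowr (SUP j. f j) q \<le> (\<Sum>j. epowr (f j) q)"
proof -
  have "f j \<le> epowr (\<Sum>j. epowr (f j) q) (1 / q)" for j
  proof -
    have "epowr (f j) q \<le> (\<Sum>j. epowr (f j) q)"
      using sum_le_suminf[of "\<lambda>j. epowr (f j) q" "{j}"] by (simp add: summableI)
    then have "epowr (epowr (f j) q) (1 / q) \<le> epowr (\<Sum>j. epowr (f j) q) (1 / q)"
      using assms by (intro epowr_mono) auto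
    then show ?thesis using assms by (simp add: epowr_inverse')
  qed
  then have "(SUP j. f j) \<le> epowr (\<Sum>j. epowr (f j) q) (1 / q)"
    by (intro SUP_least)
  then have "epowr (SUP j. f j) q \<le> epowr (epowr (\<Sum>j. epowr (f j) q) (1 / q)) q"
    using assms by (intro epowr_mono)
  then show ?thesis using assms by (simp add: epowr_inverse)
qed

lemma borel_measurable_epowr [measurable (raw)]:
  assumes [measurable]: "f \<in> borel_measurable M"
  shows "(\<lambda>x. epowr (f x) q) \<in> borel_measurable M"
  unfolding epowr_def by measurable

definition energy :: "real \<Rightarrow> 'a measure \<Rightarrow> ('a \<Rightarrow> ennreal) \<Rightarrow> ennreal" where
  "energy q M g = (\<integral>\<^sup>+x. epowr (g x) q \<partial>M)"

lemma energy_mono: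
  "0 < q \<Longrightarrow> (\<And>x. x \<in> space M \<Longrightarrow> f x \<le> g x) \<Longrightarrow> energy q M f \<le> energy q M g"
  unfolding energy_def by (intro nn_integral_mono epowr_mono)

lemma energy_add_finite:
  assumes "0 < q" "f \<in> borel_measurable M" "g \<in> borel_measurable M"
    and "energy q M f < \<infinity>" "energy q M g < \<infinity>"
  shows "energy q M (\<lambda>x. f x + g x) < \<infinity>"
proof -
  note [measurable] = assms(2,3)
  have "energy q M (\<lambda>x. f x + g x) \<le> (\<integral>\<^sup>+x. ennreal (2 powr q) * (epowr (f x) q + epowr (g x) q) \<partial>M)"
    unfolding energy_def using assms(1) by (intro nn_integral_mono epowr_add_le)
  also have "\<dots> = ennreal (2 powr q) * (energy q M f + energy q M g)"
    unfolding energy_def by (subst nn_integral_cmult) (simp_all add: nn_integral_add)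
  also have "\<dots> < \<infinity>"
    using assms(4,5) by (simp add: ennreal_mult_less_top)
  finally show ?thesis .
qed

lemma energy_cmult:
  assumes "0 < c" "f \<in> borel_measurable M"
  shows "energy q M (\<lambda>x. ennreal c * f x) = ennreal (c powr q) * energy q M f"
  using assms unfolding energy_def by (simp add: epowr_mult nn_integral_cmult)

lemma energy_SUP_le:
  fixes f :: "nat \<Rightarrow> 'a \<Rightarrow> ennreal"
  assumes "0 < q" and [measurable]: "\<And>j. f j \<in> borel_measurable M"
  shows "energy q M (\<lambda>x. SUP j. f j x) \<le> (\<Sum>j. energy q M (f j))"
proof -
  have "energy q M (\<lambda>x. SUP j. f j x) \<le> (\<integral>\<^sup>+x. (\<Sum>j. epowr (f j x) q) \<partial>M)"
    unfolding energy_def using assms(1) by (intro nn_integral_mono epowr_SUP_le)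
  also have "\<dots> = (\<Sum>j. energy q M (f j))"
    unfolding energy_def by (rule nn_integral_suminf) measurable
  finally show ?thesis .
qed

lemma ennreal_half_powers: "(\<Sum>j. ennreal ((1/2) ^ Suc j)) = 1"
proof -
  have "(\<Sum>j. ennreal ((1/2) ^ Suc j)) = ennreal 1"
    by (rule suminf_ennreal_eq[OF _ power_half_series]) simp
  then show ?thesis by (simp only: ennreal_1)
qed

text \<open>
  Countably many functions of finite energy have a common majorant of finite energy, up to positive
  factors. This is why countable unions of exceptional curve families are exceptional: a curve with
  infinite integral of one \<open>f j\<close> has infinite integral of the majorant.
\<close>
lemma energy_scaled_SUP_finite:
  fixes f :: "nat \<Rightarrow> 'a \<Rightarrow> ennreal"
  assumes "0 < q" and [measurable]: "\<And>j. f j \<in> borel_measurable M"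
    and fin: "\<And>j. energy q M (f j) < \<infinity>"
  obtains c :: "nat \<Rightarrow> real" where "\<And>j. 0 < c j"
    "energy q M (\<lambda>x. SUP j. ennreal (c j) * f j x) < \<infinity>"
proof -
  define e where "e j = enn2real (energy q M (f j)) + 1" for j
  have e: "energy q M (f j) \<le> ennreal (e j)" "1 \<le> e j" for j
  proof -
    have "energy q M (f j) = ennreal (enn2real (energy q M (f j)))"
        using fin[of j] by simp
    also have "\<dots> \<le> ennreal (e j)" unfolding e_def by (intro ennreal_leI) simp
    finally show "energy q M (f j) \<le> ennreal (e j)" .
    show "1 \<le> e j" by (simp add: e_def)
  qed
  \<comment> \<open>this makes the energy of \<open>c j * f j\<close> at most \<open>2^-(j+1)\<close>\<close>
  define c where "c j = ((1/2) ^ Suc j / e j) powr (1 / q)" for j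
  have c: "0 < c j" for j
  proof -
    have "0 < e j" using e(2)[of j] by linarith
    then have "0 < (1/2) ^ Suc j / e j" by (intro divide_pos_pos) auto
    then have "(1/2) ^ Suc j / e j \<noteq> 0" by linarith
    then show ?thesis unfolding c_def powr_gt_zero .
  qed
  have "energy q M (\<lambda>x. ennreal (c j) * f j x) \<le> ennreal ((1/2) ^ Suc j)" for j
  proof -
    have "energy q M (\<lambda>x. ennreal (c j) * f j x) = ennreal (c j powr q) * energy q M (f j)"
      by (rule energy_cmult[OF c]) simp
    also have "\<dots> \<le> ennreal (c j powr q) * ennreal (e j)"
      by (intro mult_left_mono e) simp
    also have "c j powr q = (1/2) ^ Suc j / e j"
      using \<open>0 < q\<close> order_trans[OF zero_le_one e(2)[of j]] by (simp add: c_def powr_powr)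
    also have "ennreal ((1/2) ^ Suc j / e j) * ennreal (e j) = ennreal ((1/2) ^ Suc j / e j * e j)"
      using order_trans[OF zero_le_one e(2)[of j]] by (intro ennreal_mult[symmetric]) auto
    also have "(1/2) ^ Suc j / e j * e j = (1/2) ^ Suc j"
      using e(2)[of j] by (intro nonzero_eq_divide_eq[THEN iffD1]) auto
    finally show ?thesis .
  qed
  then have "(\<Sum>j. energy q M (\<lambda>x. ennreal (c j) * f j x)) \<le> (\<Sum>j. ennreal ((1/2) ^ Suc j))"
    by (intro suminf_le summableI)
  then have "energy q M (\<lambda>x. SUP j. ennreal (c j) * f j x) \<le> 1"
    using energy_SUP_le[of q "\<lambda>j x. ennreal (c j) * f j x" M] \<open>0 < q\<close>
    unfolding ennreal_half_powers by (auto intro: order_trans)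
  then have "energy q M (\<lambda>x. SUP j. ennreal (c j) * f j x) < \<infinity>"
    by (metis ennreal_one_less_top infinity_ennreal_def order_le_less_trans)
  with c show ?thesis by (rule that)
qed


section \<open>Curves parameterized by arc length\<close>

definition seg_integral :: "(real \<Rightarrow> ennreal) \<Rightarrow> real \<Rightarrow> real \<Rightarrow> ennreal" where
  "seg_integral k a b = (\<integral>\<^sup>+t\<in>{a..b}. k t \<partial>lborel)"

lemma line_integral_eq_seg: "line_integral l \<gamma> g = seg_integral (\<lambda>t. g (\<gamma> t)) 0 l"
  by (simp add: line_integral_def seg_integral_def)

lemma seg_integral_cong:
  "(\<And>t. a \<le> t \<Longrightarrow> t \<le> b \<Longrightarrow> k t = k' t) \<Longrightarrow> seg_integral k a b = seg_integral k' a b"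
  unfolding seg_integral_def by (intro nn_integral_cong) (auto simp: indicator_def)

lemma seg_integral_mono:
  "(\<And>t. a \<le> t \<Longrightarrow> t \<le> b \<Longrightarrow> k t \<le> k' t) \<Longrightarrow> seg_integral k a b \<le> seg_integral k' a b"
  unfolding seg_integral_def by (intro nn_integral_mono) (auto simp: indicator_def)

lemma seg_integral_subset:
  "a \<le> a' \<Longrightarrow> b' \<le> b \<Longrightarrow> seg_integral k a' b' \<le> seg_integral k a b"
  unfolding seg_integral_def by (intro nn_integral_mono) (auto simp: indicator_def)

lemma seg_integral_split:
  assumes [measurable]: "k \<in> borel_measurable borel" and "a \<le> c" "c \<le> b"
  shows "seg_integral k a c + seg_integral k c b = seg_integral k a b"
proof -
  have "seg_integral k a b = (\<integral>\<^sup>+t. k t * indicator {a..c} t + k t * indicator {c..b} t \<partial>lborel)"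
    unfolding seg_integral_def
  proof (rule nn_integral_cong_AE)
    show "AE t in lborel. k t * indicator {a..b} t = k t * indicator {a..c} t + k t * indicator {c..b} t"
      using AE_lborel_singleton[of c] by eventually_elim (use assms in \<open>auto simp: indicator_def\<close>)
  qed
  also have "\<dots> = seg_integral k a c + seg_integral k c b"
    unfolding seg_integral_def by (rule nn_integral_add) measurable
  finally show ?thesis by simp
qed

lemma seg_integral_shift:
  assumes [measurable]: "k \<in> borel_measurable borel"
  shows "seg_integral (\<lambda>t. k (a + t)) 0 (b - a) = seg_integral k a b"
proof -
  have "seg_integral k a b = ennreal \<bar>1\<bar> * (\<integral>\<^sup>+t. k (a + 1 * t) * indicator {a..b} (a + 1 * t) \<partial>lborel)"
    unfolding seg_integral_def by (rule nn_integral_real_affine) simp_all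
  also have "\<dots> = seg_integral (\<lambda>t. k (a + t)) 0 (b - a)"
    unfolding seg_integral_def by (auto intro!: nn_integral_cong simp: indicator_def)
  finally show ?thesis by simp
qed

lemma seg_integral_const: "a \<le> b \<Longrightarrow> seg_integral (\<lambda>_. c) a b = c * ennreal (b - a)"
  unfolding seg_integral_def by (simp add: nn_integral_cmult_indicator)

text \<open>
  If \<open>k\<close> controls the increments of \<open>h\<close>, then only the part of \<open>k\<close> off the zeros of \<open>h\<close> matters:
  between the first and the last zero nothing has to be paid for. Applied along curves, this
  localizes upper gradients to the set where the function does not vanish.
\<close>
lemma seg_integral_off_zeros:
  fixes h :: "real \<Rightarrow> real"
  assumes [measurable]: "k \<in> borel_measurable borel"
    and "0 \<le> l"
    and ub: "\<And>a b. 0 \<le> a \<Longrightarrow> a \<le> b \<Longrightarrow> b \<le> l \<Longrightarrow> ennreal \<bar>h a - h b\<bar> \<le> seg_integral k a b"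
    and Z: "closed Z" "Z \<subseteq> {0..l}" "\<And>t. t \<in> Z \<Longrightarrow> h t = 0"
  shows "ennreal \<bar>h 0 - h l\<bar> \<le> seg_integral (\<lambda>t. k t * indicator (- Z) t) 0 l"
proof (cases "Z = {}")
  case True
  then show ?thesis using ub[of 0 l] \<open>0 \<le> l\<close> by simp
next
  case False
  let ?k = "\<lambda>t. k t * indicator (- Z) t"
  have [measurable]: "Z \<in> sets borel" using Z by auto
  have "compact Z" using Z compact_Icc[of 0 l] by (metis closed_Int_compact inf.absorb_iff1)
  obtain s where s: "s \<in> Z" "\<And>z. z \<in> Z \<Longrightarrow> s \<le> z"
    using compact_attains_inf[OF \<open>compact Z\<close> False] by blast
  obtain t where t: "t \<in> Z" "\<And>z. z \<in> Z \<Longrightarrow> z \<le> t"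
    using compact_attains_sup[OF \<open>compact Z\<close> False] by blast
  have st: "0 \<le> s" "s \<le> t" "t \<le> l" using s t Z by auto
  have 1: "seg_integral k 0 s = seg_integral ?k 0 s"
    unfolding seg_integral_def
  proof (rule nn_integral_cong_AE)
    show "AE x in lborel. k x * indicator {0..s} x = ?k x * indicator {0..s} x"
      using AE_lborel_singleton[of s]
      by eventually_elim (use s(2) in \<open>auto simp: indicator_def; force\<close>)
  qed
  have 2: "seg_integral k t l = seg_integral ?k t l"
    unfolding seg_integral_def
  proof (rule nn_integral_cong_AE)
    show "AE x in lborel. k x * indicator {t..l} x = ?k x * indicator {t..l} x"
      using AE_lborel_singleton[of t]
      by eventually_elim (use t(2) in \<open>auto simp: indicator_def; force\<close>)
  qed
  have "ennreal \<bar>h 0 - h l\<bar> \<le> ennreal (\<bar>h 0 - h s\<bar> + \<bar>h t - h l\<bar>)"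
    using Z(3)[OF s(1)] Z(3)[OF t(1)] by (intro ennreal_leI) auto
  also have "\<dots> = ennreal \<bar>h 0 - h s\<bar> + ennreal \<bar>h t - h l\<bar>" by (rule ennreal_plus) auto
  also have "\<dots> \<le> seg_integral k 0 s + seg_integral k t l"
    using st by (intro add_mono ub) auto
  also have "\<dots> \<le> seg_integral ?k 0 t + seg_integral ?k t l"
    unfolding 1 2 using st by (intro add_mono seg_integral_subset) auto
  also have "\<dots> = seg_integral ?k 0 l"
    using st by (intro seg_integral_split) auto
  finally show ?thesis .
qed

text \<open>
  The expression under the supremum in \<^const>\<open>curve_length\<close>; its recursion over the list drives the
  inductions below.
\<close>
definition path_sum :: "(real \<Rightarrow> 'a::metric_space) \<Rightarrow> real list \<Rightarrow> ennreal" where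
  "path_sum \<gamma> ts = (\<Sum>i<length ts - 1. ennreal (dist (\<gamma> (ts ! i)) (\<gamma> (ts ! Suc i))))"

lemma path_sum_simps [simp]:
  "path_sum \<gamma> [] = 0" "path_sum \<gamma> [x] = 0"
  "path_sum \<gamma> (x # y # ts) = ennreal (dist (\<gamma> x) (\<gamma> y)) + path_sum \<gamma> (y # ts)"
  by (simp_all add: path_sum_def sum.lessThan_Suc_shift del: sum.lessThan_Suc)

lemma path_sum_append: "path_sum \<gamma> (xs @ a # ys) = path_sum \<gamma> (xs @ [a]) + path_sum \<gamma> (a # ys)"
proof (induction xs)
  case (Cons x xs)
  then show ?case by (cases xs) (simp_all add: add.assoc)
qed simp

lemma path_sum_insert: "path_sum \<gamma> (xs @ ys) \<le> path_sum \<gamma> (xs @ a # ys)"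
proof (induction xs)
  case Nil
  then show ?case by (cases ys) simp_all
next
  case (Cons x xs)
  show ?case
  proof (cases xs)
    case Nil
    show ?thesis
    proof (cases ys)
      case (Cons y zs)
      have "ennreal (dist (\<gamma> x) (\<gamma> y)) \<le> ennreal (dist (\<gamma> x) (\<gamma> a)) + ennreal (dist (\<gamma> a) (\<gamma> y))"
        by (simp add: dist_triangle flip: ennreal_plus)
      then show ?thesis using Nil Cons by (simp add: add_mono flip: add.assoc)
    qed (use Nil in simp)
  next
    case (Cons z zs)
    then show ?thesis using Cons.IH by (simp add: add_mono)
  qed
qed

lemma path_sum_map: "path_sum \<gamma> (map f ts) = path_sum (\<lambda>t. \<gamma> (f t)) ts"
  unfolding path_sum_def by (auto intro!: sum.cong)

lemma curve_length_eq_SUP: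
  "curve_length \<gamma> a b = (SUP ts\<in>{ts. sorted ts \<and> set ts \<subseteq> {a..b}}. path_sum \<gamma> ts)"
  by (simp add: curve_length_def path_sum_def)

lemma path_sum_le_curve_length:
  "sorted ts \<Longrightarrow> set ts \<subseteq> {a..b} \<Longrightarrow> path_sum \<gamma> ts \<le> curve_length \<gamma> a b"
  unfolding curve_length_eq_SUP by (intro SUP_upper) auto

lemma curve_length_least:
  "(\<And>ts. sorted ts \<Longrightarrow> set ts \<subseteq> {a..b} \<Longrightarrow> path_sum \<gamma> ts \<le> B) \<Longrightarrow> curve_length \<gamma> a b \<le> B"
  unfolding curve_length_eq_SUP by (intro SUP_least) auto

lemma curve_length_split:
  assumes "a \<le> c" "c \<le> b"
  shows "curve_length \<gamma> a c + curve_length \<gamma> c b = curve_length \<gamma> a b"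
proof (rule antisym)
  show "curve_length \<gamma> a b \<le> curve_length \<gamma> a c + curve_length \<gamma> c b"
  proof (rule curve_length_least)
    fix ts assume ts: "sorted ts" "set ts \<subseteq> {a..b}"
    define xs ys where "xs = takeWhile (\<lambda>t. t \<le> c) ts" and "ys = dropWhile (\<lambda>t. t \<le> c) ts"
    have tseq: "ts = xs @ ys" by (simp add: xs_def ys_def)
    have sx: "sorted xs" "sorted ys" using ts(1) unfolding tseq sorted_append by auto
    have x: "\<forall>t\<in>set xs. t \<le> c" by (auto simp: xs_def dest: set_takeWhileD)
    have y: "\<forall>t\<in>set ys. c \<le> t"
    proof (cases ys)
      case (Cons y zs)
      then have "\<not> y \<le> c" unfolding ys_def by (metis hd_dropWhile list.distinct(1) list.sel(1))
      then show ?thesis using Cons sx(2) by auto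
    qed simp
    have "path_sum \<gamma> ts \<le> path_sum \<gamma> (xs @ c # ys)"
      unfolding tseq by (rule path_sum_insert)
    also have "\<dots> = path_sum \<gamma> (xs @ [c]) + path_sum \<gamma> (c # ys)"
      by (rule path_sum_append)
    also have "\<dots> \<le> curve_length \<gamma> a c + curve_length \<gamma> c b"
      using ts(2) sx x y assms unfolding tseq
      by (intro add_mono path_sum_le_curve_length) (auto simp: sorted_append)
    finally show "path_sum \<gamma> ts \<le> curve_length \<gamma> a c + curve_length \<gamma> c b" .
  qed
  have le: "path_sum \<gamma> xs + path_sum \<gamma> ys \<le> curve_length \<gamma> a b"
    if "sorted xs" "set xs \<subseteq> {a..c}" "sorted ys" "set ys \<subseteq> {c..b}" for xs ys
  proof -
    have "path_sum \<gamma> xs + path_sum \<gamma> ys \<le> path_sum \<gamma> (xs @ [c]) + path_sum \<gamma> (c # ys)"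
      using path_sum_insert[of \<gamma> xs "[]" c] path_sum_insert[of \<gamma> "[]" ys c] by (intro add_mono) auto
    also have "\<dots> = path_sum \<gamma> (xs @ c # ys)" by (rule path_sum_append[symmetric])
    also have "\<dots> \<le> curve_length \<gamma> a b"
      using that assms by (intro path_sum_le_curve_length) (fastforce simp: sorted_append)+
    finally show ?thesis .
  qed
  have ne: "{ts. sorted ts \<and> set ts \<subseteq> {a'..b'}} \<noteq> {}" for a' b' :: real
    by (auto intro!: exI[of _ "[]"])
  show "curve_length \<gamma> a c + curve_length \<gamma> c b \<le> curve_length \<gamma> a b"
    unfolding curve_length_eq_SUP[of _ a c] curve_length_eq_SUP[of _ c b]
      ennreal_SUP_add_left[OF ne, symmetric] ennreal_SUP_add_right[OF ne]
    by (intro SUP_least le) auto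
qed

lemma curve_length_shift: "curve_length (\<lambda>t. \<gamma> (a + t)) 0 t = curve_length \<gamma> a (a + t)"
proof (rule antisym; rule curve_length_least)
  fix ts assume "sorted ts" "set ts \<subseteq> {0..t}"
  then have "path_sum \<gamma> (map ((+) a) ts) \<le> curve_length \<gamma> a (a + t)"
    by (intro path_sum_le_curve_length) (auto simp: sorted_map)
  then show "path_sum (\<lambda>t. \<gamma> (a + t)) ts \<le> curve_length \<gamma> a (a + t)"
    by (simp add: path_sum_map)
next
  fix ts assume "sorted ts" "set ts \<subseteq> {a..a + t}"
  then have "path_sum (\<lambda>t. \<gamma> (a + t)) (map (\<lambda>t. t - a) ts) \<le> curve_length (\<lambda>t. \<gamma> (a + t)) 0 t"
    by (intro path_sum_le_curve_length) (auto simp: sorted_map)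
  then show "path_sum \<gamma> ts \<le> curve_length (\<lambda>t. \<gamma> (a + t)) 0 t"
    by (simp add: path_sum_map)
qed

lemma arc_length_curve_length:
  assumes "arc_length_curve S l \<gamma>" "0 \<le> a" "a \<le> b" "b \<le> l"
  shows "curve_length \<gamma> a b = ennreal (b - a)"
proof -
  have "ennreal a + curve_length \<gamma> a b = ennreal b"
    using curve_length_split[of 0 a b \<gamma>] assms by (simp add: arc_length_curve_def)
  also have "\<dots> = ennreal a + ennreal (b - a)"
    using assms by (simp flip: ennreal_plus)
  finally show ?thesis by (simp add: ennreal_add_left_cancel)
qed

text \<open>
  Upper gradients are defined by the end points of curves. Passing to subcurves turns this into a
  bound between any two points of a curve.
\<close>
lemma arc_length_curve_sub:
  assumes "arc_length_curve S l \<gamma>" "0 \<le> a" "a < b" "b \<le> l"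
  shows "arc_length_curve S (b - a) (\<lambda>t. \<gamma> (a + t))"
  unfolding arc_length_curve_def
proof (intro conjI ballI)
  have cont: "continuous_on {0..l} \<gamma>" and im: "\<gamma> ` {0..l} \<subseteq> S"
    using assms by (auto simp: arc_length_curve_def)
  show "continuous_on {0..b - a} (\<lambda>t. \<gamma> (a + t))"
    using assms by (intro continuous_on_compose2[OF cont] continuous_intros) auto
  show "(\<lambda>t. \<gamma> (a + t)) ` {0..b - a} \<subseteq> S" using im assms by auto
  fix t assume "t \<in> {0..b - a}"
  then show "curve_length (\<lambda>t. \<gamma> (a + t)) 0 t = ennreal t"
    using arc_length_curve_length[OF assms(1), of a "a + t"] assms by (simp add: curve_length_shift)
qed (use assms in simp)

lemma arc_length_curve_dist:
  assumes "arc_length_curve S l \<gamma>" "0 \<le> a" "a \<le> b" "b \<le> l"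
  shows "dist (\<gamma> a) (\<gamma> b) \<le> b - a"
proof -
  have "path_sum \<gamma> [a, b] \<le> curve_length \<gamma> a b"
    using assms by (intro path_sum_le_curve_length) auto
  then show ?thesis using assms by (simp add: arc_length_curve_length[OF assms])
qed

lemma arc_length_curve_mono: "arc_length_curve S l \<gamma> \<Longrightarrow> S \<subseteq> T \<Longrightarrow> arc_length_curve T l \<gamma>"
  by (auto simp: arc_length_curve_def)

text \<open>
  A curve is unconstrained outside \<open>{0..l}\<close>, so \<open>g \<circ> \<gamma>\<close> need not be measurable on the whole line;
  \<open>k\<close> is a measurable substitute.
\<close>
lemma arc_length_curve_measurable:
  fixes g :: "'a::metric_space \<Rightarrow> ennreal"
  assumes "arc_length_curve S l \<gamma>" "g \<in> borel_measurable borel"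
  obtains k where "k \<in> borel_measurable borel" "\<And>t. 0 \<le> t \<Longrightarrow> t \<le> l \<Longrightarrow> k t = g (\<gamma> t)"
proof
  have "\<gamma> \<in> borel_measurable (restrict_space borel {0..l})"
    using assms by (intro borel_measurable_continuous_on_restrict) (simp add: arc_length_curve_def)
  then have "(\<lambda>t. g (\<gamma> t)) \<in> borel_measurable (restrict_space borel {0..l})"
    using assms(2) by measurable
  then show "(\<lambda>t. g (\<gamma> t) * indicator {0..l} t) \<in> borel_measurable borel"
    by (subst (asm) borel_measurable_restrict_space_iff_ennreal) auto
qed auto

lemma line_integral_sub:
  assumes "arc_length_curve S l \<gamma>" "g \<in> borel_measurable borel" "0 \<le> a" "a \<le> b" "b \<le> l"
  shows "line_integral (b - a) (\<lambda>t. \<gamma> (a + t)) g = seg_integral (\<lambda>t. g (\<gamma> t)) a b"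
proof -
  obtain k where k: "k \<in> borel_measurable borel" "\<And>t. 0 \<le> t \<Longrightarrow> t \<le> l \<Longrightarrow> k t = g (\<gamma> t)"
    using arc_length_curve_measurable[OF assms(1,2)] by blast
  have "line_integral (b - a) (\<lambda>t. \<gamma> (a + t)) g = seg_integral (\<lambda>t. k (a + t)) 0 (b - a)"
    unfolding line_integral_eq_seg using assms k(2) by (intro seg_integral_cong) auto
  also have "\<dots> = seg_integral k a b" by (rule seg_integral_shift[OF k(1)])
  also have "\<dots> = seg_integral (\<lambda>t. g (\<gamma> t)) a b"
    using assms k(2) by (intro seg_integral_cong) auto
  finally show ?thesis .
qed

lemma ext_diff_ereal [simp]: "ext_diff (ereal x) (ereal y) = ennreal \<bar>x - y\<bar>"
  by (simp add: ext_diff_def e2ennreal_ereal)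

lemma ext_diff_commute: "ext_diff a b = ext_diff b a"
  by (cases a; cases b) (auto simp: ext_diff_def abs_minus_commute)

lemma upper_gradient_sub:
  assumes "upper_gradient S f g" "g \<in> borel_measurable borel"
    and "arc_length_curve S l \<gamma>" "0 \<le> a" "a < b" "b \<le> l"
  shows "ext_diff (f (\<gamma> a)) (f (\<gamma> b)) \<le> seg_integral (\<lambda>t. g (\<gamma> t)) a b"
  using assms(1) arc_length_curve_sub[OF assms(3-6)] line_integral_sub[OF assms(3,2), of a b] assms
  by (auto simp: upper_gradient_def dest!: spec[of _ "b - a"] spec[of _ "\<lambda>t. \<gamma> (a + t)"])


section \<open>Exceptional families of curves and polar sets\<close>

lemma seg_integral_cmult:
  assumes "k \<in> borel_measurable borel"
  shows "seg_integral (\<lambda>t. c * k t) a b = c * seg_integral k a b"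
  unfolding seg_integral_def using assms
  by (subst nn_integral_cmult[symmetric]) (auto simp: mult.assoc)

lemma line_integral_cmult:
  assumes "arc_length_curve S l \<gamma>" "g \<in> borel_measurable borel"
    and "0 \<le> a" "b \<le> l"
  shows "seg_integral (\<lambda>t. c * g (\<gamma> t)) a b = c * seg_integral (\<lambda>t. g (\<gamma> t)) a b"
proof -
  obtain k where k: "k \<in> borel_measurable borel" "\<And>t. 0 \<le> t \<Longrightarrow> t \<le> l \<Longrightarrow> k t = g (\<gamma> t)"
    using arc_length_curve_measurable[OF assms(1,2)] by blast
  have "seg_integral (\<lambda>t. c * g (\<gamma> t)) a b = seg_integral (\<lambda>t. c * k t) a b"
    using assms k by (intro seg_integral_cong) auto
  also have "\<dots> = c * seg_integral k a b" by (rule seg_integral_cmult[OF k(1)])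
  also have "seg_integral k a b = seg_integral (\<lambda>t. g (\<gamma> t)) a b"
    using assms k by (intro seg_integral_cong) auto
  finally show ?thesis .
qed

lemma line_integral_add:
  assumes "arc_length_curve S l \<gamma>" "g \<in> borel_measurable borel" "h \<in> borel_measurable borel"
    and "0 \<le> a" "b \<le> l"
  shows "seg_integral (\<lambda>t. g (\<gamma> t) + h (\<gamma> t)) a b
    = seg_integral (\<lambda>t. g (\<gamma> t)) a b + seg_integral (\<lambda>t. h (\<gamma> t)) a b"
proof -
  obtain k where k: "k \<in> borel_measurable borel" "\<And>t. 0 \<le> t \<Longrightarrow> t \<le> l \<Longrightarrow> k t = g (\<gamma> t)"
    using arc_length_curve_measurable[OF assms(1,2)] by blast
  obtain k' where k': "k' \<in> borel_measurable borel" "\<And>t. 0 \<le> t \<Longrightarrow> t \<le> l \<Longrightarrow> k' t = h (\<gamma> t)"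
    using arc_length_curve_measurable[OF assms(1,3)] by blast
  note [measurable] = k(1) k'(1)
  have "seg_integral (\<lambda>t. g (\<gamma> t) + h (\<gamma> t)) a b = seg_integral (\<lambda>t. k t + k' t) a b"
    using assms k k' by (intro seg_integral_cong) auto
  also have "\<dots> = seg_integral k a b + seg_integral k' a b"
    unfolding seg_integral_def by (subst nn_integral_add[symmetric]) (auto simp: distrib_right)
  also have "seg_integral k a b = seg_integral (\<lambda>t. g (\<gamma> t)) a b"
    using assms k by (intro seg_integral_cong) auto
  also have "seg_integral k' a b = seg_integral (\<lambda>t. h (\<gamma> t)) a b"
    using assms k' by (intro seg_integral_cong) auto
  finally show ?thesis .
qed

lemma e2ennreal_abs_le_ext_diff: "e2ennreal \<bar>a\<bar> \<le> e2ennreal \<bar>b\<bar> + ext_diff a b"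
  by (cases a; cases b) (auto simp: ext_diff_def e2ennreal_ereal simp flip: ennreal_plus intro!: ennreal_leI)

locale newton_space =
  fixes p :: real and M :: "'a::metric_space measure"
  assumes p_gt_1: "1 < p" and complete_borel: "complete_borel_measure UNIV M"
begin

lemma p_pos: "0 < p" using p_gt_1 by simp

lemma completion_of: obtains N where "sets N = sets borel" "M = completion N"
  using complete_borel by (auto simp: complete_borel_measure_def)

lemma space_M [simp]: "space M = UNIV"
  using completion_of by (metis sets_eq_imp_space_eq space_borel space_completion)

lemma borel_sets_M: "A \<in> sets borel \<Longrightarrow> A \<in> sets M"
  by (rule completion_of) auto

lemma open_sets_M [measurable]: "open A \<Longrightarrow> A \<in> sets M"
  by (simp add: borel_sets_M)

lemma borel_measurable_M: "f \<in> borel_measurable borel \<Longrightarrow> f \<in> borel_measurable M"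
  by (rule completion_of) (metis measurable_completion measurable_cong_sets)

sublocale complete_measure M
  by (rule completion_of) (auto intro: complete_measure.intro simp: completion.complete_measure_axioms)

lemma null_borel_superset:
  assumes "A \<in> null_sets M"
  obtains B where "B \<in> sets borel" "B \<in> null_sets M" "A \<subseteq> B"
  using completion_of assms by (metis null_sets_completion_iff2 null_sets_completionI null_setsD2)

lemma measurable_AE_cong:
  fixes f g :: "'a \<Rightarrow> 'b::topological_space"
  assumes "f \<in> borel_measurable M" "AE x in M. f x = g x"
  shows "g \<in> borel_measurable M"
proof (rule borel_measurableI)
  fix S :: "'b set" assume "open S"
  then have "f -` S \<inter> space M \<in> sets M" using assms(1) by measurable
  then show "g -` S \<inter> space M \<in> sets M"
    by (rule in_sets_AE[rotated]) (use assms(2) in auto)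
qed

text \<open>
  Functions measurable with respect to the completion may be replaced by larger Borel functions
  without changing them almost everywhere. Enlarging a weak upper gradient keeps it one, so it
  suffices to study Borel ones, whose line integrals behave well.
\<close>
lemma borel_majorant:
  fixes f :: "'a \<Rightarrow> ennreal"
  assumes "f \<in> borel_measurable M"
  obtains g where "g \<in> borel_measurable borel" "\<And>x. f x \<le> g x" "AE x in M. f x = g x"
proof -
  obtain N where N: "sets N = sets borel" "M = completion N" by (rule completion_of)
  obtain g' where g': "g' \<in> borel_measurable N" "AE x in N. f x = g' x"
    using completion_ex_borel_measurable assms N by metis
  have AE: "AE x in M. f x = g' x" unfolding N using g'(2) by (rule AE_completion)
  then have "{x. f x \<noteq> g' x} \<in> null_sets M" by (simp add: AE_iff_null_sets)
  then obtain B where B: "B \<in> sets borel" "B \<in> null_sets M" "{x. f x \<noteq> g' x} \<subseteq> B"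
    by (rule null_borel_superset)
  have [measurable]: "g' \<in> borel_measurable borel" using g'(1) N(1) measurable_cong_sets by blast
  note [measurable] = B(1)
  show thesis
  proof (rule that[of "\<lambda>x. if x \<in> B then top else g' x"])
    show "AE x in M. f x = (if x \<in> B then top else g' x)"
      using AE AE_not_in[OF B(2)] by eventually_elim auto
    show "f x \<le> (if x \<in> B then top else g' x)" for x
      using B(3) by (cases "f x = g' x") auto
  qed measurable
qed

lemma line_integral_mono: "(\<And>x. g x \<le> h x) \<Longrightarrow> line_integral l \<gamma> g \<le> line_integral l \<gamma> h"
  unfolding line_integral_eq_seg by (intro seg_integral_mono)

text \<open>
  \<open>p\<close>-almost every curve. The witness is a Borel function because line integrals of functions that
  are merely measurable for the completion need not be defined.
\<close>
definition ae_curve :: "(real \<Rightarrow> (real \<Rightarrow> 'a) \<Rightarrow> bool) \<Rightarrow> bool" where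
  "ae_curve P \<longleftrightarrow> (\<exists>\<rho>\<in>borel_measurable borel. energy p M \<rho> < \<infinity> \<and>
     (\<forall>l \<gamma>. arc_length_curve UNIV l \<gamma> \<longrightarrow> line_integral l \<gamma> \<rho> < \<infinity> \<longrightarrow> P l \<gamma>))"

lemma ae_curve_mono:
  assumes "ae_curve P" "\<And>l \<gamma>. arc_length_curve UNIV l \<gamma> \<Longrightarrow> P l \<gamma> \<Longrightarrow> Q l \<gamma>"
  shows "ae_curve Q"
  using assms unfolding ae_curve_def by metis

lemma ae_curve_finite:
  "g \<in> borel_measurable borel \<Longrightarrow> energy p M g < \<infinity> \<Longrightarrow> ae_curve (\<lambda>l \<gamma>. line_integral l \<gamma> g < \<infinity>)"
  unfolding ae_curve_def by blast

lemma ae_curve_all: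
  assumes "\<And>j::nat. ae_curve (P j)"
  shows "ae_curve (\<lambda>l \<gamma>. \<forall>j. P j l \<gamma>)"
proof -
  have "\<exists>\<rho>. \<forall>j. \<rho> j \<in> borel_measurable borel \<and> energy p M (\<rho> j) < \<infinity> \<and>
     (\<forall>l \<gamma>. arc_length_curve UNIV l \<gamma> \<longrightarrow> line_integral l \<gamma> (\<rho> j) < \<infinity> \<longrightarrow> P j l \<gamma>)"
    using assms unfolding ae_curve_def by (intro choice) blast
  then obtain \<rho> where \<rho>: "\<And>j. \<rho> j \<in> borel_measurable borel" "\<And>j. energy p M (\<rho> j) < \<infinity>"
    "\<And>j l \<gamma>. arc_length_curve UNIV l \<gamma> \<Longrightarrow> line_integral l \<gamma> (\<rho> j) < \<infinity> \<Longrightarrow> P j l \<gamma>"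
    by blast
  note [measurable] = \<rho>(1)
  obtain c where c: "\<And>j. 0 < c j" "energy p M (\<lambda>x. SUP j. ennreal (c j) * \<rho> j x) < \<infinity>"
    using energy_scaled_SUP_finite[OF p_pos, of \<rho> M] \<rho> borel_measurable_M by blast
  let ?\<sigma> = "\<lambda>x. SUP j. ennreal (c j) * \<rho> j x"
  show ?thesis unfolding ae_curve_def
  proof (intro bexI[of _ ?\<sigma>] conjI allI impI c(2))
    fix l and \<gamma> :: "real \<Rightarrow> 'a" and j
    assume \<gamma>: "arc_length_curve UNIV l \<gamma>" "line_integral l \<gamma> ?\<sigma> < \<infinity>"
    have "ennreal (c j) * line_integral l \<gamma> (\<rho> j) = line_integral l \<gamma> (\<lambda>x. ennreal (c j) * \<rho> j x)"
      using line_integral_cmult[OF \<gamma>(1) \<rho>(1), of 0 l] by (simp add: line_integral_eq_seg)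
    also have "\<dots> \<le> line_integral l \<gamma> ?\<sigma>"
      by (intro line_integral_mono SUP_upper) simp
    finally have "ennreal (c j) * line_integral l \<gamma> (\<rho> j) < \<infinity>" using \<gamma>(2) by (rule le_less_trans)
    then have "line_integral l \<gamma> (\<rho> j) < \<infinity>" using c(1)[of j] by (auto simp: ennreal_mult_less_top)
    then show "P j l \<gamma>" by (rule \<rho>(3)[OF \<gamma>(1)])
  qed measurable
qed

lemma ae_curve_conj: "ae_curve P \<Longrightarrow> ae_curve Q \<Longrightarrow> ae_curve (\<lambda>l \<gamma>. P l \<gamma> \<and> Q l \<gamma>)"
proof (rule ae_curve_mono[OF ae_curve_all[of "\<lambda>j. if j = 0 then P else Q"]])
  fix l and \<gamma> :: "real \<Rightarrow> 'a" assume *: "\<forall>j::nat. (if j = 0 then P else Q) l \<gamma>"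
  show "P l \<gamma> \<and> Q l \<gamma>" using *[rule_format, of 0] *[rule_format, of 1] by simp
qed simp

text \<open>
  The sets of Sobolev capacity zero (lemma \<open>polar_iff\<close> below), described so that countable unions
  and curve arguments are immediate.
\<close>
definition polar :: "'a set \<Rightarrow> bool" where
  "polar A \<longleftrightarrow> A \<in> null_sets M \<and> ae_curve (\<lambda>l \<gamma>. \<forall>t. 0 \<le> t \<and> t \<le> l \<longrightarrow> \<gamma> t \<notin> A)"

lemma polar_subset: "polar B \<Longrightarrow> A \<subseteq> B \<Longrightarrow> polar A"
  unfolding polar_def using complete2 by (auto elim!: ae_curve_mono)

lemma polar_UN:
  assumes "\<And>j::nat. polar (A j)"
  shows "polar (\<Union>j. A j)"
  unfolding polar_def
proof
  show "(\<Union>j. A j) \<in> null_sets M" using assms by (intro null_sets_UN) (simp add: polar_def)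
  have "ae_curve (\<lambda>l \<gamma>. \<forall>j t. 0 \<le> t \<and> t \<le> l \<longrightarrow> \<gamma> t \<notin> A j)"
    using assms by (intro ae_curve_all) (simp add: polar_def)
  then show "ae_curve (\<lambda>l \<gamma>. \<forall>t. 0 \<le> t \<and> t \<le> l \<longrightarrow> \<gamma> t \<notin> (\<Union>j. A j))"
    by (rule ae_curve_mono) auto
qed

lemma polar_empty: "polar {}"
  unfolding polar_def by (auto simp: energy_def intro!: ae_curve_mono[OF ae_curve_finite[of "\<lambda>_. 0"]])

lemma polar_Un: assumes "polar A" "polar B" shows "polar (A \<union> B)"
proof -
  have "polar (\<Union>j::nat. if j = 0 then A else B)"
    using assms by (intro polar_UN) auto
  moreover have "A \<union> B \<subseteq> (\<Union>j::nat. if j = 0 then A else B)"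
    by (auto intro: exI[of _ "0::nat"] exI[of _ "1::nat"] split: if_splits)
  ultimately show ?thesis by (rule polar_subset)
qed

lemma energy_finite_AE:
  assumes "f \<in> borel_measurable M" "energy p M f < \<infinity>"
  shows "AE x in M. f x < \<infinity>"
proof -
  have "AE x in M. epowr (f x) p \<noteq> \<infinity>"
    using assms by (intro nn_integral_noteq_infinite) (auto simp: energy_def)
  then show ?thesis by eventually_elim (metis epowr_top(1) infinity_ennreal_def top.not_eq_extremum)
qed

lemma energy_null_modification:
  assumes "B \<in> null_sets M"
  shows "energy p M (\<lambda>x. if x \<in> B then h x else g x) = energy p M g"
  unfolding energy_def using AE_not_in[OF assms] by (intro nn_integral_cong_AE) auto

text \<open>
  The workhorse for polarity. The weighted supremum \<open>V\<close> is finite almost everywhere, and along a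
  curve it changes by at most the integral of the corresponding supremum \<open>h\<close> of upper gradients.
  So a curve that reaches \<open>V = \<infinity>\<close> either contains a point with \<open>V < \<infinity>\<close>, and then \<open>h\<close> has infinite
  integral, or it lies in \<open>{V = \<infinity>}\<close> completely; these curves are caught by adding the value
  \<open>\<infinity>\<close> on a Borel null set containing \<open>{V = \<infinity>}\<close>.
\<close>
lemma polar_infinity_set:
  fixes w :: "nat \<Rightarrow> 'a \<Rightarrow> ereal" and c :: "nat \<Rightarrow> real"
  assumes w: "\<And>j. w j \<in> borel_measurable M"
    and g: "\<And>j. g j \<in> borel_measurable borel" "\<And>j. upper_gradient UNIV (w j) (g j)"
    and fin: "energy p M (\<lambda>x. SUP j. ennreal (c j) * e2ennreal \<bar>w j x\<bar>) < \<infinity>"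
      "energy p M (\<lambda>x. SUP j. ennreal (c j) * g j x) < \<infinity>"
  shows "polar {x. (SUP j. ennreal (c j) * e2ennreal \<bar>w j x\<bar>) = \<infinity>}"
proof -
  define V where "V x = (SUP j. ennreal (c j) * e2ennreal \<bar>w j x\<bar>)" for x
  define h where "h x = (SUP j. ennreal (c j) * g j x)" for x
  note [measurable] = w g(1)
  have h[measurable]: "h \<in> borel_measurable borel" unfolding h_def by measurable
  have [measurable]: "V \<in> borel_measurable M" unfolding V_def by measurable
  have "AE x in M. V x < \<infinity>" using fin(1) by (intro energy_finite_AE) (auto simp: V_def)
  then have null: "{x. V x = \<infinity>} \<in> null_sets M"
    unfolding AE_iff_null_sets by (simp add: less_top[symmetric])
  then obtain B where B: "B \<in> sets borel" "B \<in> null_sets M" "{x. V x = \<infinity>} \<subseteq> B"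
    by (rule null_borel_superset)
  note [measurable] = B(1)
  \<comment> \<open>the value \<open>\<infinity>\<close> on \<open>B\<close> catches the curves on which \<open>V\<close> is infinite throughout\<close>
  define \<rho> where "\<rho> x = (if x \<in> B then \<infinity> else h x)" for x
  have h_le: "h x \<le> \<rho> x" for x by (simp add: \<rho>_def)
  have V_le: "V (\<gamma> t) \<le> V (\<gamma> s) + line_integral l \<gamma> h"
    if \<gamma>: "arc_length_curve UNIV l \<gamma>" and st: "0 \<le> s" "s \<le> l" "0 \<le> t" "t \<le> l" for l \<gamma> s t
  proof (cases "s = t")
    case False
    define a b where "a = min s t" and "b = max s t"
    have ab: "0 \<le> a" "a < b" "b \<le> l" using st False by (auto simp: a_def b_def)
    have "ennreal (c j) * e2ennreal \<bar>w j (\<gamma> t)\<bar> \<le> V (\<gamma> s) + line_integral l \<gamma> h" for j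
    proof -
      have "ext_diff (w j (\<gamma> t)) (w j (\<gamma> s)) \<le> seg_integral (\<lambda>t. g j (\<gamma> t)) a b"
        using upper_gradient_sub[OF g(2,1) \<gamma> ab] ext_diff_commute
        by (cases "s \<le> t") (auto simp: a_def b_def)
      then have "ennreal (c j) * ext_diff (w j (\<gamma> t)) (w j (\<gamma> s))
          \<le> ennreal (c j) * seg_integral (\<lambda>t. g j (\<gamma> t)) a b"
        by (intro mult_left_mono) auto
      also have "\<dots> = seg_integral (\<lambda>t. ennreal (c j) * g j (\<gamma> t)) a b"
        using line_integral_cmult[OF \<gamma> g(1)] ab by simp
      also have "\<dots> \<le> seg_integral (\<lambda>t. h (\<gamma> t)) a b"
        unfolding h_def by (intro seg_integral_mono SUP_upper) simp
      also have "\<dots> \<le> line_integral l \<gamma> h"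
        unfolding line_integral_eq_seg using ab by (intro seg_integral_subset) auto
      finally have 1: "ennreal (c j) * ext_diff (w j (\<gamma> t)) (w j (\<gamma> s)) \<le> line_integral l \<gamma> h" .
      have "ennreal (c j) * e2ennreal \<bar>w j (\<gamma> t)\<bar>
          \<le> ennreal (c j) * (e2ennreal \<bar>w j (\<gamma> s)\<bar> + ext_diff (w j (\<gamma> t)) (w j (\<gamma> s)))"
        by (intro mult_left_mono e2ennreal_abs_le_ext_diff) simp
      also have "\<dots> \<le> V (\<gamma> s) + line_integral l \<gamma> h"
        unfolding distrib_left V_def by (intro add_mono 1 SUP_upper) simp
      finally show ?thesis .
    qed
    then show ?thesis unfolding V_def[of "\<gamma> t"] by (intro SUP_least)
  qed simp
  have \<rho>_fin: "energy p M \<rho> < \<infinity>"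
    unfolding \<rho>_def energy_null_modification[OF B(2)] using fin(2) by (simp add: h_def)
  have \<rho>_meas: "\<rho> \<in> borel_measurable borel" unfolding \<rho>_def by measurable
  have "ae_curve (\<lambda>l \<gamma>. \<forall>t. 0 \<le> t \<and> t \<le> l \<longrightarrow> \<gamma> t \<notin> {x. V x = \<infinity>})"
  proof (rule ae_curve_mono[OF ae_curve_finite[OF \<rho>_meas \<rho>_fin]], intro allI impI notI)
    fix l \<gamma> t
    assume \<gamma>: "arc_length_curve UNIV l \<gamma>" and \<rho>: "line_integral l \<gamma> \<rho> < \<infinity>"
      and t: "0 \<le> t \<and> t \<le> l" "\<gamma> t \<in> {x. V x = \<infinity>}"
    show False
    proof (cases "\<forall>s. 0 \<le> s \<and> s \<le> l \<longrightarrow> V (\<gamma> s) = \<infinity>")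
      case True
      then have "line_integral l \<gamma> \<rho> = seg_integral (\<lambda>_. \<infinity>) 0 l"
        unfolding line_integral_eq_seg using B(3) by (intro seg_integral_cong) (auto simp: \<rho>_def)
      then show ?thesis
        using \<rho> \<gamma> by (simp add: seg_integral_const ennreal_top_mult arc_length_curve_def)
    next
      case False
      then obtain s where s: "0 \<le> s" "s \<le> l" "V (\<gamma> s) \<noteq> \<infinity>" by auto
      have "V (\<gamma> t) \<le> V (\<gamma> s) + line_integral l \<gamma> h" using t s by (intro V_le \<gamma>) auto
      then have "line_integral l \<gamma> h = \<infinity>" using t s(3) by (auto simp: top_unique)
      then show ?thesis using line_integral_mono[of h \<rho> l \<gamma>, OF h_le] \<rho> by (simp add: top_unique)
    qed
  qed
  then have "polar {x. V x = \<infinity>}" using null by (simp add: polar_def)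
  then show ?thesis by (simp add: V_def)
qed

end


section \<open>Newtonian functions and capacity zero\<close>

lemma e2ennreal_0 [simp]: "e2ennreal 0 = 0" and e2ennreal_1 [simp]: "e2ennreal 1 = 1"
  by (simp_all add: zero_ereal_def one_ereal_def e2ennreal_ereal)

lemma one_le_e2ennreal_abs:
  assumes "1 \<le> x" shows "1 \<le> e2ennreal \<bar>x\<bar>"
proof -
  have "1 \<le> \<bar>x\<bar>" using assms by (cases x) auto
  then show ?thesis using e2ennreal_mono[of 1 "\<bar>x\<bar>"] by simp
qed

lemma measurable_restrict_UNIV: "measurable (restrict_space M UNIV) N = measurable M N"
  by (rule measurable_cong_sets) (simp_all add: sets_restrict_UNIV)

lemma upper_gradient_times_indicator:
  assumes "upper_gradient S f g" "S \<in> sets borel"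
  shows "upper_gradient S f (\<lambda>x. g x * indicator S x)"
    "(\<lambda>x. g x * indicator S x) \<in> borel_measurable borel"
proof -
  show "(\<lambda>x. g x * indicator S x) \<in> borel_measurable borel"
    using assms by (subst borel_measurable_restrict_space_iff_ennreal[symmetric])
      (auto simp: upper_gradient_def)
  then have "(\<lambda>x. g x * indicator S x) \<in> borel_measurable (restrict_space borel S)"
    by (rule measurable_restrict_space1)
  moreover have "line_integral l \<gamma> (\<lambda>x. g x * indicator S x) = line_integral l \<gamma> g"
    if "arc_length_curve S l \<gamma>" for l \<gamma>
    unfolding line_integral_eq_seg using that
    by (intro seg_integral_cong) (auto simp: arc_length_curve_def image_subset_iff)
  ultimately show "upper_gradient S f (\<lambda>x. g x * indicator S x)"
    using assms by (auto simp: upper_gradient_def)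
qed

lemma upper_gradient_borel: "upper_gradient UNIV f g \<Longrightarrow> g \<in> borel_measurable borel"
  by (simp add: upper_gradient_def measurable_restrict_UNIV)

context newton_space
begin

text \<open>
  The infimum in the Newtonian norm need not be attained, but a strict bound passes to a single
  upper gradient.
\<close>
lemma newton_norm_less:
  assumes "epowr (newton_norm p M S f) p < e"
  obtains g where "upper_gradient S f g"
    "(\<integral>\<^sup>+x\<in>S. epowr (e2ennreal \<bar>f x\<bar>) p \<partial>M) + (\<integral>\<^sup>+x\<in>S. epowr (g x) p \<partial>M) < e"
proof -
  let ?A = "\<integral>\<^sup>+x\<in>S. epowr (e2ennreal \<bar>f x\<bar>) p \<partial>M"
  let ?I = "INF g\<in>{g. upper_gradient S f g}. \<integral>\<^sup>+x\<in>S. epowr (g x) p \<partial>M"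
  have *: "?A + ?I < e"
    using assms p_pos by (simp add: newton_norm_def epowr_inverse)
  have "\<exists>g. upper_gradient S f g \<and> ?A + (\<integral>\<^sup>+x\<in>S. epowr (g x) p \<partial>M) < e"
  proof (rule ccontr)
    assume "\<not> ?thesis"
    then have "e \<le> ?A + (\<integral>\<^sup>+x\<in>S. epowr (g x) p \<partial>M)" if "upper_gradient S f g" for g
      using that by (auto simp: not_less)
    moreover have A: "?A \<noteq> top" using * by auto
    ultimately have 1: "e - ?A \<le> ?I"
      by (intro INF_greatest) (auto simp: ennreal_minus_le_iff)
    then have "e \<le> ?A + ?I" using A by (simp add: ennreal_minus_le_iff)
    with * show False by simp
  qed
  then show thesis using that by blast
qed

lemma newton_norm_le:
  assumes "upper_gradient UNIV f g"
  shows "epowr (newton_norm p M UNIV f) p \<le> energy p M (\<lambda>x. e2ennreal \<bar>f x\<bar>) + energy p M g"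
proof -
  have "(INF g\<in>{g. upper_gradient UNIV f g}. \<integral>\<^sup>+x\<in>UNIV. epowr (g x) p \<partial>M) \<le> energy p M g"
    using assms by (intro INF_lower2[of g]) (auto simp: energy_def)
  then show ?thesis
    using p_pos unfolding newton_norm_def by (simp add: epowr_inverse energy_def add_mono)
qed

lemma newtonianD:
  assumes "f \<in> newtonian p M S" "S \<in> sets borel"
  obtains g where "g \<in> borel_measurable borel" "upper_gradient S f g"
    "energy p M g < \<infinity>"
    "(\<integral>\<^sup>+x\<in>S. epowr (e2ennreal \<bar>f x\<bar>) p \<partial>M) < \<infinity>" "f \<in> borel_measurable (restrict_space M S)"
proof -
  have "epowr (newton_norm p M S f) p < \<infinity>" using assms by (simp add: newtonian_def)
  then obtain g where g: "upper_gradient S f g"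
    "(\<integral>\<^sup>+x\<in>S. epowr (e2ennreal \<bar>f x\<bar>) p \<partial>M) + (\<integral>\<^sup>+x\<in>S. epowr (g x) p \<partial>M) < \<infinity>"
    by (rule newton_norm_less)
  have "energy p M (\<lambda>x. g x * indicator S x) = (\<integral>\<^sup>+x\<in>S. epowr (g x) p \<partial>M)"
    unfolding energy_def by (intro nn_integral_cong) (auto simp: indicator_def)
  then show thesis
    using g assms by (intro that[of "\<lambda>x. g x * indicator S x"] upper_gradient_times_indicator)
      (auto simp: newtonian_def)
qed

lemma newtonian_UNIV_D:
  assumes "f \<in> newtonian p M UNIV"
  obtains g where "g \<in> borel_measurable borel" "upper_gradient UNIV f g" "energy p M g < \<infinity>"
    "energy p M (\<lambda>x. e2ennreal \<bar>f x\<bar>) < \<infinity>" "f \<in> borel_measurable M"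
  using newtonianD[OF assms, of thesis] that by (auto simp: measurable_restrict_UNIV energy_def)

lemma newtonian_UNIV_I:
  assumes "f \<in> borel_measurable M" "upper_gradient UNIV f g" "energy p M g < \<infinity>"
    "energy p M (\<lambda>x. e2ennreal \<bar>f x\<bar>) < \<infinity>"
  shows "f \<in> newtonian p M UNIV"
proof -
  have "epowr (newton_norm p M UNIV f) p < \<infinity>"
    by (rule le_less_trans[OF newton_norm_le[OF assms(2)]]) (use assms in auto)
  then show ?thesis using assms(1) by (simp add: newtonian_def measurable_restrict_UNIV)
qed

lemma newtonian_restrict:
  assumes "f \<in> newtonian p M UNIV" "S \<in> sets borel"
  shows "f \<in> newtonian p M S"
proof -
  obtain g where g: "g \<in> borel_measurable borel" "upper_gradient UNIV f g" "energy p M g < \<infinity>"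
    "energy p M (\<lambda>x. e2ennreal \<bar>f x\<bar>) < \<infinity>" "f \<in> borel_measurable M"
    using newtonian_UNIV_D[OF assms(1)] .
  have "upper_gradient S f g"
    using g(1,2) arc_length_curve_mono[of S _ _ UNIV]
    by (auto simp: upper_gradient_def intro!: measurable_restrict_space1)
  then have "(INF g\<in>{g. upper_gradient S f g}. \<integral>\<^sup>+x\<in>S. epowr (g x) p \<partial>M) \<le> (\<integral>\<^sup>+x\<in>S. epowr (g x) p \<partial>M)"
    by (intro INF_lower) auto
  also have "\<dots> \<le> energy p M g"
    unfolding energy_def by (intro nn_integral_mono) (auto simp: indicator_def)
  finally have 1: "(INF g\<in>{g. upper_gradient S f g}. \<integral>\<^sup>+x\<in>S. epowr (g x) p \<partial>M) < \<infinity>"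
    using g(3) by order
  have "(\<integral>\<^sup>+x\<in>S. epowr (e2ennreal \<bar>f x\<bar>) p \<partial>M) \<le> energy p M (\<lambda>x. e2ennreal \<bar>f x\<bar>)"
    unfolding energy_def by (intro nn_integral_mono) (auto simp: indicator_def)
  then have "(\<integral>\<^sup>+x\<in>S. epowr (e2ennreal \<bar>f x\<bar>) p \<partial>M) < \<infinity>"
    using g(4) by order
  with 1 show ?thesis using g(5) by (simp add: newtonian_def newton_norm_def measurable_restrict_space1)
qed

text \<open>
  The weights are chosen such that \<open>SUP j. 2^j |w\<^sub>j|\<close> still has finite energy although it is infinite
  wherever all \<open>w\<^sub>j\<close> are at least \<open>1\<close>.
\<close>
lemma polar_of_caps:
  fixes w :: "nat \<Rightarrow> 'a \<Rightarrow> ereal"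
  assumes w: "\<And>j. w j \<in> newtonian p M UNIV"
    and norm: "\<And>j. epowr (newton_norm p M UNIV (w j)) p < ennreal ((1/2) ^ Suc j / (2 ^ j) powr p)"
  shows "polar {x. \<forall>j. 1 \<le> w j x}"
proof -
  have "\<forall>j. \<exists>g. upper_gradient UNIV (w j) g \<and> energy p M (\<lambda>x. e2ennreal \<bar>w j x\<bar>) + energy p M g
      < ennreal ((1/2) ^ Suc j / (2 ^ j) powr p)"
  proof
    fix j
    show "\<exists>g. upper_gradient UNIV (w j) g \<and> energy p M (\<lambda>x. e2ennreal \<bar>w j x\<bar>) + energy p M g
        < ennreal ((1/2) ^ Suc j / (2 ^ j) powr p)"
      by (rule newton_norm_less[OF norm[of j]]) (auto simp: energy_def)
  qed
  then obtain g where g: "\<And>j. upper_gradient UNIV (w j) (g j)"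
    "\<And>j. energy p M (\<lambda>x. e2ennreal \<bar>w j x\<bar>) + energy p M (g j) < ennreal ((1/2) ^ Suc j / (2 ^ j) powr p)"
    by metis
  have gm: "g j \<in> borel_measurable borel" for j using g(1) by (rule upper_gradient_borel)
  have wm: "w j \<in> borel_measurable M" for j using w[of j] by (simp add: newtonian_def measurable_restrict_UNIV)
  note [measurable] = gm[THEN borel_measurable_M] wm
  have fin: "energy p M (\<lambda>x. SUP j. ennreal (2 ^ j) * h j x) < \<infinity>"
    if [measurable]: "\<And>j. h j \<in> borel_measurable M"
      and h: "\<And>j. energy p M (h j) \<le> ennreal ((1/2) ^ Suc j / (2 ^ j) powr p)" for h
  proof -
    have "energy p M (\<lambda>x. ennreal (2 ^ j) * h j x) \<le> ennreal ((1/2) ^ Suc j)" for j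
    proof -
      have "energy p M (\<lambda>x. ennreal (2 ^ j) * h j x) = ennreal ((2 ^ j) powr p) * energy p M (h j)"
        by (rule energy_cmult) auto
      also have "\<dots> \<le> ennreal ((2 ^ j) powr p) * ennreal ((1/2) ^ Suc j / (2 ^ j) powr p)"
        by (intro mult_left_mono h) simp
      also have "\<dots> = ennreal ((2 ^ j) powr p * ((1/2) ^ Suc j / (2 ^ j) powr p))"
        by (rule ennreal_mult[symmetric]) auto
      also have "(2 ^ j) powr p * ((1/2) ^ Suc j / (2 ^ j) powr p) = (1/2) ^ Suc j"
        by (rule nonzero_mult_div_cancel_left[of "(2 ^ j) powr p", folded times_divide_eq_right]) simp
      finally show ?thesis .
    qed
    then have "(\<Sum>j. energy p M (\<lambda>x. ennreal (2 ^ j) * h j x)) \<le> (\<Sum>j. ennreal ((1/2) ^ Suc j))"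
      by (intro suminf_le summableI)
    then have "energy p M (\<lambda>x. SUP j. ennreal (2 ^ j) * h j x) \<le> 1"
      using energy_SUP_le[of p "\<lambda>j x. ennreal (2 ^ j) * h j x" M] p_pos
      unfolding ennreal_half_powers by (auto intro: order_trans)
    then show ?thesis by (metis ennreal_one_less_top infinity_ennreal_def order_le_less_trans)
  qed
  have "polar {x. (SUP j. ennreal (2 ^ j) * e2ennreal \<bar>w j x\<bar>) = \<infinity>}"
  proof (rule polar_infinity_set[of w g])
    show "energy p M (\<lambda>x. SUP j. ennreal (2 ^ j) * e2ennreal \<bar>w j x\<bar>) < \<infinity>"
      by (intro fin order_trans[OF _ less_imp_le[OF g(2)]]) (auto simp: add_increasing2)
    show "energy p M (\<lambda>x. SUP j. ennreal (2 ^ j) * g j x) < \<infinity>"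
      by (intro fin order_trans[OF _ less_imp_le[OF g(2)]]) (auto simp: add_increasing)
  qed (use g gm wm in auto)
  moreover have "(SUP j. ennreal (2 ^ j) * e2ennreal \<bar>w j x\<bar>) = \<infinity>" if x: "\<forall>j. 1 \<le> w j x" for x
  proof -
    have "of_nat n \<le> (SUP j. ennreal (2 ^ j) * e2ennreal \<bar>w j x\<bar>)" for n
    proof -
      have 1: "1 \<le> e2ennreal \<bar>w n x\<bar>" using x by (intro one_le_e2ennreal_abs) auto
      have "of_nat n = ennreal (real n)" by (simp add: ennreal_of_nat_eq_real_of_nat)
      also have "\<dots> \<le> ennreal (2 ^ n)" using of_nat_less_two_power[of n] by (intro ennreal_leI) (simp add: less_imp_le)
      also have "\<dots> \<le> ennreal (2 ^ n) * e2ennreal \<bar>w n x\<bar>"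
        using mult_left_mono[OF 1, of "ennreal (2 ^ n)"] by simp
      also have "\<dots> \<le> (SUP j. ennreal (2 ^ j) * e2ennreal \<bar>w j x\<bar>)" by (rule SUP_upper) simp
      finally show ?thesis .
    qed
    then show ?thesis by (metis ennreal_Ex_less_of_nat infinity_ennreal_def leD top.not_eq_extremum)
  qed
  ultimately show ?thesis by (elim polar_subset) blast
qed

lemma sobolev_cap_less:
  assumes "sobolev_cap p M A < e"
  obtains u where "u \<in> newtonian p M UNIV" "\<And>x. x \<in> A \<Longrightarrow> 1 \<le> u x"
    "epowr (newton_norm p M UNIV u) p < e"
  using assms unfolding sobolev_cap_def INF_less_iff by auto

lemma cap_weight_pos: "0 < ennreal ((1/2) ^ Suc j / (2 ^ j) powr p)"
  by simp

text \<open>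
  If \<open>\<rho>\<close> has infinite integral along every curve that meets \<open>A\<close>, then \<open>c \<rho>\<close> is an upper gradient of
  the indicator for every \<open>c > 0\<close>; let \<open>c\<close> tend to \<open>0\<close>.
\<close>
lemma indicator_polar_norm:
  assumes "polar A"
  shows "(\<lambda>x. indicator A x) \<in> newtonian p M UNIV"
    and "newton_norm p M UNIV (\<lambda>x. indicator A x) = 0"
proof -
  obtain \<rho> where \<rho>: "\<rho> \<in> borel_measurable borel" "energy p M \<rho> < \<infinity>"
    "\<And>l \<gamma> t. arc_length_curve UNIV l \<gamma> \<Longrightarrow> 0 \<le> t \<Longrightarrow> t \<le> l \<Longrightarrow> \<gamma> t \<in> A \<Longrightarrow> \<not> line_integral l \<gamma> \<rho> < \<infinity>"
    and A: "A \<in> null_sets M"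
    using assms unfolding polar_def ae_curve_def by blast
  have [measurable]: "A \<in> sets M" using A by auto
  let ?f = "\<lambda>x. indicator A x :: ereal"
  have ug: "upper_gradient UNIV ?f (\<lambda>x. ennreal c * \<rho> x)" if "0 < c" for c
    unfolding upper_gradient_def
  proof (intro conjI allI impI)
    show "(\<lambda>x. ennreal c * \<rho> x) \<in> borel_measurable (restrict_space borel UNIV)"
      using \<rho>(1) by (simp add: measurable_restrict_UNIV)
    fix l and \<gamma> :: "real \<Rightarrow> 'a" assume \<gamma>: "arc_length_curve UNIV l \<gamma>"
    then have l: "0 < l" by (simp add: arc_length_curve_def)
    show "ext_diff (?f (\<gamma> 0)) (?f (\<gamma> l)) \<le> line_integral l \<gamma> (\<lambda>x. ennreal c * \<rho> x)"
    proof (cases "\<gamma> 0 \<in> A \<or> \<gamma> l \<in> A")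
      case True
      then have "line_integral l \<gamma> \<rho> = \<infinity>"
        using \<rho>(3)[OF \<gamma>, of 0] \<rho>(3)[OF \<gamma>, of l] l by (auto simp flip: top.not_eq_extremum)
      then show ?thesis using line_integral_cmult[OF \<gamma> \<rho>(1), of 0 l "ennreal c"] that
        by (simp add: line_integral_eq_seg ennreal_mult_top)
    next
      case False
      then show ?thesis by (simp add: zero_ereal_def)
    qed
  qed
  have en0: "energy p M (\<lambda>x. e2ennreal \<bar>?f x\<bar>) = 0"
  proof -
    have "energy p M (\<lambda>x. e2ennreal \<bar>?f x\<bar>) = (\<integral>\<^sup>+x. 0 \<partial>M)"
      unfolding energy_def using AE_not_in[OF A] by (intro nn_integral_cong_AE) auto
    then show ?thesis by simp
  qed
  have cm: "energy p M (\<lambda>x. ennreal c * \<rho> x) = ennreal (c powr p) * energy p M \<rho>" if "0 < c" for c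
    using that \<rho>(1) by (intro energy_cmult borel_measurable_M)
  show mem: "?f \<in> newtonian p M UNIV"
    using cm[of 1] \<rho>(2) en0 by (intro newtonian_UNIV_I[OF _ ug[of 1]]) auto
  have "epowr (newton_norm p M UNIV ?f) p \<le> ennreal (c powr p) * energy p M \<rho>" if "0 < c" for c
    using newton_norm_le[OF ug[OF that]] unfolding en0 cm[OF that] by simp
  then have *: "epowr (newton_norm p M UNIV ?f) p \<le> ennreal ((e powr (1/p)) powr p) * energy p M \<rho>" if "0 < e" for e
    using that by simp
  have "epowr (newton_norm p M UNIV ?f) p \<le> 0"
  proof (rule ennreal_le_epsilon)
    fix e :: real assume e: "0 < e"
    obtain K where K: "energy p M \<rho> = ennreal K" "0 \<le> K" using \<rho>(2) by (cases "energy p M \<rho>") auto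
    have "epowr (newton_norm p M UNIV ?f) p \<le> ennreal (((e / (K + 1)) powr (1/p)) powr p) * energy p M \<rho>"
      using e K(2) by (intro *) simp
    also have "\<dots> = ennreal (e / (K + 1) * K)"
      using e K p_pos by (simp add: powr_powr flip: ennreal_mult)
    also have "\<dots> \<le> ennreal e"
      using e K(2) by (intro ennreal_leI) (simp add: field_simps)
    finally show "epowr (newton_norm p M UNIV ?f) p \<le> 0 + ennreal e" by simp
  qed
  then show "newton_norm p M UNIV ?f = 0" by simp
qed

lemma polar_iff: "sobolev_cap p M A = 0 \<longleftrightarrow> polar A"
proof
  assume 0: "sobolev_cap p M A = 0"
  have "\<exists>u. u \<in> newtonian p M UNIV \<and> (\<forall>x\<in>A. 1 \<le> u x) \<and>
      epowr (newton_norm p M UNIV u) p < ennreal ((1/2) ^ Suc j / (2 ^ j) powr p)" for j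
    using sobolev_cap_less[of A "ennreal ((1/2) ^ Suc j / (2 ^ j) powr p)"] 0 cap_weight_pos[of j] by metis
  then obtain u where u: "\<And>j. u j \<in> newtonian p M UNIV" "\<And>j x. x \<in> A \<Longrightarrow> 1 \<le> u j x"
    "\<And>j. epowr (newton_norm p M UNIV (u j)) p < ennreal ((1/2) ^ Suc j / (2 ^ j) powr p)"
    by metis
  show "polar A" using polar_of_caps[of u] u by (auto intro: polar_subset)
next
  assume "polar A"
  then have "sobolev_cap p M A \<le> epowr (newton_norm p M UNIV (\<lambda>x. indicator A x)) p"
    unfolding sobolev_cap_def by (intro INF_lower) (auto simp: indicator_polar_norm)
  then show "sobolev_cap p M A = 0" using indicator_polar_norm[OF \<open>polar A\<close>] by simp
qed

lemma polar_infinite: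
  assumes "u \<in> newtonian p M UNIV"
  shows "polar {x. \<bar>u x\<bar> = \<infinity>}"
proof -
  obtain g where g: "g \<in> borel_measurable borel" "upper_gradient UNIV u g" "energy p M g < \<infinity>"
    "energy p M (\<lambda>x. e2ennreal \<bar>u x\<bar>) < \<infinity>" "u \<in> borel_measurable M"
    using newtonian_UNIV_D[OF assms] .
  have "polar {x. (SUP j::nat. ennreal 1 * e2ennreal \<bar>u x\<bar>) = \<infinity>}"
    by (rule polar_infinity_set[of "\<lambda>_. u" "\<lambda>_. g"]) (use g in auto)
  then show ?thesis by (rule polar_subset) auto
qed

text \<open>
  Real-valued Newtonian functions on the whole space. All test functions are of this kind, which
  avoids the undefined differences of infinite values.
\<close>
definition newt :: "('a \<Rightarrow> real) set" where
  "newt = {f. (\<lambda>x. ereal (f x)) \<in> newtonian p M UNIV}"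

lemma newtI:
  fixes f :: "'a \<Rightarrow> real"
  assumes "f \<in> borel_measurable M" "g \<in> borel_measurable borel" "energy p M g < \<infinity>"
    and "energy p M (\<lambda>x. ennreal \<bar>f x\<bar>) < \<infinity>"
    and "\<And>l (\<gamma> :: real \<Rightarrow> 'a). arc_length_curve UNIV l \<gamma> \<Longrightarrow> ennreal \<bar>f (\<gamma> 0) - f (\<gamma> l)\<bar> \<le> line_integral l \<gamma> g"
  shows "f \<in> newt"
  unfolding newt_def mem_Collect_eq
  by (rule newtonian_UNIV_I[of _ g])
     (use assms in \<open>auto simp: upper_gradient_def measurable_restrict_UNIV e2ennreal_ereal\<close>)

lemma newtD:
  fixes f :: "'a \<Rightarrow> real"
  assumes "f \<in> newt"
  obtains g where "f \<in> borel_measurable M" "g \<in> borel_measurable borel" "energy p M g < \<infinity>"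
    "energy p M (\<lambda>x. ennreal \<bar>f x\<bar>) < \<infinity>"
    "\<And>l (\<gamma> :: real \<Rightarrow> 'a). arc_length_curve UNIV l \<gamma> \<Longrightarrow> ennreal \<bar>f (\<gamma> 0) - f (\<gamma> l)\<bar> \<le> line_integral l \<gamma> g"
    "\<And>l (\<gamma> :: real \<Rightarrow> 'a) a b. arc_length_curve UNIV l \<gamma> \<Longrightarrow> 0 \<le> a \<Longrightarrow> a \<le> b \<Longrightarrow> b \<le> l \<Longrightarrow>
       ennreal \<bar>f (\<gamma> a) - f (\<gamma> b)\<bar> \<le> seg_integral (\<lambda>t. g (\<gamma> t)) a b"
proof -
  obtain g where g: "g \<in> borel_measurable borel" "upper_gradient UNIV (\<lambda>x. ereal (f x)) g" "energy p M g < \<infinity>"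
    "energy p M (\<lambda>x. e2ennreal \<bar>ereal (f x)\<bar>) < \<infinity>" "(\<lambda>x. ereal (f x)) \<in> borel_measurable M"
    using newtonian_UNIV_D assms unfolding newt_def by blast
  have *: "ennreal \<bar>f (\<gamma> a) - f (\<gamma> b)\<bar> \<le> seg_integral (\<lambda>t. g (\<gamma> t)) a b"
    if "arc_length_curve UNIV l \<gamma>" "0 \<le> a" "a \<le> b" "b \<le> l" for l \<gamma> a b
    using upper_gradient_sub[OF g(2,1) that(1,2) _ that(4)] that(3) by (cases "a = b") auto
  show thesis
  proof (rule that[of g])
    show "f \<in> borel_measurable M" using g(5) by (simp add: borel_measurable_ereal_iff)
    fix l and \<gamma> :: "real \<Rightarrow> 'a" assume "arc_length_curve UNIV l \<gamma>"
    then show "ennreal \<bar>f (\<gamma> 0) - f (\<gamma> l)\<bar> \<le> line_integral l \<gamma> g"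
      unfolding line_integral_eq_seg by (intro *) (auto simp: arc_length_curve_def)
  qed (use g * in \<open>auto simp: e2ennreal_ereal\<close>)
qed

lemma newt_measurable: "f \<in> newt \<Longrightarrow> f \<in> borel_measurable M"
  by (elim newtD)

text \<open>
  Sums, multiples and Lipschitz images are all of this form, and the constant \<open>K\<close> only rescales the
  sum of two upper gradients.
\<close>
lemma newt_combine:
  assumes "f1 \<in> newt" "f2 \<in> newt" and meas: "f \<in> borel_measurable M"
    and size: "\<And>x. \<bar>f x\<bar> \<le> K * (\<bar>f1 x\<bar> + \<bar>f2 x\<bar>)"
    and diff: "\<And>x y. \<bar>f x - f y\<bar> \<le> K * (\<bar>f1 x - f1 y\<bar> + \<bar>f2 x - f2 y\<bar>)"
  shows "f \<in> newt"
proof -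
  obtain g1 where g1: "f1 \<in> borel_measurable M" "g1 \<in> borel_measurable borel" "energy p M g1 < \<infinity>"
    "energy p M (\<lambda>x. ennreal \<bar>f1 x\<bar>) < \<infinity>"
    "\<And>l (\<gamma> :: real \<Rightarrow> 'a). arc_length_curve UNIV l \<gamma> \<Longrightarrow> ennreal \<bar>f1 (\<gamma> 0) - f1 (\<gamma> l)\<bar> \<le> line_integral l \<gamma> g1"
    using newtD[OF assms(1)] by metis
  obtain g2 where g2: "f2 \<in> borel_measurable M" "g2 \<in> borel_measurable borel" "energy p M g2 < \<infinity>"
    "energy p M (\<lambda>x. ennreal \<bar>f2 x\<bar>) < \<infinity>"
    "\<And>l (\<gamma> :: real \<Rightarrow> 'a). arc_length_curve UNIV l \<gamma> \<Longrightarrow> ennreal \<bar>f2 (\<gamma> 0) - f2 (\<gamma> l)\<bar> \<le> line_integral l \<gamma> g2"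
    using newtD[OF assms(2)] by metis
  note [measurable] = g1(1,2) g2(1,2)
  \<comment> \<open>a positive constant, also if \<open>K \<le> 0\<close>\<close>
  define k where "k = max K 1"
  have k: "0 < k" by (simp add: k_def)
  have up: "ennreal z \<le> ennreal k * (ennreal a + ennreal b)"
    if "z \<le> K * (a + b)" "0 \<le> a" "0 \<le> b" for z a b
  proof -
    have "K * (a + b) \<le> k * (a + b)" unfolding k_def using that by (intro mult_right_mono) auto
    then have "ennreal z \<le> ennreal (k * (a + b))" using that by (intro ennreal_leI) auto
    also have "\<dots> = ennreal k * (ennreal a + ennreal b)"
      using that k by (simp add: ennreal_mult)
    finally show ?thesis .
  qed
  show ?thesis
  proof (rule newtI[of f "\<lambda>x. ennreal k * (g1 x + g2 x)", OF meas])
    show "(\<lambda>x. ennreal k * (g1 x + g2 x)) \<in> borel_measurable borel" by measurable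
    have "energy p M (\<lambda>x. g1 x + g2 x) < \<infinity>"
      using p_pos g1 g2 by (intro energy_add_finite borel_measurable_M) auto
    then show "energy p M (\<lambda>x. ennreal k * (g1 x + g2 x)) < \<infinity>"
      using energy_cmult[OF k, of "\<lambda>x. g1 x + g2 x" M p] g1 g2
      by (simp add: borel_measurable_M ennreal_mult_less_top)
    have "energy p M (\<lambda>x. ennreal \<bar>f x\<bar>) \<le> energy p M (\<lambda>x. ennreal k * (ennreal \<bar>f1 x\<bar> + ennreal \<bar>f2 x\<bar>))"
      using size by (intro energy_mono p_pos up) auto
    also have "\<dots> = ennreal (k powr p) * energy p M (\<lambda>x. ennreal \<bar>f1 x\<bar> + ennreal \<bar>f2 x\<bar>)"
      by (rule energy_cmult[OF k]) measurable
    also have "\<dots> < \<infinity>"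
      using energy_add_finite[of p "\<lambda>x. ennreal \<bar>f1 x\<bar>" M "\<lambda>x. ennreal \<bar>f2 x\<bar>"] p_pos g1(4) g2(4)
      by (simp add: ennreal_mult_less_top)
    finally show "energy p M (\<lambda>x. ennreal \<bar>f x\<bar>) < \<infinity>" .
    fix l and \<gamma> :: "real \<Rightarrow> 'a" assume \<gamma>: "arc_length_curve UNIV l \<gamma>"
    have "ennreal \<bar>f (\<gamma> 0) - f (\<gamma> l)\<bar>
        \<le> ennreal k * (ennreal \<bar>f1 (\<gamma> 0) - f1 (\<gamma> l)\<bar> + ennreal \<bar>f2 (\<gamma> 0) - f2 (\<gamma> l)\<bar>)"
      by (intro up diff) auto
    also have "\<dots> \<le> ennreal k * (line_integral l \<gamma> g1 + line_integral l \<gamma> g2)"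
      by (intro mult_left_mono add_mono g1(5)[OF \<gamma>] g2(5)[OF \<gamma>]) auto
    also have "\<dots> = line_integral l \<gamma> (\<lambda>x. ennreal k * (g1 x + g2 x))"
      using line_integral_cmult[OF \<gamma>, of "\<lambda>x. g1 x + g2 x" 0 l "ennreal k"]
        line_integral_add[OF \<gamma>, of g1 g2 0 l] g1(2) g2(2)
      by (simp add: line_integral_eq_seg)
    finally show "ennreal \<bar>f (\<gamma> 0) - f (\<gamma> l)\<bar> \<le> line_integral l \<gamma> (\<lambda>x. ennreal k * (g1 x + g2 x))" .
  qed
qed

lemma newt_lipschitz_image:
  assumes "f \<in> newt" "F 0 = 0" "\<And>s t. \<bar>F s - F t\<bar> \<le> K * \<bar>s - t\<bar>"
  shows "(\<lambda>x. F (f x)) \<in> newt"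
proof (rule newt_combine[OF assms(1,1), of _ K])
  have K: "0 \<le> K" using assms(3)[of 0 1] by simp
  have "continuous_on UNIV F"
    by (rule lipschitz_on_continuous_on[of K]) (use assms(3) K in \<open>auto simp: lipschitz_on_def dist_real_def\<close>)
  then have [measurable]: "F \<in> borel_measurable borel" by (rule borel_measurable_continuous_onI)
  note [measurable] = newt_measurable[OF assms(1)]
  show "(\<lambda>x. F (f x)) \<in> borel_measurable M" by measurable
  have *: "K * \<bar>s\<bar> \<le> K * (\<bar>s\<bar> + \<bar>s\<bar>)" for s using K by (intro mult_left_mono) auto
  show "\<bar>F (f x)\<bar> \<le> K * (\<bar>f x\<bar> + \<bar>f x\<bar>)" for x
    using assms(3)[of "f x" 0] assms(2) *[of "f x"] by simp
  show "\<bar>F (f x) - F (f y)\<bar> \<le> K * (\<bar>f x - f y\<bar> + \<bar>f x - f y\<bar>)" for x y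
    using assms(3)[of "f x" "f y"] *[of "f x - f y"] by simp
qed

lemma newt_scale: "f \<in> newt \<Longrightarrow> (\<lambda>x. c * f x) \<in> newt"
  by (rule newt_lipschitz_image[of f "\<lambda>s. c * s" "\<bar>c\<bar>"]) (auto simp: abs_mult simp flip: right_diff_distrib)

lemma newt_add: "f \<in> newt \<Longrightarrow> g \<in> newt \<Longrightarrow> (\<lambda>x. f x + g x) \<in> newt"
  by (rule newt_combine[of f g _ 1]) (auto simp: abs_le_iff newt_measurable borel_measurable_add)

lemma newt_diff: "f \<in> newt \<Longrightarrow> g \<in> newt \<Longrightarrow> (\<lambda>x. f x - g x) \<in> newt"
  by (rule newt_combine[of f g _ 1]) (auto simp: abs_le_iff newt_measurable borel_measurable_diff)

lemma newt_abs: "f \<in> newt \<Longrightarrow> (\<lambda>x. \<bar>f x\<bar>) \<in> newt"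
  by (rule newt_lipschitz_image[of f "\<lambda>s. \<bar>s\<bar>" 1]) auto

lemma newt_pos_part: "f \<in> newt \<Longrightarrow> (\<lambda>x. max 0 (f x)) \<in> newt"
  by (rule newt_lipschitz_image[of f "\<lambda>s. max 0 s" 1]) auto

end


section \<open>The lattice of weak upper gradients\<close>

lemma seg_integral_cong_open:
  assumes "\<And>t. a < t \<Longrightarrow> t < b \<Longrightarrow> k t = k' t"
  shows "seg_integral k a b = seg_integral k' a b"
  unfolding seg_integral_def
proof (rule nn_integral_cong_AE)
  show "AE t in lborel. k t * indicator {a..b} t = k' t * indicator {a..b} t"
    using AE_lborel_singleton[of a] AE_lborel_singleton[of b]
    by eventually_elim (use assms in \<open>auto simp: indicator_def\<close>)
qed

text \<open>
  The increments of \<open>h\<close> on \<open>{0..l}\<close> are bounded by the integrals of \<open>k\<close>. If \<open>h\<close> is absolutely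
  continuous this means \<open>|h'| \<le> k\<close> almost everywhere; the integrated form passes to limits directly.
\<close>
definition majorant :: "(real \<Rightarrow> real) \<Rightarrow> real \<Rightarrow> (real \<Rightarrow> ennreal) \<Rightarrow> bool" where
  "majorant h l k \<longleftrightarrow> k \<in> borel_measurable borel \<and> seg_integral k 0 l < \<infinity> \<and>
     (\<forall>a b. 0 \<le> a \<and> a \<le> b \<and> b \<le> l \<longrightarrow> ennreal \<bar>h a - h b\<bar> \<le> seg_integral k a b)"

lemma majorant_limit:
  fixes k :: "nat \<Rightarrow> real \<Rightarrow> ennreal"
  assumes maj: "\<And>n. majorant h l (k n)" and le: "\<And>n t. k n t \<le> K t" and K: "K \<in> borel_measurable borel"
    and fin: "seg_integral K 0 l < \<infinity>" and lim: "\<And>t. (\<lambda>n. k n t) \<longlonglongrightarrow> k' t"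
  shows "majorant h l k'"
proof -
  have km [measurable]: "k n \<in> borel_measurable borel" for n using maj by (simp add: majorant_def)
  have [measurable]: "k' \<in> borel_measurable borel"
    by (rule borel_measurable_LIMSEQ_order[OF lim km])
  note [measurable] = K
  have conv: "(\<lambda>n. seg_integral (k n) a b) \<longlonglongrightarrow> seg_integral k' a b" if "0 \<le> a" "b \<le> l" for a b
    unfolding seg_integral_def
  proof (rule nn_integral_dominated_convergence[where w = "\<lambda>t. K t * indicator {a..b} t"])
    have "seg_integral K a b \<le> seg_integral K 0 l" using that by (intro seg_integral_subset)
    then show "(\<integral>\<^sup>+t\<in>{a..b}. K t \<partial>lborel) < \<infinity>" using fin by (simp add: seg_integral_def)
    show "AE t in lborel. (\<lambda>n. k n t * indicator {a..b} t) \<longlonglongrightarrow> k' t * indicator {a..b} t"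
      using lim by (auto simp: indicator_def)
  qed (use le in \<open>auto simp: indicator_def\<close>)
  show ?thesis unfolding majorant_def
  proof (intro conjI allI impI)
    have "k' t \<le> K t" for t by (rule LIMSEQ_le_const2[OF lim]) (use le in auto)
    then have "seg_integral k' 0 l \<le> seg_integral K 0 l" by (intro seg_integral_mono)
    then show "seg_integral k' 0 l < \<infinity>" using fin by order
    fix a b assume "0 \<le> a \<and> a \<le> b \<and> b \<le> l"
    then show "ennreal \<bar>h a - h b\<bar> \<le> seg_integral k' a b"
      using maj by (intro LIMSEQ_le_const[OF conv]) (auto simp: majorant_def)
  qed simp
qed

lemma majorant_splice_atMost:
  assumes "majorant h l k1" "majorant h l k2"
  shows "majorant h l (\<lambda>t. if t \<le> c then k1 t else k2 t)"
proof -
  let ?k = "\<lambda>t. if t \<le> c then k1 t else k2 t"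
  have [measurable]: "k1 \<in> borel_measurable borel" "k2 \<in> borel_measurable borel"
    using assms by (auto simp: majorant_def)
  have m: "?k \<in> borel_measurable borel" by measurable
  show ?thesis unfolding majorant_def
  proof (intro conjI allI impI m)
    have "seg_integral ?k 0 l \<le> seg_integral (\<lambda>t. k1 t + k2 t) 0 l"
      by (intro seg_integral_mono) (auto simp: add_increasing add_increasing2)
    also have "\<dots> = seg_integral k1 0 l + seg_integral k2 0 l"
      unfolding seg_integral_def by (subst nn_integral_add[symmetric]) (auto simp: distrib_right)
    also have "\<dots> < \<infinity>" using assms by (simp add: majorant_def)
    finally show "seg_integral ?k 0 l < \<infinity>" .
    fix a b assume ab: "0 \<le> a \<and> a \<le> b \<and> b \<le> l"
    have maj: "ennreal \<bar>h s - h t\<bar> \<le> seg_integral k1 s t" "ennreal \<bar>h s - h t\<bar> \<le> seg_integral k2 s t"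
      if "a \<le> s" "s \<le> t" "t \<le> b" for s t
      using assms ab that by (auto simp: majorant_def)
    consider "c \<le> a" | "b \<le> c" | "a \<le> c" "c \<le> b" by linarith
    then show "ennreal \<bar>h a - h b\<bar> \<le> seg_integral ?k a b"
    proof cases
      case 1
      then have "seg_integral ?k a b = seg_integral k2 a b" by (intro seg_integral_cong_open) auto
      then show ?thesis using maj(2)[of a b] ab by simp
    next
      case 2
      then have "seg_integral ?k a b = seg_integral k1 a b" by (intro seg_integral_cong_open) auto
      then show ?thesis using maj(1)[of a b] ab by simp
    next
      case 3
      have "ennreal \<bar>h a - h b\<bar> \<le> ennreal (\<bar>h a - h c\<bar> + \<bar>h c - h b\<bar>)" by (intro ennreal_leI) auto
      also have "\<dots> = ennreal \<bar>h a - h c\<bar> + ennreal \<bar>h c - h b\<bar>" by (rule ennreal_plus) auto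
      also have "\<dots> \<le> seg_integral k1 a c + seg_integral k2 c b"
        using 3 by (intro add_mono maj) auto
      also have "seg_integral k1 a c = seg_integral ?k a c" by (intro seg_integral_cong_open) auto
      also have "seg_integral k2 c b = seg_integral ?k c b" by (intro seg_integral_cong_open) auto
      also have "seg_integral ?k a c + seg_integral ?k c b = seg_integral ?k a b"
        using 3 by (intro seg_integral_split m) auto
      finally show ?thesis .
    qed
  qed
qed

text \<open>
  Majorants may be exchanged on an arbitrary Borel set. The sets for which this is possible for all
  pairs of majorants form a \<open>\<sigma>\<close>-algebra: complements swap the roles of \<open>k1\<close> and \<open>k2\<close>, finite unions
  are two successive exchanges (this is why the claim quantifies over all pairs), and monotone limits
  pass by dominated convergence. Half-lines belong to it by additivity of the integral.
\<close>
lemma majorant_splice: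
  assumes "A \<in> sets borel" "majorant h l k1" "majorant h l k2"
  shows "majorant h l (\<lambda>t. if t \<in> A then k1 t else k2 t)"
proof -
  have "A \<in> sigma_sets UNIV (range (\<lambda>c::real. {..c}))"
    using assms(1) unfolding borel_eq_atMost by simp
  then have "\<forall>k1 k2. majorant h l k1 \<longrightarrow> majorant h l k2 \<longrightarrow> majorant h l (\<lambda>t. if t \<in> A then k1 t else k2 t)"
  proof induction
    case (Basic A)
    then show ?case using majorant_splice_atMost by auto
  next
    case Empty
    then show ?case by simp
  next
    case (Compl A)
    have "(\<lambda>t. if t \<in> UNIV - A then k1 t else k2 t) = (\<lambda>t. if t \<in> A then k2 t else k1 t)"
      for k1 k2 :: "real \<Rightarrow> ennreal" by auto
    then show ?case using Compl.IH by simp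
  next
    case (Union A)
    show ?case
    proof (intro allI impI)
      fix k1 k2 assume k: "majorant h l k1" "majorant h l k2"
      have fin: "majorant h l (\<lambda>t. if t \<in> (\<Union>i<n. A i) then k1 t else k2 t)" for n
      proof (induction n)
        case 0
        then show ?case using k by simp
      next
        case (Suc n)
        have "(\<lambda>t. if t \<in> (\<Union>i<Suc n. A i) then k1 t else k2 t) =
          (\<lambda>t. if t \<in> A n then k1 t else (if t \<in> (\<Union>i<n. A i) then k1 t else k2 t))"
          by (auto simp: lessThan_Suc fun_eq_iff)
        then show ?case using Union.IH[of n] k(1) Suc by presburger
      qed
      have [measurable]: "k1 \<in> borel_measurable borel" "k2 \<in> borel_measurable borel"
        using k by (auto simp: majorant_def)
      show "majorant h l (\<lambda>t. if t \<in> (\<Union>i. A i) then k1 t else k2 t)"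
      proof (rule majorant_limit[OF fin, where K = "\<lambda>t. k1 t + k2 t"])
        have "seg_integral (\<lambda>t. k1 t + k2 t) 0 l = seg_integral k1 0 l + seg_integral k2 0 l"
          unfolding seg_integral_def by (subst nn_integral_add[symmetric]) (auto simp: distrib_right)
        then show "seg_integral (\<lambda>t. k1 t + k2 t) 0 l < \<infinity>" using k by (simp add: majorant_def)
        fix t
        show "(\<lambda>n. if t \<in> (\<Union>i<n. A i) then k1 t else k2 t) \<longlonglongrightarrow> (if t \<in> (\<Union>i. A i) then k1 t else k2 t)"
        proof (cases "t \<in> (\<Union>i. A i)")
          case True
          then obtain i where "t \<in> A i" by auto
          then have "eventually (\<lambda>n. (if t \<in> (\<Union>i<n. A i) then k1 t else k2 t) = k1 t) sequentially"
            by (intro eventually_sequentiallyI[of "Suc i"]) auto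
          then show ?thesis using True by (simp add: tendsto_eventually)
        qed auto
      qed (auto simp: add_increasing add_increasing2)
    qed
  qed
  then show ?thesis using assms by blast
qed

lemma majorant_min:
  assumes "majorant h l k1" "majorant h l k2"
  shows "majorant h l (\<lambda>t. min (k1 t) (k2 t))"
proof -
  have [measurable]: "k1 \<in> borel_measurable borel" "k2 \<in> borel_measurable borel"
    using assms by (auto simp: majorant_def)
  have "{t. k1 t \<le> k2 t} \<in> sets borel" by measurable
  from majorant_splice[OF this assms] show ?thesis by (simp add: min_def)
qed

context newton_space
begin

definition ug_ineq_along :: "('a \<Rightarrow> real) \<Rightarrow> ('a \<Rightarrow> ennreal) \<Rightarrow> real \<Rightarrow> (real \<Rightarrow> 'a) \<Rightarrow> bool" where
  "ug_ineq_along f g l \<gamma> \<longleftrightarrow>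
     (\<forall>a b. 0 \<le> a \<and> a \<le> b \<and> b \<le> l \<longrightarrow> ennreal \<bar>f (\<gamma> a) - f (\<gamma> b)\<bar> \<le> seg_integral (\<lambda>t. g (\<gamma> t)) a b)"

text \<open>
  Borel weak upper gradients of real functions; the inequality holds on all subcurves of
  \<open>p\<close>-almost every curve because an exceptional function also detects the curves that have a bad
  subcurve.
\<close>
definition weak_grad :: "('a \<Rightarrow> real) \<Rightarrow> ('a \<Rightarrow> ennreal) \<Rightarrow> bool" where
  "weak_grad f g \<longleftrightarrow> g \<in> borel_measurable borel \<and> ae_curve (ug_ineq_along f g)"

lemma weak_grad_imp_weak_upper_gradient:
  assumes "weak_grad f g"
  shows "weak_upper_gradient p M (\<lambda>x. ereal (f x)) g"
proof -
  obtain \<rho> where \<rho>: "\<rho> \<in> borel_measurable borel" "energy p M \<rho> < \<infinity>"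
    "\<And>l \<gamma>. arc_length_curve UNIV l \<gamma> \<Longrightarrow> line_integral l \<gamma> \<rho> < \<infinity> \<Longrightarrow> ug_ineq_along f g l \<gamma>"
    using assms unfolding weak_grad_def ae_curve_def by blast
  have g: "g \<in> borel_measurable M" using assms by (simp add: weak_grad_def borel_measurable_M)
  show ?thesis unfolding weak_upper_gradient_def
  proof (intro conjI g bexI[OF _ \<rho>(1)] allI impI)
    show "(\<integral>\<^sup>+x. epowr (\<rho> x) p \<partial>M) < \<infinity>" using \<rho>(2) by (simp add: energy_def)
    fix l and \<gamma> :: "real \<Rightarrow> 'a" assume \<gamma>: "arc_length_curve UNIV l \<gamma>"
    then have "0 < l" by (simp add: arc_length_curve_def)
    then show "ext_diff (ereal (f (\<gamma> 0))) (ereal (f (\<gamma> l))) \<le> line_integral l \<gamma> g \<or> line_integral l \<gamma> \<rho> = \<infinity>"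
      using \<rho>(3)[OF \<gamma>] by (auto simp: ug_ineq_along_def less_top line_integral_eq_seg)
  qed
qed

lemma weak_upper_gradient_imp_weak_grad:
  assumes "weak_upper_gradient p M (\<lambda>x. ereal (f x)) g"
  obtains g' where "weak_grad f g'" "AE x in M. g x = g' x"
proof -
  obtain \<rho> where \<rho>: "\<rho> \<in> borel_measurable borel" "energy p M \<rho> < \<infinity>"
    "\<And>l \<gamma>. arc_length_curve UNIV l \<gamma> \<Longrightarrow>
       ennreal \<bar>f (\<gamma> 0) - f (\<gamma> l)\<bar> \<le> line_integral l \<gamma> g \<or> line_integral l \<gamma> \<rho> = \<infinity>"
    using assms unfolding weak_upper_gradient_def energy_def by auto
  obtain g' where g': "g' \<in> borel_measurable borel" "\<And>x. g x \<le> g' x" "AE x in M. g x = g' x"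
    using borel_majorant assms unfolding weak_upper_gradient_def by blast
  have "ug_ineq_along f g' l \<gamma>" if \<gamma>: "arc_length_curve UNIV l \<gamma>" "line_integral l \<gamma> \<rho> < \<infinity>" for l \<gamma>
    unfolding ug_ineq_along_def
  proof (intro allI impI)
    fix a b assume ab: "0 \<le> a \<and> a \<le> b \<and> b \<le> l"
    show "ennreal \<bar>f (\<gamma> a) - f (\<gamma> b)\<bar> \<le> seg_integral (\<lambda>t. g' (\<gamma> t)) a b"
    proof (cases "a = b")
      case False
      then have ab': "0 \<le> a" "a < b" "b \<le> l" using ab by auto
      let ?\<gamma> = "\<lambda>t. \<gamma> (a + t)"
      have arc: "arc_length_curve UNIV (b - a) ?\<gamma>" by (rule arc_length_curve_sub[OF \<gamma>(1) ab'])
      have "line_integral (b - a) ?\<gamma> \<rho> = seg_integral (\<lambda>t. \<rho> (\<gamma> t)) a b"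
        using ab' by (intro line_integral_sub[OF \<gamma>(1) \<rho>(1)]) auto
      also have "\<dots> \<le> line_integral l \<gamma> \<rho>"
        unfolding line_integral_eq_seg using ab' by (intro seg_integral_subset) auto
      finally have "line_integral (b - a) ?\<gamma> \<rho> \<noteq> \<infinity>" using \<gamma>(2) by auto
      then have "ennreal \<bar>f (\<gamma> a) - f (\<gamma> b)\<bar> \<le> line_integral (b - a) ?\<gamma> g" using \<rho>(3)[OF arc] by auto
      also have "\<dots> \<le> line_integral (b - a) ?\<gamma> g'" using g'(2) by (rule line_integral_mono)
      also have "\<dots> = seg_integral (\<lambda>t. g' (\<gamma> t)) a b"
        using ab' by (intro line_integral_sub[OF \<gamma>(1) g'(1)]) auto
      finally show ?thesis .
    qed simp
  qed
  then have "weak_grad f g'" unfolding weak_grad_def ae_curve_def using g'(1) \<rho>(1,2) by blast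
  then show thesis using g'(3) by (rule that)
qed

lemma along_curve_majorant:
  assumes "arc_length_curve UNIV l \<gamma>" "g \<in> borel_measurable borel"
    "ug_ineq_along f g l \<gamma>" "line_integral l \<gamma> g < \<infinity>"
  shows "majorant (\<lambda>t. f (\<gamma> t)) l (\<lambda>t. g (\<gamma> t) * indicator {0..l} t)"
proof -
  obtain k where k: "k \<in> borel_measurable borel" "\<And>t. 0 \<le> t \<Longrightarrow> t \<le> l \<Longrightarrow> k t = g (\<gamma> t)"
    using arc_length_curve_measurable[OF assms(1,2)] by blast
  have eq: "(\<lambda>t. g (\<gamma> t) * indicator {0..l} t) = (\<lambda>t. k t * indicator {0..l} t)"
    using k(2) by (auto simp: indicator_def)
  have seg: "seg_integral (\<lambda>t. g (\<gamma> t) * indicator {0..l} t) a b = seg_integral (\<lambda>t. g (\<gamma> t)) a b"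
    if "0 \<le> a" "b \<le> l" for a b
    using that by (intro seg_integral_cong) auto
  show ?thesis
    unfolding majorant_def
    using assms(3,4) k(1) by (auto simp: seg line_integral_eq_seg ug_ineq_along_def) (auto simp: eq)
qed

lemma majorant_along_curve:
  assumes "majorant (\<lambda>t. f (\<gamma> t)) l k" "\<And>t. 0 \<le> t \<Longrightarrow> t \<le> l \<Longrightarrow> k t = g (\<gamma> t)"
  shows "ug_ineq_along f g l \<gamma>"
  unfolding ug_ineq_along_def
proof (intro allI impI)
  fix a b assume ab: "0 \<le> a \<and> a \<le> b \<and> b \<le> l"
  have "seg_integral (\<lambda>t. g (\<gamma> t)) a b = seg_integral k a b"
    using assms(2) ab by (intro seg_integral_cong) auto
  then show "ennreal \<bar>f (\<gamma> a) - f (\<gamma> b)\<bar> \<le> seg_integral (\<lambda>t. g (\<gamma> t)) a b"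
    using assms(1) ab by (simp add: majorant_def)
qed

text \<open>
  Along almost every curve both functions are integrable majorants, so the minimum is one.
\<close>
lemma weak_grad_min:
  assumes "weak_grad f g1" "weak_grad f g2"
    and "ae_curve (\<lambda>l \<gamma>. line_integral l \<gamma> g1 < \<infinity>)" "ae_curve (\<lambda>l \<gamma>. line_integral l \<gamma> g2 < \<infinity>)"
  shows "weak_grad f (\<lambda>x. min (g1 x) (g2 x))"
  unfolding weak_grad_def
proof
  have [measurable]: "g1 \<in> borel_measurable borel" "g2 \<in> borel_measurable borel"
    using assms by (auto simp: weak_grad_def)
  show "(\<lambda>x. min (g1 x) (g2 x)) \<in> borel_measurable borel" by measurable
  have "ae_curve (\<lambda>l \<gamma>. (ug_ineq_along f g1 l \<gamma> \<and> ug_ineq_along f g2 l \<gamma>) \<and>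
      line_integral l \<gamma> g1 < \<infinity> \<and> line_integral l \<gamma> g2 < \<infinity>)"
    using assms by (intro ae_curve_conj) (auto simp: weak_grad_def)
  then show "ae_curve (ug_ineq_along f (\<lambda>x. min (g1 x) (g2 x)))"
  proof (rule ae_curve_mono)
    fix l \<gamma> assume \<gamma>: "arc_length_curve UNIV l \<gamma>"
      "(ug_ineq_along f g1 l \<gamma> \<and> ug_ineq_along f g2 l \<gamma>) \<and>
        line_integral l \<gamma> g1 < \<infinity> \<and> line_integral l \<gamma> g2 < \<infinity>"
    show "ug_ineq_along f (\<lambda>x. min (g1 x) (g2 x)) l \<gamma>"
      by (rule majorant_along_curve[OF majorant_min[OF
            along_curve_majorant[OF \<gamma>(1), of g1] along_curve_majorant[OF \<gamma>(1), of g2]]])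
         (use \<gamma> in auto)
  qed
qed

text \<open>
  For decreasing sequences the line integrals converge by dominated convergence on every curve on
  which \<open>g 0\<close> is integrable. By the lattice property the minimization below only has to deal with
  such sequences.
\<close>
lemma weak_grad_INF:
  fixes g :: "nat \<Rightarrow> 'a \<Rightarrow> ennreal"
  assumes "\<And>n. weak_grad f (g n)" "\<And>n x. g (Suc n) x \<le> g n x" "energy p M (g 0) < \<infinity>"
  shows "weak_grad f (\<lambda>x. INF n. g n x)"
  unfolding weak_grad_def
proof
  have gm [measurable]: "g n \<in> borel_measurable borel" for n
    using assms by (auto simp: weak_grad_def)
  show "(\<lambda>x. INF n. g n x) \<in> borel_measurable borel" by measurable
  have dec: "decseq (\<lambda>n. g n x)" for x using assms(2) by (intro decseq_SucI)
  have le0: "g n x \<le> g 0 x" for n x using dec[of x] by (simp add: decseq_def)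
  have "ae_curve (\<lambda>l \<gamma>. (\<forall>n. ug_ineq_along f (g n) l \<gamma>) \<and> line_integral l \<gamma> (g 0) < \<infinity>)"
    using assms by (intro ae_curve_conj ae_curve_all ae_curve_finite) (auto simp: weak_grad_def)
  then show "ae_curve (ug_ineq_along f (\<lambda>x. INF n. g n x))"
  proof (rule ae_curve_mono)
    fix l \<gamma> assume \<gamma>: "arc_length_curve UNIV l \<gamma>"
      "(\<forall>n. ug_ineq_along f (g n) l \<gamma>) \<and> line_integral l \<gamma> (g 0) < \<infinity>"
    have fin: "line_integral l \<gamma> (g n) < \<infinity>" for n
      using line_integral_mono[of "g n" "g 0" l \<gamma>, OF le0] \<gamma>(2) by (auto elim: le_less_trans)
    have maj: "majorant (\<lambda>t. f (\<gamma> t)) l (\<lambda>t. g n (\<gamma> t) * indicator {0..l} t)" for n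
      using \<gamma> fin by (intro along_curve_majorant) auto
    show "ug_ineq_along f (\<lambda>x. INF n. g n x) l \<gamma>"
    proof (rule majorant_along_curve[OF majorant_limit[OF maj, where K = "\<lambda>t. g 0 (\<gamma> t) * indicator {0..l} t"]])
      show "(\<lambda>t. g 0 (\<gamma> t) * indicator {0..l} t) \<in> borel_measurable borel"
        "seg_integral (\<lambda>t. g 0 (\<gamma> t) * indicator {0..l} t) 0 l < \<infinity>"
        using maj[of 0] by (auto simp: majorant_def)
      show "(\<lambda>n. g n (\<gamma> t) * indicator {0..l} t) \<longlonglongrightarrow> (INF n. g n (\<gamma> t)) * indicator {0..l} t" for t
        using LIMSEQ_INF[OF dec[of "\<gamma> t"]] by (auto simp: indicator_def)
    qed (use le0 in \<open>auto simp: indicator_def\<close>)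
  qed
qed

lemma newt_weak_grad:
  assumes "f \<in> newt"
  obtains g where "weak_grad f g" "energy p M g < \<infinity>"
proof -
  obtain g where g: "g \<in> borel_measurable borel" "energy p M g < \<infinity>"
    "\<And>l (\<gamma> :: real \<Rightarrow> 'a) a b. arc_length_curve UNIV l \<gamma> \<Longrightarrow> 0 \<le> a \<Longrightarrow> a \<le> b \<Longrightarrow> b \<le> l \<Longrightarrow>
       ennreal \<bar>f (\<gamma> a) - f (\<gamma> b)\<bar> \<le> seg_integral (\<lambda>t. g (\<gamma> t)) a b"
    using newtD[OF assms] by metis
  have "ae_curve (ug_ineq_along f g)"
    using ae_curve_finite[OF g(1,2)] by (rule ae_curve_mono) (use g(3) in \<open>auto simp: ug_ineq_along_def\<close>)
  then show thesis using g by (intro that[of g]) (simp_all add: weak_grad_def)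
qed

end


section \<open>Minimal weak upper gradients\<close>

text \<open>
  A function with an integrable majorant is continuous.
\<close>
lemma majorant_closed_zeros:
  assumes "majorant h l k"
  shows "closed {t \<in> {0..l}. h t = 0}"
  unfolding closed_sequential_limits
proof (intro allI impI)
  fix x t assume *: "(\<forall>n. x n \<in> {t \<in> {0..l}. h t = 0}) \<and> x \<longlonglongrightarrow> t"
  then have x: "\<And>n. 0 \<le> x n" "\<And>n. x n \<le> l" "\<And>n. h (x n) = 0" and lim: "x \<longlonglongrightarrow> t" by auto
  have t: "0 \<le> t" "t \<le> l" using LIMSEQ_le_const[OF lim] LIMSEQ_le_const2[OF lim] x by blast+
  have km [measurable]: "k \<in> borel_measurable borel" and fin: "seg_integral k 0 l < \<infinity>"
    using assms by (auto simp: majorant_def)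
  have maj: "ennreal \<bar>h a - h b\<bar> \<le> seg_integral k a b" if "0 \<le> a" "a \<le> b" "b \<le> l" for a b
    using assms that by (simp add: majorant_def)
  have le: "ennreal \<bar>h t\<bar> \<le> seg_integral k (min (x n) t) (max (x n) t)" for n
    using maj[of "x n" t] maj[of t "x n"] x[of n] t by (cases "x n \<le> t") auto
  have "(\<lambda>n. seg_integral k (min (x n) t) (max (x n) t)) \<longlonglongrightarrow> (\<integral>\<^sup>+s. 0 \<partial>(lborel :: real measure))"
    unfolding seg_integral_def
  proof (rule nn_integral_dominated_convergence[where w = "\<lambda>s. k s * indicator {0..l} s"])
    show "(\<integral>\<^sup>+s\<in>{0..l}. k s \<partial>lborel) < \<infinity>" using fin by (simp add: seg_integral_def)
    show "AE s in lborel. k s * indicator {min (x n) t..max (x n) t} s \<le> k s * indicator {0..l} s" for n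
      using x[of n] t by (auto simp: indicator_def)
    show "AE s in lborel. (\<lambda>n. k s * indicator {min (x n) t..max (x n) t} s) \<longlonglongrightarrow> 0"
      using AE_lborel_singleton[of t]
    proof eventually_elim
      case (elim s)
      then have "eventually (\<lambda>n. dist (x n) t < dist s t) sequentially"
        using lim by (intro tendstoD) auto
      then have "eventually (\<lambda>n. k s * indicator {min (x n) t..max (x n) t} s = 0) sequentially"
        by eventually_elim (auto simp: indicator_def dist_real_def)
      then show ?case by (rule tendsto_eventually)
    qed
  qed auto
  then have "ennreal \<bar>h t\<bar> \<le> 0" using le by (intro LIMSEQ_le_const) auto
  then show "t \<in> {t \<in> {0..l}. h t = 0}" using t by simp
qed

locale newton_space_balls = newton_space +
  assumes balls: "0 < r \<Longrightarrow> 0 < emeasure M (ball x r) \<and> emeasure M (ball x r) < \<infinity>"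
begin

text \<open>
  The disjoint balls around the points of a separated set have positive measure inside a ball of
  finite measure.
\<close>
lemma separated_countable:
  fixes S :: "'a set"
  assumes e: "0 < e" and S: "S \<subseteq> ball x0 R" "\<And>x y. x \<in> S \<Longrightarrow> y \<in> S \<Longrightarrow> x \<noteq> y \<Longrightarrow> e \<le> dist x y"
  shows "countable S"
proof (cases "S = {}")
  case False
  then have R: "0 < R" using S(1) by (metis ball_eq_empty linorder_not_le subset_empty)
  let ?m = "\<lambda>x. measure M (ball x (e/2))"
  have pos: "0 < ?m x" for x
    using balls[of "e/2" x] e by (simp add: measure_def enn2real_positive_iff)
  have "?m summable_on S"
  proof (rule nonneg_bdd_above_summable_on)
    show "bdd_above (sum ?m ` {F. F \<subseteq> S \<and> finite F})"
    proof (rule bdd_aboveI2)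
      fix F assume "F \<in> {F. F \<subseteq> S \<and> finite F}"
      then have F: "F \<subseteq> S" "finite F" by auto
      have disj: "disjoint_family_on (\<lambda>x. ball x (e/2)) F"
        unfolding disjoint_family_on_def
      proof (intro ballI impI)
        fix x y assume "x \<in> F" "y \<in> F" "x \<noteq> y"
        then have "e \<le> dist x y" using S(2) F by auto
        show "ball x (e/2) \<inter> ball y (e/2) = {}"
        proof (rule ccontr)
          assume "\<not> ?thesis"
          then obtain z where "dist x z < e/2" "dist y z < e/2" by auto
          then show False using dist_triangle2[of x y z] \<open>e \<le> dist x y\<close> by linarith
        qed
      qed
      have "sum ?m F = measure M (\<Union>x\<in>F. ball x (e/2))"
        using F(2) disj balls e by (intro measure_finite_Union[symmetric]) (auto simp: less_top)
      also have "\<dots> \<le> measure M (ball x0 (R + e))"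
      proof (rule measure_mono_fmeasurable)
        show "(\<Union>x\<in>F. ball x (e/2)) \<subseteq> ball x0 (R + e)"
        proof safe
          fix x z assume "x \<in> F" "z \<in> ball x (e/2)"
          then have "dist x0 x < R" "dist x z < e/2" using F S(1) by auto
          then show "z \<in> ball x0 (R + e)" using dist_triangle[of x0 z x] e by simp
        qed
        show "(\<Union>x\<in>F. ball x (e/2)) \<in> sets M" by (intro open_sets_M open_UN) auto
        show "ball x0 (R + e) \<in> fmeasurable M" using balls[of "R + e" x0] R e by (intro fmeasurableI) auto
      qed
      finally show "sum ?m F \<le> measure M (ball x0 (R + e))" .
    qed
  qed simp
  then have "countable {x \<in> S. ?m x \<noteq> 0}" by (rule summable_countable_real)
  moreover have "{x \<in> S. ?m x \<noteq> 0} = S" using pos by (auto simp: less_le)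
  ultimately show ?thesis by simp
qed simp

lemma separable: "\<exists>D :: 'a set. countable D \<and> (\<forall>x. \<forall>e>0. \<exists>d\<in>D. dist x d < e)"
proof -
  fix x0 :: 'a
  have "\<exists>S. countable S \<and> (\<forall>x\<in>ball x0 R. \<exists>s\<in>S. dist x s < e)" if e: "0 < e" for R e
  proof -
    let ?A = "{S. S \<subseteq> ball x0 R \<and> (\<forall>x\<in>S. \<forall>y\<in>S. x \<noteq> y \<longrightarrow> e \<le> dist x y)}"
    have "\<exists>S\<in>?A. \<forall>X\<in>?A. S \<subseteq> X \<longrightarrow> X = S"
    proof (rule subset_Zorn')
      fix C assume C: "subset.chain ?A C"
      have "e \<le> dist x y" if xy: "x \<in> X" "X \<in> C" "y \<in> Y" "Y \<in> C" "x \<noteq> y" for x y X Y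
      proof -
        have "X \<subseteq> Y \<or> Y \<subseteq> X" using C xy unfolding subset_chain_def by blast
        then show ?thesis using C xy unfolding subset_chain_def by blast
      qed
      then show "\<Union> C \<in> ?A" using C unfolding subset_chain_def by blast
    qed
    then obtain S where S: "S \<in> ?A" and m: "\<forall>X\<in>?A. S \<subseteq> X \<longrightarrow> X = S" by (rule bexE)
    have max: "X = S" if "X \<in> ?A" "S \<subseteq> X" for X by (rule m[THEN bspec, THEN mp, OF that])
    have "\<exists>s\<in>S. dist x s < e" if x: "x \<in> ball x0 R" for x
    proof (rule ccontr)
      assume *: "\<not> ?thesis"
      then have "insert x S \<in> ?A" using S x by (auto simp: not_less dist_commute)
      then have "insert x S = S" by (rule max) auto
      with * e show False by (metis dist_self insertI1)
    qed
    moreover have "countable S" using S by (intro separated_countable[OF e, of S x0 R]) auto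
    ultimately show ?thesis by blast
  qed
  note ex = this
  define S where "S R e = (SOME S. countable S \<and> (\<forall>x\<in>ball x0 R. \<exists>s\<in>S. dist x s < e))" for R e
  have S: "countable (S R e)" "x \<in> ball x0 R \<Longrightarrow> \<exists>s\<in>S R e. dist x s < e" if "0 < e" for R e x
    using someI_ex[OF ex[OF that, of R]] unfolding S_def by blast+
  show ?thesis
  proof (intro exI[of _ "\<Union>n m. S (real n) (1 / real (Suc m))"] conjI allI impI)
    show "countable (\<Union>n m. S (real n) (1 / real (Suc m)))" using S(1) by auto
    fix x :: 'a and e :: real assume "0 < e"
    then obtain m where m: "1 / real (Suc m) < e" using nat_approx_posE by metis
    obtain n where "dist x0 x < real n" using reals_Archimedean2 by blast
    then obtain s where "s \<in> S (real n) (1 / real (Suc m))" "dist x s < 1 / real (Suc m)"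
      using S(2)[of "1 / real (Suc m)" x "real n"] by auto
    then show "\<exists>d\<in>\<Union>n m. S (real n) (1 / real (Suc m)). dist x d < e" using m by force
  qed
qed

text \<open>
  A Lindelof argument: balls with rational radii around the points of a countable dense set.
\<close>
lemma ball_cover:
  assumes "\<And>x. \<exists>r>0. P (ball x r)" and mono: "\<And>A B. P B \<Longrightarrow> A \<subseteq> B \<Longrightarrow> P A"
  obtains B :: "nat \<Rightarrow> 'a set" where "\<And>i. open (B i)" "\<And>i. P (B i)" "(\<Union>i. B i) = UNIV"
proof -
  obtain D :: "'a set" where D: "countable D" "\<And>x e. 0 < e \<Longrightarrow> \<exists>d\<in>D. dist x d < e"
    using separable by blast
  \<comment> \<open>for \<open>x\<close> and a good radius \<open>r\<close> take a centre within \<open>r/4\<close> of \<open>x\<close> and a radius between \<open>r/4\<close> and \<open>r/2\<close>\<close>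
  let ?C = "{(d, q). d \<in> D \<and> q \<in> \<rat> \<and> P (ball d q)}"
  have "?C \<subseteq> D \<times> \<rat>" by auto
  then have C: "countable ?C" using D(1) countable_rat by (meson countable_SIGMA countable_subset)
  have cov: "\<exists>c\<in>?C. x \<in> (case c of (d, q) \<Rightarrow> ball d q)" for x
  proof -
    obtain r where r: "0 < r" "P (ball x r)" using assms(1) by blast
    obtain d where d: "d \<in> D" "dist x d < r/4" using D(2)[of "r/4" x] r by auto
    obtain q where q: "q \<in> \<rat>" "r/4 < q" "q < r/2" using Rats_dense_in_real[of "r/4" "r/2"] r by auto
    have "ball d q \<subseteq> ball x r"
    proof
      fix z assume "z \<in> ball d q"
      then show "z \<in> ball x r" using dist_triangle[of x z d] d q by simp
    qed
    then have "P (ball d q)" using r(2) mono by blast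
    then show ?thesis using d q by (intro bexI[of _ "(d, q)"]) (auto simp: dist_commute)
  qed
  then have ne: "?C \<noteq> {}" by blast
  show thesis
  proof (rule that[of "\<lambda>i. case from_nat_into ?C i of (d, q) \<Rightarrow> ball d q"])
    show "P (case from_nat_into ?C i of (d, q) \<Rightarrow> ball d q)" for i
      using from_nat_into[OF ne, of i] by auto
    show "(\<Union>i. case from_nat_into ?C i of (d, q) \<Rightarrow> ball d q) = UNIV"
    proof (intro equalityI subsetI UNIV_I)
      fix x :: 'a
      obtain c where c: "c \<in> ?C" "x \<in> (case c of (d, q) \<Rightarrow> ball d q)" using cov[of x] by (rule bexE)
      from from_nat_into_surj[OF C c(1)] obtain i where "from_nat_into ?C i = c" by (rule exE)
      with c(2) show "x \<in> (\<Union>i. case from_nat_into ?C i of (d, q) \<Rightarrow> ball d q)"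
        by (intro UN_I[of i]) auto
    qed
  qed (auto split: prod.split)
qed

text \<open>
  Minimality has to be tested against competitors that are only locally \<open>p\<close>-integrable. The space is
  covered by countably many open sets on which the competitor is \<open>p\<close>-integrable, and a curve, being
  compact, needs finitely many of them.
\<close>
lemma Lp_loc_ae_curve_finite:
  assumes h: "h \<in> Lp_loc p M" and h': "h' \<in> borel_measurable borel" "AE x in M. h x = h' x"
  shows "ae_curve (\<lambda>l \<gamma>. line_integral l \<gamma> h' < \<infinity>)"
proof -
  note [measurable] = h'(1)
  obtain B :: "nat \<Rightarrow> 'a set" where B: "\<And>i. open (B i)" "(\<Union>i. B i) = UNIV"
    "\<And>i. (\<integral>\<^sup>+y\<in>B i. epowr (h y) p \<partial>M) < \<infinity>"
  proof (rule ball_cover[of "\<lambda>A. (\<integral>\<^sup>+y\<in>A. epowr (h y) p \<partial>M) < \<infinity>"])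
    show "\<exists>r>0. (\<integral>\<^sup>+y\<in>ball x r. epowr (h y) p \<partial>M) < \<infinity>" for x using h by (simp add: Lp_loc_def)
    fix A B :: "'a set" assume "(\<integral>\<^sup>+y\<in>B. epowr (h y) p \<partial>M) < \<infinity>" "A \<subseteq> B"
    moreover have "(\<integral>\<^sup>+y\<in>A. epowr (h y) p \<partial>M) \<le> (\<integral>\<^sup>+y\<in>B. epowr (h y) p \<partial>M)"
      using \<open>A \<subseteq> B\<close> by (intro nn_integral_mono) (auto simp: indicator_def)
    ultimately show "(\<integral>\<^sup>+y\<in>A. epowr (h y) p \<partial>M) < \<infinity>" by order
  qed metis
  have [measurable]: "B i \<in> sets borel" for i using B(1) by simp
  let ?h = "\<lambda>i x. h' x * indicator (B i) x"
  have hm: "?h i \<in> borel_measurable borel" for i by measurable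
  have "energy p M (?h i) < \<infinity>" for i
  proof -
    have "energy p M (?h i) = (\<integral>\<^sup>+y\<in>B i. epowr (h y) p \<partial>M)"
      unfolding energy_def
    proof (rule nn_integral_cong_AE)
      show "AE x in M. epowr (?h i x) p = epowr (h x) p * indicator (B i) x"
        using h'(2) by eventually_elim (auto simp: indicator_def)
    qed
    then show ?thesis using B(3)[of i] by simp
  qed
  then have "ae_curve (\<lambda>l \<gamma>. \<forall>i. line_integral l \<gamma> (?h i) < \<infinity>)"
    by (intro ae_curve_all ae_curve_finite hm)
  then show ?thesis
  proof (rule ae_curve_mono)
    fix l and \<gamma> :: "real \<Rightarrow> 'a" assume \<gamma>: "arc_length_curve UNIV l \<gamma>" "\<forall>i. line_integral l \<gamma> (?h i) < \<infinity>"
    have "compact (\<gamma> ` {0..l})"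
      using \<gamma>(1) by (intro compact_continuous_image) (auto simp: arc_length_curve_def)
    then obtain F where F: "finite F" "\<gamma> ` {0..l} \<subseteq> (\<Union>i\<in>F. B i)"
      using compactE_image[of "\<gamma> ` {0..l}" UNIV B] B(1,2) by auto
    have "line_integral l \<gamma> (\<lambda>x. h' x * indicator (\<Union>i\<in>F. B i) x) < \<infinity>"
      using F(1)
    proof induction
      case empty
      then show ?case by (simp add: line_integral_eq_seg seg_integral_def)
    next
      case (insert i F)
      have "line_integral l \<gamma> (\<lambda>x. h' x * indicator (\<Union>i\<in>insert i F. B i) x)
          \<le> line_integral l \<gamma> (\<lambda>x. ?h i x + h' x * indicator (\<Union>i\<in>F. B i) x)"
        by (intro line_integral_mono) (auto simp: indicator_def)
      also have "\<dots> = line_integral l \<gamma> (?h i) + line_integral l \<gamma> (\<lambda>x. h' x * indicator (\<Union>i\<in>F. B i) x)"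
        unfolding line_integral_eq_seg using insert(1) by (intro line_integral_add[OF \<gamma>(1)]) measurable
      also have "\<dots> < \<infinity>" using insert \<gamma>(2) by simp
      finally show ?case .
    qed
    also have "line_integral l \<gamma> (\<lambda>x. h' x * indicator (\<Union>i\<in>F. B i) x) = line_integral l \<gamma> h'"
      unfolding line_integral_eq_seg using F(2) by (intro seg_integral_cong) (auto simp: image_subset_iff indicator_def)
    finally show "line_integral l \<gamma> h' < \<infinity>" .
  qed
qed

lemma finite_energy_Lp_loc:
  assumes "g \<in> borel_measurable M" "energy p M g < \<infinity>"
  shows "g \<in> Lp_loc p M"
  unfolding Lp_loc_def mem_Collect_eq
proof (intro conjI allI exI[of _ "1::real"] assms(1))
  fix x
  have "(\<integral>\<^sup>+y\<in>ball x 1. epowr (g y) p \<partial>M) \<le> energy p M g"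
    unfolding energy_def by (intro nn_integral_mono) (auto simp: indicator_def)
  then show "(\<integral>\<^sup>+y\<in>ball x 1. epowr (g y) p \<partial>M) < \<infinity>" using assms(2) by order
qed simp

text \<open>
  Minimize the energy: running minima of a minimizing sequence decrease to a weak upper gradient \<open>k\<close>
  of least energy. For any competitor \<open>q\<close> the minimum of \<open>k\<close> and \<open>q\<close> has the same energy as \<open>k\<close>, so it
  equals \<open>k\<close> almost everywhere.
\<close>
lemma min_weak_upper_gradient_exists:
  assumes "f \<in> newt"
  obtains g where "is_min_weak_upper_gradient p M (\<lambda>x. ereal (f x)) g" "energy p M g < \<infinity>"
    "g \<in> borel_measurable borel"
proof -
  let ?E = "{energy p M g | g. weak_grad f g \<and> energy p M g < \<infinity>}"
  obtain g0 where g0: "weak_grad f g0" "energy p M g0 < \<infinity>" using newt_weak_grad[OF assms] .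
  then have "?E \<noteq> {}" by blast
  from ennreal_Inf_countable_INF[OF this]
  obtain e :: "nat \<Rightarrow> ennreal" where e: "range e \<subseteq> ?E" "Inf ?E = (INF n. e n)"
    by (elim exE conjE)
  have "\<exists>g. weak_grad f g \<and> energy p M g < \<infinity> \<and> energy p M g = e n" for n
  proof -
    have "e n \<in> ?E" using e(1) by (rule subsetD) simp
    then show ?thesis unfolding mem_Collect_eq by (elim exE conjE) (simp, blast)
  qed
  then have "\<forall>n. \<exists>g. weak_grad f g \<and> energy p M g < \<infinity> \<and> energy p M g = e n" by (rule allI)
  from choice[OF this] obtain g where g: "\<And>n. weak_grad f (g n)"
    "\<And>n. energy p M (g n) < \<infinity>" "\<And>n. energy p M (g n) = e n"
    by blast
  \<comment> \<open>running minima; they are weak upper gradients by the lattice property\<close>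
  define h where "h = rec_nat (g 0) (\<lambda>n k x. min (k x) (g (Suc n) x))"
  have h0: "h 0 = g 0" and hS: "h (Suc n) = (\<lambda>x. min (h n x) (g (Suc n) x))" for n
    by (simp_all add: h_def)
  have gm: "g n \<in> borel_measurable borel" for n using g(1) by (simp add: weak_grad_def)
  have h: "weak_grad f (h n) \<and> energy p M (h n) < \<infinity>" for n
  proof (induction n)
    case 0
    then show ?case using g h0 by simp
  next
    case (Suc n)
    have "energy p M (h (Suc n)) \<le> energy p M (h n)" unfolding hS by (intro energy_mono p_pos) simp
    moreover have "weak_grad f (h (Suc n))"
      unfolding hS using Suc g gm
      by (intro weak_grad_min ae_curve_finite) (auto simp: weak_grad_def)
    ultimately show ?case using Suc by (auto elim: le_less_trans)
  qed
  have h_le: "h n x \<le> g n x" for n x by (cases n) (simp_all add: h0 hS)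
  define k where "k x = (INF n. h n x)" for x
  have k: "weak_grad f k" unfolding k_def using h by (intro weak_grad_INF) (auto simp: hS)
  have km: "k \<in> borel_measurable borel" using k by (simp add: weak_grad_def)
  have k_le: "k x \<le> g n x" for n x
    unfolding k_def using INF_lower2[of n UNIV "\<lambda>n. h n x" "g n x"] h_le by simp
  have k_en: "energy p M k \<le> e n" for n
    using energy_mono[OF p_pos, of M k "g n"] k_le g(3) by simp
  then have "energy p M k \<le> Inf ?E" unfolding e(2) by (intro INF_greatest)
  have kfin: "energy p M k < \<infinity>" using k_en[of 0] g(2,3)[of 0] by order
  have "is_min_weak_upper_gradient p M (\<lambda>x. ereal (f x)) k"
    unfolding is_min_weak_upper_gradient_def
  proof (intro conjI ballI impI)
    show "k \<in> Lp_loc p M" using km kfin by (intro finite_energy_Lp_loc borel_measurable_M)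
    show "weak_upper_gradient p M (\<lambda>x. ereal (f x)) k" by (rule weak_grad_imp_weak_upper_gradient[OF k])
    fix q assume q: "q \<in> Lp_loc p M" "weak_upper_gradient p M (\<lambda>x. ereal (f x)) q"
    obtain q' where q': "weak_grad f q'" "AE x in M. q x = q' x"
      using weak_upper_gradient_imp_weak_grad[OF q(2)] .
    have q'm: "q' \<in> borel_measurable borel" using q'(1) by (simp add: weak_grad_def)
    let ?m = "\<lambda>x. min (k x) (q' x)"
    note [measurable] = km[THEN borel_measurable_M] q'm[THEN borel_measurable_M]
    have m: "weak_grad f ?m"
      using Lp_loc_ae_curve_finite[OF q(1) q'm q'(2)] ae_curve_finite[OF km kfin] k q'(1)
      by (intro weak_grad_min)
    have m_le: "energy p M ?m \<le> energy p M k" by (intro energy_mono p_pos) simp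
    then have mfin: "energy p M ?m < \<infinity>" using kfin by order
    have "energy p M k \<le> energy p M ?m"
      using \<open>energy p M k \<le> Inf ?E\<close> by (rule order_trans) (use m mfin in \<open>auto intro!: Inf_lower\<close>)
    then have "(\<integral>\<^sup>+x. epowr (k x) p - epowr (?m x) p \<partial>M) = 0"
      using m_le mfin unfolding energy_def
      by (subst nn_integral_diff) (auto intro!: epowr_mono p_pos simp: less_top)
    then have "AE x in M. epowr (k x) p - epowr (?m x) p = 0"
      by (subst (asm) nn_integral_0_iff_AE) auto
    moreover have "AE x in M. k x < \<infinity>" using kfin by (intro energy_finite_AE) auto
    ultimately show "AE x in M. k x \<le> q x" using q'(2)
    proof eventually_elim
      case (elim x)
      have "epowr (k x) p \<le> epowr (?m x) p"
      proof (rule ccontr)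
        assume "\<not> ?thesis"
        then have "0 < epowr (k x) p - epowr (?m x) p" by (simp add: diff_gr0_ennreal)
        then show False using elim(1) by simp
      qed
      then have "k x \<le> ?m x" by (simp add: epowr_le_iff[OF p_pos])
      then show ?case using elim(3) by simp
    qed
  qed
  then show thesis using kfin km by (rule that)
qed

text \<open>
  Any weak upper gradient remains one if it is set to zero where the function vanishes, by
  \<open>seg_integral_off_zeros\<close>. The minimal one lies below this modification.
\<close>
lemma min_weak_upper_gradient_zero:
  assumes "f \<in> newt" and min: "is_min_weak_upper_gradient p M (\<lambda>x. ereal (f x)) g"
  shows "AE x in M. f x = 0 \<longrightarrow> g x = 0"
proof -
  have gL: "g \<in> Lp_loc p M" and gw: "weak_upper_gradient p M (\<lambda>x. ereal (f x)) g"
    using min by (auto simp: is_min_weak_upper_gradient_def)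
  obtain g' where g': "weak_grad f g'" "AE x in M. g x = g' x"
    using weak_upper_gradient_imp_weak_grad[OF gw] .
  have g'm: "g' \<in> borel_measurable borel" using g'(1) by (simp add: weak_grad_def)
  note [measurable] = g'm[THEN borel_measurable_M] newt_measurable[OF assms(1)]
  let ?q = "\<lambda>x. g' x * indicator {x. f x \<noteq> 0} x"
  have "{x \<in> space M. f x \<noteq> 0} \<in> sets M" by measurable
  then have [measurable]: "{x. f x \<noteq> 0} \<in> sets M" by simp
  have qm: "?q \<in> borel_measurable M" by measurable
  have "?q \<in> Lp_loc p M"
    unfolding Lp_loc_def mem_Collect_eq
  proof (intro conjI allI qm)
    fix x
    obtain r where r: "0 < r" "(\<integral>\<^sup>+y\<in>ball x r. epowr (g y) p \<partial>M) < \<infinity>"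
      using gL by (auto simp: Lp_loc_def)
    have "(\<integral>\<^sup>+y\<in>ball x r. epowr (?q y) p \<partial>M) \<le> (\<integral>\<^sup>+y\<in>ball x r. epowr (g y) p \<partial>M)"
    proof (rule nn_integral_mono_AE)
      show "AE y in M. epowr (?q y) p * indicator (ball x r) y \<le> epowr (g y) p * indicator (ball x r) y"
        using g'(2) by eventually_elim (auto simp: indicator_def)
    qed
    then show "\<exists>r>0. (\<integral>\<^sup>+y\<in>ball x r. epowr (?q y) p \<partial>M) < \<infinity>" using r by (auto elim: le_less_trans)
  qed
  moreover have "weak_upper_gradient p M (\<lambda>x. ereal (f x)) ?q"
  proof -
    have "ae_curve (\<lambda>l \<gamma>. ug_ineq_along f g' l \<gamma> \<and> line_integral l \<gamma> g' < \<infinity>)"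
      using g'(1) Lp_loc_ae_curve_finite[OF gL g'm g'(2)] by (intro ae_curve_conj) (auto simp: weak_grad_def)
    then obtain \<rho> where \<rho>: "\<rho> \<in> borel_measurable borel" "energy p M \<rho> < \<infinity>"
      "\<And>l (\<gamma> :: real \<Rightarrow> 'a). arc_length_curve UNIV l \<gamma> \<Longrightarrow> line_integral l \<gamma> \<rho> < \<infinity> \<Longrightarrow>
         ug_ineq_along f g' l \<gamma> \<and> line_integral l \<gamma> g' < \<infinity>"
      unfolding ae_curve_def by blast
    have "ennreal \<bar>f (\<gamma> 0) - f (\<gamma> l)\<bar> \<le> line_integral l \<gamma> ?q"
      if \<gamma>: "arc_length_curve UNIV l \<gamma>" "line_integral l \<gamma> \<rho> < \<infinity>" for l \<gamma>
    proof -
      let ?h = "\<lambda>t. f (\<gamma> t)" and ?k = "\<lambda>t. g' (\<gamma> t) * indicator {0..l} t"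
      have l: "0 \<le> l" using \<gamma>(1) by (simp add: arc_length_curve_def)
      have maj: "majorant ?h l ?k"
        using \<rho>(3)[OF \<gamma>] by (intro along_curve_majorant \<gamma>(1) g'm) auto
      let ?Z = "{t \<in> {0..l}. f (\<gamma> t) = 0}"
      have "closed ?Z" by (rule majorant_closed_zeros[OF maj])
      then have "ennreal \<bar>?h 0 - ?h l\<bar> \<le> seg_integral (\<lambda>t. ?k t * indicator (- ?Z) t) 0 l"
        using maj l by (intro seg_integral_off_zeros) (auto simp: majorant_def)
      also have "\<dots> = line_integral l \<gamma> ?q"
        unfolding line_integral_eq_seg by (intro seg_integral_cong) (auto simp: indicator_def)
      finally show ?thesis .
    qed
    then show ?thesis
      using \<rho>(1,2) qm unfolding weak_upper_gradient_def energy_def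
      by (intro conjI bexI[of _ \<rho>] allI impI) (auto simp: less_top)
  qed
  ultimately have "AE x in M. g x \<le> ?q x" using min by (auto simp: is_min_weak_upper_gradient_def)
  then show ?thesis by eventually_elim auto
qed

end


section \<open>Inner products and the derivative of the \<open>p\<close>-th power of the norm\<close>

lemma young_powr:
  fixes a c p :: real
  assumes "1 < p" "0 \<le> a" "0 \<le> c"
  shows "p * (a powr (p - 1) * c) \<le> (p - 1) * a powr p + c powr p"
proof (cases "a = 0 \<or> c = 0")
  case False
  then have ac: "0 < a" "0 < c" using assms by auto
  have "(a powr p) powr ((p-1)/p) * (c powr p) powr (1/p) \<le> ((p-1)/p) * a powr p + (1/p) * c powr p"
    using assms ac by (intro Youngs_inequality_0) (auto simp: field_simps)
  then have "a powr (p - 1) * c \<le> ((p-1)/p) * a powr p + (1/p) * c powr p"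
    using assms ac by (simp add: powr_powr)
  then have "p * (a powr (p - 1) * c) \<le> p * (((p-1)/p) * a powr p + (1/p) * c powr p)"
    using assms by (intro mult_left_mono) auto
  also have "\<dots> = (p - 1) * a powr p + c powr p" using assms by (simp add: field_simps)
  finally show ?thesis .
qed (use assms in auto)

context
  fixes kk :: nat and b :: "(nat \<Rightarrow> real) \<Rightarrow> (nat \<Rightarrow> real) \<Rightarrow> real"
  assumes ip: "inner_product_on kk b"
begin

lemma ipo_commute: "b v w = b w v"
  using ip unfolding inner_product_on_def by blast

lemma ipo_cong: "(\<And>i. i < kk \<Longrightarrow> v i = v' i) \<Longrightarrow> (\<And>i. i < kk \<Longrightarrow> w i = w' i) \<Longrightarrow> b v w = b v' w'"
  using ip unfolding inner_product_on_def by metis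

lemma ipo_linear: "b v (\<lambda>i. a * w i + z i) = a * b v w + b v z"
  using ip unfolding inner_product_on_def by blast

lemma ipo_zero: "b v (\<lambda>i. 0) = 0"
  using ipo_linear[of v 1 "\<lambda>i. 0" "\<lambda>i. 0"] by simp

lemma ipo_vanish: assumes "\<And>i. i < kk \<Longrightarrow> w i = 0" shows "b v w = 0"
  using ipo_cong[of v v w "\<lambda>i. 0"] assms ipo_zero by simp

lemma ipo_nonneg: "0 \<le> b v v"
proof (cases "\<exists>i<kk. v i \<noteq> 0")
  case True
  then show ?thesis using ip unfolding inner_product_on_def by (metis less_imp_le)
next
  case False
  then show ?thesis by (subst ipo_vanish) auto
qed

lemma ipo_eq_0: "b v v = 0 \<Longrightarrow> i < kk \<Longrightarrow> v i = 0"
  using ip unfolding inner_product_on_def by (metis less_irrefl)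

lemma ipo_expand: "b (\<lambda>i. t * w i + v i) (\<lambda>i. t * w i + v i) = b v v + 2 * t * b v w + t^2 * b w w"
proof -
  let ?x = "\<lambda>i. t * w i + v i"
  have "b ?x ?x = t * b ?x w + b ?x v" by (rule ipo_linear)
  also have "b ?x w = t * b w w + b v w" by (subst ipo_commute, subst ipo_linear) (simp add: ipo_commute)
  also have "b ?x v = t * b v w + b v v" by (subst ipo_commute, subst ipo_linear) simp
  finally show ?thesis by (simp add: algebra_simps power2_eq_square)
qed

lemma ipo_norm_nonneg: "0 \<le> ip_norm b v" by (simp add: ip_norm_def ipo_nonneg)

lemma ipo_norm_sq: "ip_norm b v ^ 2 = b v v" by (simp add: ip_norm_def ipo_nonneg)

lemma ipo_cauchy_schwarz: "\<bar>b v w\<bar> \<le> ip_norm b v * ip_norm b w"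
proof -
  have "(b v w)^2 \<le> b v v * b w w"
  proof (cases "b w w = 0")
    case True
    then show ?thesis using ipo_vanish[of w v] ipo_eq_0[of w] by simp
  next
    case False
    then have pos: "0 < b w w" using ipo_nonneg[of w] by simp
    have "0 \<le> b v v + 2 * (- b v w / b w w) * b v w + (- b v w / b w w)^2 * b w w"
      using ipo_nonneg[of "\<lambda>i. (- b v w / b w w) * w i + v i"] unfolding ipo_expand .
    also have "\<dots> = b v v - (b v w)^2 / b w w" using pos by (simp add: field_simps power2_eq_square)
    finally show ?thesis using pos by (simp add: field_simps)
  qed
  then have "\<bar>b v w\<bar>^2 \<le> (ip_norm b v * ip_norm b w)^2"
    by (simp add: power_mult_distrib ipo_norm_sq)
  then show ?thesis by (rule power2_le_imp_le) (simp add: ipo_norm_nonneg)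
qed

lemma ipo_triangle:
  assumes "\<And>i. i < kk \<Longrightarrow> w i = t * z i + v i" "\<bar>t\<bar> \<le> 1"
  shows "ip_norm b w \<le> ip_norm b v + ip_norm b z"
proof -
  have "b w w = b v v + 2 * t * b v z + t^2 * b z z"
    using ipo_cong[of w "\<lambda>i. t * z i + v i" w "\<lambda>i. t * z i + v i"] assms(1) ipo_expand by simp
  also have "\<dots> \<le> b v v + 2 * (ip_norm b v * ip_norm b z) + b z z"
  proof -
    have "2 * t * b v z \<le> 2 * \<bar>t * b v z\<bar>" by simp
    also have "\<dots> \<le> 2 * (1 * (ip_norm b v * ip_norm b z))"
      unfolding abs_mult using assms(2) ipo_cauchy_schwarz[of v z] by (intro mult_left_mono mult_mono) auto
    finally have 1: "2 * t * b v z \<le> 2 * (ip_norm b v * ip_norm b z)" by simp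
    have "t^2 * b z z \<le> 1 * b z z"
      using assms(2) by (intro mult_right_mono ipo_nonneg) (simp add: abs_square_le_1)
    then show ?thesis using 1 by simp
  qed
  also have "\<dots> = (ip_norm b v + ip_norm b z)^2"
    by (simp add: power2_sum ipo_norm_sq algebra_simps)
  finally have "ip_norm b w ^ 2 \<le> (ip_norm b v + ip_norm b z)^2" by (simp add: ipo_norm_sq)
  then show ?thesis by (rule power2_le_imp_le) (simp add: ipo_norm_nonneg)
qed

text \<open>
  The default value \<open>0 powr (p - 2) = 0\<close> is harmless: where the norm vanishes, the inner product
  vanishes, too.
\<close>
lemma ipo_flux_le:
  assumes "1 < p"
  shows "\<bar>ip_norm b v powr (p - 2) * b v z\<bar> \<le> ip_norm b v powr (p - 1) * ip_norm b z"
proof -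
  have "\<bar>ip_norm b v powr (p - 2) * b v z\<bar> \<le> ip_norm b v powr (p - 2) * (ip_norm b v * ip_norm b z)"
    unfolding abs_mult using ipo_cauchy_schwarz by (simp add: mult_left_mono)
  also have "\<dots> = ip_norm b v powr (p - 1) * ip_norm b z"
  proof (cases "ip_norm b v = 0")
    case False
    then have "ip_norm b v powr (p - 1) = ip_norm b v powr (p - 2) * ip_norm b v"
      using powr_mult_base[of "ip_norm b v" "p - 2"] ipo_norm_nonneg[of v] by (simp add: mult.commute)
    then show ?thesis by simp
  qed simp
  finally show ?thesis .
qed

text \<open>
  The tangent inequality for the convex function \<open>|\<xi>|\<^sup>p\<close> at the point \<open>w\<close>, evaluated at
  \<open>v = w - t z\<close>. It follows from the Cauchy-Schwarz and Young inequalities.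
\<close>
lemma ipo_convexity:
  assumes p: "1 < p" and w: "\<And>i. i < kk \<Longrightarrow> w i = t * z i + v i"
  shows "ip_norm b w powr p - p * t * (ip_norm b w powr (p - 2) * b w z) \<le> ip_norm b v powr p"
proof -
  have v: "b w v = b w w - t * b w z"
  proof -
    have "b w w = b w (\<lambda>i. t * z i + v i)" by (rule ipo_cong) (auto simp: w)
    then show ?thesis by (simp add: ipo_linear)
  qed
  have sq: "ip_norm b w powr (p - 2) * b w w = ip_norm b w powr p"
  proof (cases "ip_norm b w = 0")
    case False
    then have pos: "0 < ip_norm b w" using ipo_norm_nonneg[of w] by simp
    have "ip_norm b w powr p = ip_norm b w powr (p - 2) * ip_norm b w powr 2"
      by (simp flip: powr_add)
    then show ?thesis using pos by (simp add: ipo_norm_sq powr_numeral)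
  qed simp
  have "ip_norm b w powr (p - 2) * b w v
      = ip_norm b w powr (p - 2) * b w w - t * (ip_norm b w powr (p - 2) * b w z)"
    unfolding v by (simp add: algebra_simps)
  then have e: "ip_norm b w powr (p - 2) * b w v = ip_norm b w powr p - t * (ip_norm b w powr (p - 2) * b w z)"
    unfolding sq .
  have "p * (ip_norm b w powr (p - 2) * b w v) \<le> p * (ip_norm b w powr (p - 1) * ip_norm b v)"
    using ipo_flux_le[OF p, of w v] p by (intro mult_left_mono) auto
  also have "\<dots> \<le> (p - 1) * ip_norm b w powr p + ip_norm b v powr p"
    using p by (intro young_powr ipo_norm_nonneg)
  finally have "p * (ip_norm b w powr p - t * (ip_norm b w powr (p - 2) * b w z))
      \<le> (p - 1) * ip_norm b w powr p + ip_norm b v powr p"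
    unfolding e .
  then show ?thesis by (simp add: algebra_simps)
qed

lemma ipo_flux_tendsto:
  assumes p: "1 < p" and t: "t \<longlonglongrightarrow> 0" and w: "\<And>n i. i < kk \<Longrightarrow> w n i = t n * z i + v i"
  shows "(\<lambda>n. ip_norm b (w n) powr (p - 2) * b (w n) z) \<longlonglongrightarrow> ip_norm b v powr (p - 2) * b v z"
proof -
  have ww: "b (w n) (w n) = b v v + 2 * t n * b v z + (t n)^2 * b z z" for n
    using ipo_cong[of "w n" "\<lambda>i. t n * z i + v i" "w n" "\<lambda>i. t n * z i + v i"] w ipo_expand by simp
  have "b (w n) z = b z (\<lambda>i. t n * z i + v i)" for n
    using ipo_commute[of "w n" z] ipo_cong[of z z "w n" "\<lambda>i. t n * z i + v i"] w by simp
  then have wz: "b (w n) z = t n * b z z + b v z" for n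
    by (simp add: ipo_linear ipo_commute[of z v])
  have "(\<lambda>n. t n * b z z + b v z) \<longlonglongrightarrow> 0 * b z z + b v z" by (intro tendsto_intros t)
  then have limz: "(\<lambda>n. b (w n) z) \<longlonglongrightarrow> b v z" unfolding wz by simp
  have "(\<lambda>n. sqrt (b v v + 2 * t n * b v z + (t n)^2 * b z z)) \<longlonglongrightarrow> sqrt (b v v + 2 * 0 * b v z + 0^2 * b z z)"
    by (intro tendsto_intros t)
  then have limn: "(\<lambda>n. ip_norm b (w n)) \<longlonglongrightarrow> ip_norm b v"
    unfolding ip_norm_def ww by simp
  show ?thesis
  proof (cases "ip_norm b v = 0")
    case False
    then show ?thesis by (intro tendsto_mult tendsto_powr limz limn tendsto_const) auto
  next
    case True
    have "(\<lambda>n. ip_norm b (w n) powr (p - 1)) \<longlonglongrightarrow> 0"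
      using limn True p by (intro tendsto_zero_powrI[where b = "p - 1"]) (auto simp: ipo_norm_nonneg)
    then have "(\<lambda>n. ip_norm b (w n) powr (p - 1) * ip_norm b z) \<longlonglongrightarrow> 0 * ip_norm b z"
      by (intro tendsto_intros)
    then have lim0: "(\<lambda>n. ip_norm b (w n) powr (p - 1) * ip_norm b z) \<longlonglongrightarrow> 0" by simp
    have "(\<lambda>n. ip_norm b (w n) powr (p - 2) * b (w n) z) \<longlonglongrightarrow> 0"
      by (rule Lim_null_comparison[OF always_eventually lim0])
         (simp only: real_norm_def ipo_flux_le[OF p] simp_thms)
    then show ?thesis using True by simp
  qed
qed

text \<open>
  Since \<open>ip x v w\<close> is measurable in \<open>x\<close> for fixed vectors, this formula makes inner products of
  measurable vector fields measurable.
\<close>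
lemma ipo_coordinates:
  "b v w = (\<Sum>i<kk. \<Sum>j<kk. v i * w j * b (\<lambda>m. if m = i then 1 else 0) (\<lambda>m. if m = j then 1 else 0))"
proof -
  have step: "b v (\<lambda>m. if m < n then w m else 0) = (\<Sum>j<n. w j * b v (\<lambda>m. if m = j then 1 else 0))"
    for v w :: "nat \<Rightarrow> real" and n
  proof (induction n)
    case 0
    then show ?case by (simp add: ipo_zero)
  next
    case (Suc n)
    have "(\<lambda>m. if m < Suc n then w m else 0)
        = (\<lambda>m. w n * (if m = n then 1 else 0) + (if m < n then w m else 0))"
      by (auto simp: fun_eq_iff less_Suc_eq)
    then show ?case by (simp add: ipo_linear Suc)
  qed
  have exp: "b v w = (\<Sum>j<kk. w j * b v (\<lambda>m. if m = j then 1 else 0))" for v w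
    unfolding step[symmetric] by (rule ipo_cong) auto
  have "b v w = (\<Sum>j<kk. w j * b (\<lambda>m. if m = j then 1 else 0) v)"
    unfolding exp[of v w] by (simp add: ipo_commute)
  also have "\<dots> = (\<Sum>j<kk. \<Sum>i<kk. v i * w j * b (\<lambda>m. if m = i then 1 else 0) (\<lambda>m. if m = j then 1 else 0))"
    unfolding exp[of _ v]
    by (intro sum.cong) (auto simp: sum_distrib_left mult_ac ipo_commute intro!: sum.cong)
  finally show ?thesis by (subst sum.swap)
qed

end


section \<open>The Cheeger gradient and the first variation of the energy\<close>

locale cheeger_space = newton_space_balls +
  fixes I :: "nat set" and W :: "nat \<Rightarrow> 'a set" and k :: "nat \<Rightarrow> nat"
    and Y :: "nat \<Rightarrow> 'a \<Rightarrow> nat \<Rightarrow> real"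
    and ip :: "'a \<Rightarrow> (nat \<Rightarrow> real) \<Rightarrow> (nat \<Rightarrow> real) \<Rightarrow> real"
    and D :: "('a \<Rightarrow> ereal) \<Rightarrow> 'a \<Rightarrow> nat \<Rightarrow> real"
  assumes charts: "cheeger_structure p M I W k Y ip"
    and gradient: "cheeger_gradient p M I W k Y ip D"
begin

lemma chart_sets: "\<alpha> \<in> I \<Longrightarrow> W \<alpha> \<in> sets M"
  and chart_cover: "AE x in M. x \<in> (\<Union>\<alpha>\<in>I. W \<alpha>)"
  and chart_ip: "\<alpha> \<in> I \<Longrightarrow> AE x in M. x \<in> W \<alpha> \<longrightarrow> inner_product_on (k \<alpha>) (ip x)"
  and chart_ip_measurable: "\<alpha> \<in> I \<Longrightarrow> (\<lambda>x. ip x v w) \<in> borel_measurable (restrict_space M (W \<alpha>))"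
  using charts unfolding cheeger_structure_def by blast+

lemma D_measurable:
  "u \<in> newtonian p M UNIV \<Longrightarrow> \<alpha> \<in> I \<Longrightarrow> i < k \<alpha> \<Longrightarrow>
     (\<lambda>x. D u x i) \<in> borel_measurable (restrict_space M (W \<alpha>))"
  using gradient unfolding cheeger_gradient_def by blast

lemma D_linear:
  "u \<in> newtonian p M UNIV \<Longrightarrow> v \<in> newtonian p M UNIV \<Longrightarrow> w \<in> newtonian p M UNIV \<Longrightarrow>
   AE x in M. w x = ereal a * u x + ereal b * v x \<Longrightarrow> \<alpha> \<in> I \<Longrightarrow>
   AE x in M. x \<in> W \<alpha> \<longrightarrow> (\<forall>i<k \<alpha>. D w x i = a * D u x i + b * D v x i)"
  using gradient unfolding cheeger_gradient_def by blast

lemma D_comparable: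
  obtains C where "0 < C"
    "\<And>u g. u \<in> newtonian p M UNIV \<Longrightarrow> is_min_weak_upper_gradient p M u g \<Longrightarrow>
       AE x in M. ennreal (ip_norm (ip x) (D u x)) \<le> ennreal C * g x"
proof -
  obtain C where C: "C > 0" "\<forall>u\<in>newtonian p M UNIV. \<forall>g. is_min_weak_upper_gradient p M u g \<longrightarrow>
        (AE x in M.
           ennreal (1 / C) * g x \<le> ennreal (ip_norm (ip x) (D u x)) \<and>
           ennreal (ip_norm (ip x) (D u x)) \<le> ennreal C * g x)"
    using gradient unfolding cheeger_gradient_def by blast
  show thesis
  proof (rule that[OF C(1)])
    fix u g assume "u \<in> newtonian p M UNIV" "is_min_weak_upper_gradient p M u g"
    then have "AE x in M.
           ennreal (1 / C) * g x \<le> ennreal (ip_norm (ip x) (D u x)) \<and>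
           ennreal (ip_norm (ip x) (D u x)) \<le> ennreal C * g x" using C(2) by blast
    then show "AE x in M. ennreal (ip_norm (ip x) (D u x)) \<le> ennreal C * g x" by eventually_elim auto
  qed
qed

lemma AE_chartI:
  assumes "\<And>\<alpha>. \<alpha> \<in> I \<Longrightarrow> AE x in M. x \<in> W \<alpha> \<longrightarrow> P \<alpha> x"
  shows "AE x in M. \<exists>\<alpha>\<in>I. x \<in> W \<alpha> \<and> P \<alpha> x \<and> inner_product_on (k \<alpha>) (ip x)"
proof -
  have cI: "countable I" by simp
  have "AE x in M. \<forall>\<alpha>\<in>I. x \<in> W \<alpha> \<longrightarrow> P \<alpha> x"
    using assms by (subst AE_ball_countable[OF cI]) auto
  moreover have "AE x in M. \<forall>\<alpha>\<in>I. x \<in> W \<alpha> \<longrightarrow> inner_product_on (k \<alpha>) (ip x)"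
    using chart_ip by (subst AE_ball_countable[OF cI]) auto
  ultimately show ?thesis using chart_cover by eventually_elim blast
qed

text \<open>
  \<open>D u\<close> and the inner products are only meaningful chart by chart and almost everywhere, so
  measurability has to be glued from countably many charts and a null set.
\<close>
lemma chartwise_measurable:
  fixes F :: "'a \<Rightarrow> real"
  assumes "\<And>\<alpha>. \<alpha> \<in> I \<Longrightarrow> \<exists>H\<in>borel_measurable (restrict_space M (W \<alpha>)). AE x in M. x \<in> W \<alpha> \<longrightarrow> F x = H x"
  shows "F \<in> borel_measurable M"
proof -
  let ?R = "UNIV - (\<Union>\<alpha>\<in>I. W \<alpha>)"
  have "(\<Union>\<alpha>\<in>I. W \<alpha>) \<in> sets M" using chart_sets by (intro sets.countable_UN') auto
  from sets.compl_sets[OF this] have R: "?R \<in> sets M" by simp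
  show ?thesis
  proof (rule measurable_piecewise_restrict[of "insert ?R (W ` I)"])
    fix A assume "A \<in> insert ?R (W ` I)"
    then have A: "A \<in> sets M" using R chart_sets by auto
    then show "A \<inter> space M \<in> sets M" by simp
    show "F \<in> borel_measurable (restrict_space M A)"
    proof (cases "A = ?R")
      case True
      have "(\<lambda>x. indicator A x *\<^sub>R F x) \<in> borel_measurable M"
      proof (rule measurable_AE_cong[of "\<lambda>_. 0"])
        show "AE x in M. 0 = indicator A x *\<^sub>R F x"
          using chart_cover by eventually_elim (auto simp: True)
      qed simp
      then show ?thesis using A by (subst borel_measurable_restrict_space_iff) auto
    next
      case False
      then obtain \<alpha> where \<alpha>: "\<alpha> \<in> I" "A = W \<alpha>" using \<open>A \<in> insert ?R (W ` I)\<close> by auto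
      then obtain H where H: "H \<in> borel_measurable (restrict_space M A)" "AE x in M. x \<in> A \<longrightarrow> F x = H x"
        using assms by blast
      have "(\<lambda>x. indicator A x *\<^sub>R F x) \<in> borel_measurable M"
      proof (rule measurable_AE_cong[of "\<lambda>x. indicator A x *\<^sub>R H x"])
        show "(\<lambda>x. indicator A x *\<^sub>R H x) \<in> borel_measurable M"
          using H(1) A by (subst (asm) borel_measurable_restrict_space_iff) auto
        show "AE x in M. indicator A x *\<^sub>R H x = indicator A x *\<^sub>R F x"
          using H(2) by eventually_elim (auto simp: indicator_def)
      qed
      then show ?thesis using A by (subst borel_measurable_restrict_space_iff) auto
    qed
  qed auto
qed

definition Dprod :: "('a \<Rightarrow> ereal) \<Rightarrow> ('a \<Rightarrow> ereal) \<Rightarrow> 'a \<Rightarrow> real" where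
  "Dprod u v x = ip x (D u x) (D v x)"

definition Dnorm :: "('a \<Rightarrow> ereal) \<Rightarrow> 'a \<Rightarrow> real" where
  "Dnorm u x = ip_norm (ip x) (D u x)"

lemma Dprod_measurable:
  assumes "u \<in> newtonian p M UNIV" "v \<in> newtonian p M UNIV"
  shows "Dprod u v \<in> borel_measurable M"
proof (rule chartwise_measurable)
  fix \<alpha> assume \<alpha>: "\<alpha> \<in> I"
  let ?e = "\<lambda>i (m::nat). if m = i then 1 else (0::real)"
  let ?H = "\<lambda>x. \<Sum>i<k \<alpha>. \<Sum>j<k \<alpha>. D u x i * D v x j * ip x (?e i) (?e j)"
  have "?H \<in> borel_measurable (restrict_space M (W \<alpha>))"
    using \<alpha> assms by (intro borel_measurable_sum borel_measurable_times D_measurable chart_ip_measurable) auto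
  moreover have "AE x in M. x \<in> W \<alpha> \<longrightarrow> Dprod u v x = ?H x"
    using chart_ip[OF \<alpha>] unfolding Dprod_def by eventually_elim (intro impI ipo_coordinates, blast)
  ultimately show "\<exists>H\<in>borel_measurable (restrict_space M (W \<alpha>)). AE x in M. x \<in> W \<alpha> \<longrightarrow> Dprod u v x = H x"
    by (intro bexI[where x = ?H])
qed

lemma Dnorm_measurable: "u \<in> newtonian p M UNIV \<Longrightarrow> Dnorm u \<in> borel_measurable M"
proof -
  assume "u \<in> newtonian p M UNIV"
  then have [measurable]: "Dprod u u \<in> borel_measurable M" by (intro Dprod_measurable)
  have "(\<lambda>x. sqrt (Dprod u u x)) \<in> borel_measurable M" by measurable
  then show ?thesis by (simp add: Dnorm_def[abs_def] Dprod_def ip_norm_def)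
qed

lemma Dnorm_nonneg_AE: "AE x in M. 0 \<le> Dnorm u x"
proof -
  have "AE x in M. \<exists>\<alpha>\<in>I. x \<in> W \<alpha> \<and> True \<and> inner_product_on (k \<alpha>) (ip x)"
    by (rule AE_chartI) simp
  then show ?thesis unfolding Dnorm_def by eventually_elim (auto intro: ipo_norm_nonneg)
qed

abbreviation er :: "('a \<Rightarrow> real) \<Rightarrow> 'a \<Rightarrow> ereal" where
  "er f \<equiv> (\<lambda>x. ereal (f x))"

lemma newt_iff: "f \<in> newt \<longleftrightarrow> er f \<in> newtonian p M UNIV"
  by (simp add: newt_def)

lemma D_combination:
  assumes "f \<in> newt" "h \<in> newt" "w \<in> newt" "AE x in M. w x = a * f x + b * h x"
  shows "AE x in M. \<exists>\<alpha>. inner_product_on (k \<alpha>) (ip x) \<and>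
    (\<forall>i<k \<alpha>. D (er w) x i = a * D (er f) x i + b * D (er h) x i)"
proof -
  have "AE x in M. er w x = ereal a * er f x + ereal b * er h x"
    using assms(4) by eventually_elim simp
  then have "AE x in M. x \<in> W \<alpha> \<longrightarrow> (\<forall>i<k \<alpha>. D (er w) x i = a * D (er f) x i + b * D (er h) x i)"
    if "\<alpha> \<in> I" for \<alpha> using assms(1-3) that by (intro D_linear) (auto simp: newt_iff)
  then have "AE x in M. \<exists>\<alpha>\<in>I. x \<in> W \<alpha> \<and> (\<forall>i<k \<alpha>. D (er w) x i = a * D (er f) x i + b * D (er h) x i) \<and> inner_product_on (k \<alpha>) (ip x)"
    by (rule AE_chartI)
  then show ?thesis by eventually_elim blast
qed

lemma D_AE_cong:
  assumes "u \<in> newtonian p M UNIV" "f \<in> newt" "AE x in M. u x = er f x"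
  shows "AE x in M. Dnorm u x = Dnorm (er f) x \<and> (\<forall>v. Dprod u v x = Dprod (er f) v x)"
proof -
  have "AE x in M. er f x = ereal 1 * u x + ereal 0 * u x"
    using assms(3) by eventually_elim (simp flip: zero_ereal_def one_ereal_def)
  then have "AE x in M. x \<in> W \<alpha> \<longrightarrow> (\<forall>i<k \<alpha>. D (er f) x i = 1 * D u x i + 0 * D u x i)"
    if "\<alpha> \<in> I" for \<alpha> using assms that by (intro D_linear) (auto simp: newt_iff)
  then have "AE x in M. \<exists>\<alpha>\<in>I. x \<in> W \<alpha> \<and> (\<forall>i<k \<alpha>. D (er f) x i = 1 * D u x i + 0 * D u x i) \<and> inner_product_on (k \<alpha>) (ip x)"
    by (rule AE_chartI)
  then show ?thesis
  proof eventually_elim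
    case (elim x)
    then obtain \<alpha> where \<alpha>: "inner_product_on (k \<alpha>) (ip x)" "\<forall>i<k \<alpha>. D (er f) x i = D u x i" by auto
    have "ip x (D u x) (D u x) = ip x (D (er f) x) (D (er f) x)"
      by (rule ipo_cong[OF \<alpha>(1)]) (simp_all add: \<alpha>(2))
    moreover have "ip x (D u x) (D v x) = ip x (D (er f) x) (D v x)" for v
      by (rule ipo_cong[OF \<alpha>(1)]) (simp_all add: \<alpha>(2))
    ultimately show ?case by (simp add: Dnorm_def Dprod_def ip_norm_def)
  qed
qed

lemma Dnorm_energy_finite:
  assumes "f \<in> newt"
  shows "energy p M (\<lambda>x. ennreal (Dnorm (er f) x)) < \<infinity>"
proof -
  obtain g where g: "is_min_weak_upper_gradient p M (er f) g" "energy p M g < \<infinity>" "g \<in> borel_measurable borel"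
    using min_weak_upper_gradient_exists[OF assms] .
  obtain C where C: "0 < C" "AE x in M. ennreal (ip_norm (ip x) (D (er f) x)) \<le> ennreal C * g x"
    using D_comparable g(1) assms newt_iff by metis
  have "energy p M (\<lambda>x. ennreal (Dnorm (er f) x)) \<le> energy p M (\<lambda>x. ennreal C * g x)"
    unfolding energy_def
  proof (rule nn_integral_mono_AE)
    show "AE x in M. epowr (ennreal (Dnorm (er f) x)) p \<le> epowr (ennreal C * g x) p"
      using C(2) by eventually_elim (auto simp: Dnorm_def intro!: epowr_mono p_pos)
  qed
  also have "\<dots> = ennreal (C powr p) * energy p M g"
    using C(1) g(3) by (intro energy_cmult borel_measurable_M)
  also have "\<dots> < \<infinity>" using g(2) by (simp add: ennreal_mult_less_top)
  finally show ?thesis .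
qed

text \<open>
  Locality of the Cheeger gradient, inherited from the minimal weak upper gradient.
\<close>
lemma Dnorm_zero:
  assumes "f \<in> newt"
  shows "AE x in M. f x = 0 \<longrightarrow> Dnorm (er f) x = 0"
proof -
  obtain g where g: "is_min_weak_upper_gradient p M (er f) g"
    using min_weak_upper_gradient_exists[OF assms] .
  obtain C where C: "0 < C" "AE x in M. ennreal (ip_norm (ip x) (D (er f) x)) \<le> ennreal C * g x"
    using D_comparable g(1) assms newt_iff by metis
  show ?thesis
    using C(2) min_weak_upper_gradient_zero[OF assms g] Dnorm_nonneg_AE[of "er f"]
    by eventually_elim (auto simp: Dnorm_def)
qed

text \<open>
  Write \<open>f\<close> as the difference of its positive and its negative part. At almost every point one of
  the two parts has vanishing gradient.
\<close>
lemma Dnorm_pos_part_le: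
  assumes "f \<in> newt"
  shows "AE x in M. Dnorm (er (\<lambda>x. max 0 (f x))) x \<le> Dnorm (er f) x"
proof -
  let ?P = "\<lambda>x. max 0 (f x)" and ?N = "\<lambda>x. max 0 (- f x)"
  have P: "?P \<in> newt" using assms by (rule newt_pos_part)
  have N: "?N \<in> newt" using newt_pos_part[OF newt_scale[OF assms, of "-1"]] by simp
  have "AE x in M. \<exists>\<alpha>. inner_product_on (k \<alpha>) (ip x) \<and>
    (\<forall>i<k \<alpha>. D (er ?P) x i = 1 * D (er f) x i + 1 * D (er ?N) x i)"
    by (rule D_combination[OF assms N P]) (auto simp: max_def)
  then show ?thesis using Dnorm_zero[OF P] Dnorm_zero[OF N] Dnorm_nonneg_AE[of "er f"]
  proof eventually_elim
    case (elim x)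
    then obtain \<alpha> where \<alpha>: "inner_product_on (k \<alpha>) (ip x)"
      "\<And>i. i < k \<alpha> \<Longrightarrow> D (er ?P) x i = D (er f) x i + D (er ?N) x i" by auto
    show ?case
    proof (cases "f x \<le> 0")
      case True
      then have "Dnorm (er ?P) x = 0" using elim(2) by simp
      then show ?thesis using elim(4) by simp
    next
      case False
      then have "Dnorm (er ?N) x = 0" using elim(3) by simp
      then have "D (er ?N) x i = 0" if "i < k \<alpha>" for i
        using ipo_eq_0[OF \<alpha>(1) _ that] ipo_norm_sq[OF \<alpha>(1), of "D (er ?N) x"] by (simp add: Dnorm_def)
      then have "D (er ?P) x i = D (er f) x i" if "i < k \<alpha>" for i using \<alpha>(2) that by simp
      then show ?thesis
        unfolding Dnorm_def ip_norm_def by (subst ipo_cong[OF \<alpha>(1)]) auto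
    qed
  qed
qed

lemma Dnorm_sum_integrable:
  assumes "f \<in> newt" "h \<in> newt"
  shows "integrable M (\<lambda>x. (Dnorm (er f) x + Dnorm (er h) x) powr p)"
proof -
  have [measurable]: "Dnorm (er f) \<in> borel_measurable M" "Dnorm (er h) \<in> borel_measurable M"
    using assms by (auto simp: newt_iff intro: Dnorm_measurable)
  have "energy p M (\<lambda>x. ennreal (Dnorm (er f) x) + ennreal (Dnorm (er h) x)) < \<infinity>"
    using assms by (intro energy_add_finite p_pos Dnorm_energy_finite) auto
  also have "energy p M (\<lambda>x. ennreal (Dnorm (er f) x) + ennreal (Dnorm (er h) x))
      = (\<integral>\<^sup>+x. ennreal ((Dnorm (er f) x + Dnorm (er h) x) powr p) \<partial>M)"
    unfolding energy_def
  proof (rule nn_integral_cong_AE)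
    show "AE x in M. epowr (ennreal (Dnorm (er f) x) + ennreal (Dnorm (er h) x)) p
        = ennreal ((Dnorm (er f) x + Dnorm (er h) x) powr p)"
      using Dnorm_nonneg_AE[of "er f"] Dnorm_nonneg_AE[of "er h"]
      by eventually_elim (simp flip: ennreal_plus)
  qed
  finally show ?thesis by (intro integrableI_nonneg) auto
qed

lemma Dnorm_integrable: "f \<in> newt \<Longrightarrow> integrable M (\<lambda>x. Dnorm (er f) x powr p)"
proof (rule Bochner_Integration.integrable_bound[OF Dnorm_sum_integrable[of f f]])
  assume f: "f \<in> newt"
  then have [measurable]: "Dnorm (er f) \<in> borel_measurable M" by (auto simp: newt_iff intro: Dnorm_measurable)
  show "(\<lambda>x. Dnorm (er f) x powr p) \<in> borel_measurable M" by measurable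
  show "AE x in M. norm (Dnorm (er f) x powr p) \<le> norm ((Dnorm (er f) x + Dnorm (er f) x) powr p)"
    using Dnorm_nonneg_AE[of "er f"] by eventually_elim (auto intro!: powr_mono2 simp: p_pos less_imp_le)
qed

text \<open>
  The integrand \<open>|Du|\<^bsup>p-2\<^esup> Du \<cdot> Dv\<close> of the Euler-Lagrange equation.
\<close>
definition flux :: "('a \<Rightarrow> ereal) \<Rightarrow> ('a \<Rightarrow> ereal) \<Rightarrow> 'a \<Rightarrow> real" where
  "flux u v x = Dnorm u x powr (p - 2) * Dprod u v x"

text \<open>
  Convexity gives \<open>|Df|\<^sup>p \<ge> |Dw|\<^sup>p - p t |Dw|\<^bsup>p-2\<^esup> Dw \<cdot> Dh\<close> with \<open>w = f + t h\<close>. Integrating and using that the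
  energy of \<open>w\<close> is at least the energy of \<open>f\<close> shows that the flux of \<open>w\<close> in direction \<open>h\<close> has
  nonnegative integral; then \<open>t\<close> tends to \<open>0\<close>. The tangent is taken at \<open>w\<close> and not at \<open>f\<close>, so that
  the limit is one of integrals and not of difference quotients.
\<close>
lemma variation_inequality:
  assumes f: "f \<in> newt" and h: "h \<in> newt" and A: "A \<in> sets M"
    and min: "\<And>t. 0 < t \<Longrightarrow> t \<le> 1 \<Longrightarrow>
      (\<integral>\<^sup>+x\<in>A. ennreal (Dnorm (er f) x powr p) \<partial>M) \<le>
      (\<integral>\<^sup>+x\<in>A. ennreal (Dnorm (er (\<lambda>x. f x + t * h x)) x powr p) \<partial>M)"
  shows "0 \<le> (LINT x:A|M. flux (er f) (er h) x)"
proof -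
  define t where "t n = 1 / real (Suc n)" for n
  have t: "0 < t n" "t n \<le> 1" for n by (auto simp: t_def)
  define w where "w n = (\<lambda>x. f x + t n * h x)" for n
  have w: "w n \<in> newt" for n unfolding w_def by (intro newt_add newt_scale f h)
  have [measurable]: "Dnorm (er (w n)) \<in> borel_measurable M" "Dnorm (er f) \<in> borel_measurable M"
    "Dnorm (er h) \<in> borel_measurable M" "Dprod (er (w n)) (er h) \<in> borel_measurable M"
    "Dprod (er f) (er h) \<in> borel_measurable M" for n
    using f h w[of n] by (auto simp: newt_iff intro: Dnorm_measurable Dprod_measurable)
  note [measurable] = A
  let ?K = "\<lambda>x. (Dnorm (er f) x + Dnorm (er h) x) powr p"
  let ?F = "\<lambda>n x. indicator A x * flux (er (w n)) (er h) x"
  have chart: "AE x in M. \<exists>\<alpha>. inner_product_on (k \<alpha>) (ip x) \<and>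
    (\<forall>n. \<forall>i<k \<alpha>. D (er (w n)) x i = t n * D (er h) x i + D (er f) x i)"
  proof -
    have "AE x in M. x \<in> W \<alpha> \<longrightarrow> (\<forall>n. \<forall>i<k \<alpha>. D (er (w n)) x i = t n * D (er h) x i + D (er f) x i)"
      if \<alpha>: "\<alpha> \<in> I" for \<alpha>
    proof -
      have "AE x in M. x \<in> W \<alpha> \<longrightarrow> (\<forall>i<k \<alpha>. D (er (w n)) x i = t n * D (er h) x i + 1 * D (er f) x i)" for n
        using f h w[of n] by (intro D_linear[OF _ _ _ _ \<alpha>]) (auto simp: newt_iff w_def add.commute)
      then have "AE x in M. \<forall>n. x \<in> W \<alpha> \<longrightarrow> (\<forall>i<k \<alpha>. D (er (w n)) x i = t n * D (er h) x i + 1 * D (er f) x i)"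
        unfolding AE_all_countable by (rule allI)
      then show ?thesis by eventually_elim auto
    qed
    then have "AE x in M. \<exists>\<alpha>\<in>I. x \<in> W \<alpha> \<and> (\<forall>n. \<forall>i<k \<alpha>. D (er (w n)) x i = t n * D (er h) x i + D (er f) x i) \<and> inner_product_on (k \<alpha>) (ip x)"
    by (rule AE_chartI)
    then show ?thesis by eventually_elim blast
  qed
  have bound: "AE x in M. \<forall>n. \<bar>flux (er (w n)) (er h) x\<bar> \<le> ?K x"
    using chart
  proof eventually_elim
    case (elim x)
    then obtain \<alpha> where ipx: "inner_product_on (k \<alpha>) (ip x)"
      and D: "\<And>n i. i < k \<alpha> \<Longrightarrow> D (er (w n)) x i = t n * D (er h) x i + D (er f) x i" by blast
    show ?case
    proof
      fix n
      let ?w = "Dnorm (er (w n)) x" and ?s = "Dnorm (er f) x + Dnorm (er h) x"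
      have nn: "0 \<le> ?w" "0 \<le> Dnorm (er f) x" "0 \<le> Dnorm (er h) x"
        unfolding Dnorm_def by (rule ipo_norm_nonneg[OF ipx])+
      have "?w \<le> ?s" unfolding Dnorm_def
        by (rule ipo_triangle[OF ipx D]) (use t[of n] in auto)
      have "\<bar>flux (er (w n)) (er h) x\<bar> \<le> ?w powr (p - 1) * Dnorm (er h) x"
        using ipo_flux_le[OF ipx p_gt_1] unfolding flux_def Dprod_def Dnorm_def .
      also have "\<dots> \<le> ?s powr (p - 1) * ?s"
        using \<open>?w \<le> ?s\<close> nn p_gt_1 by (intro mult_mono powr_mono2) auto
      also have "\<dots> = ?K x"
        using powr_mult_base[of ?s "p - 1"] nn by (simp add: mult.commute)
      finally show "\<bar>flux (er (w n)) (er h) x\<bar> \<le> ?K x" .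
    qed
  qed
  have Fint: "integrable M (?F n)" for n
  proof (rule Bochner_Integration.integrable_bound[OF Dnorm_sum_integrable[OF f h]])
    show "?F n \<in> borel_measurable M" unfolding flux_def by measurable
    show "AE x in M. norm (?F n x) \<le> norm (?K x)"
      using bound by eventually_elim (auto simp: indicator_def)
  qed
  have wint: "integrable M (\<lambda>x. indicator A x * Dnorm (er v) x powr p)" if "v \<in> newt" for v
    using integrable_mult_indicator[OF A Dnorm_integrable[OF that]] by simp
  have F_nonneg: "0 \<le> (\<integral>x. ?F n x \<partial>M)" for n
  proof -
    let ?J = "\<lambda>v. \<integral>x. indicator A x * Dnorm (er v) x powr p \<partial>M"
    have J: "(\<integral>\<^sup>+x\<in>A. ennreal (Dnorm (er v) x powr p) \<partial>M) = ennreal (?J v)" if "v \<in> newt" for v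
    proof -
      have "(\<integral>\<^sup>+x\<in>A. ennreal (Dnorm (er v) x powr p) \<partial>M)
          = (\<integral>\<^sup>+x. ennreal (indicator A x * Dnorm (er v) x powr p) \<partial>M)"
        by (intro nn_integral_cong) (auto simp: indicator_def)
      also have "\<dots> = ennreal (?J v)" by (rule nn_integral_eq_integral[OF wint[OF that]]) auto
      finally show ?thesis .
    qed
    have er_w: "(\<lambda>x. ereal (f x + t n * h x)) = er (w n)" by (simp add: w_def)
    have "?J f \<le> ?J (w n)"
      using min[OF t[of n]] unfolding er_w J[OF f] J[OF w]
      by (subst (asm) ennreal_le_iff) (auto intro!: integral_nonneg_AE)
    also have "?J (w n) - p * t n * (\<integral>x. ?F n x \<partial>M)
        = (\<integral>x. indicator A x * Dnorm (er (w n)) x powr p - p * t n * ?F n x \<partial>M)"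
      using wint[OF w] Fint by simp
    then have "?J (w n) - p * t n * (\<integral>x. ?F n x \<partial>M) \<le> ?J f"
    proof (rule ord_eq_le_trans)
      show "(\<integral>x. indicator A x * Dnorm (er (w n)) x powr p - p * t n * ?F n x \<partial>M) \<le> ?J f"
      proof (rule integral_mono_AE)
        show "AE x in M. indicator A x * Dnorm (er (w n)) x powr p - p * t n * ?F n x
            \<le> indicator A x * Dnorm (er f) x powr p"
          using chart
        proof eventually_elim
          case (elim x)
          then obtain \<alpha> where ipx: "inner_product_on (k \<alpha>) (ip x)"
            and D: "\<And>n i. i < k \<alpha> \<Longrightarrow> D (er (w n)) x i = t n * D (er h) x i + D (er f) x i" by blast
          show ?case
            using ipo_convexity[OF ipx p_gt_1 D[where n = n]]
            by (auto simp: indicator_def flux_def Dprod_def Dnorm_def)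
        qed
      qed (use wint[OF w] wint[OF f] Fint in auto)
    qed
    ultimately have "0 \<le> p * t n * (\<integral>x. ?F n x \<partial>M)" by linarith
    then show ?thesis using mult_pos_pos[OF p_pos t(1)[of n]] by (simp add: zero_le_mult_iff)
  qed
  have "t \<longlonglongrightarrow> 0" unfolding t_def using LIMSEQ_inverse_real_of_nat by (simp add: inverse_eq_divide)
  have "(\<lambda>n. \<integral>x. ?F n x \<partial>M) \<longlonglongrightarrow> (\<integral>x. indicator A x * flux (er f) (er h) x \<partial>M)"
  proof (rule integral_dominated_convergence[OF _ _ Dnorm_sum_integrable[OF f h]])
    show "(\<lambda>x. indicator A x * flux (er f) (er h) x) \<in> borel_measurable M" unfolding flux_def by measurable
    show "?F n \<in> borel_measurable M" for n unfolding flux_def by measurable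
    show "AE x in M. (\<lambda>n. ?F n x) \<longlonglongrightarrow> indicator A x * flux (er f) (er h) x"
      using chart
    proof eventually_elim
      case (elim x)
      then obtain \<alpha> where ipx: "inner_product_on (k \<alpha>) (ip x)"
        and D: "\<And>n i. i < k \<alpha> \<Longrightarrow> D (er (w n)) x i = t n * D (er h) x i + D (er f) x i" by blast
      show ?case
        unfolding flux_def Dprod_def Dnorm_def
        by (intro tendsto_mult_left ipo_flux_tendsto[OF ipx p_gt_1 \<open>t \<longlonglongrightarrow> 0\<close> D])
    qed
    show "AE x in M. norm (?F n x) \<le> ?K x" for n
      using bound by eventually_elim (auto simp: indicator_def)
  qed
  then have "0 \<le> (\<integral>x. indicator A x * flux (er f) (er h) x \<partial>M)"
    by (rule LIMSEQ_le_const) (use F_nonneg in auto)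
  then show ?thesis by (simp add: set_lebesgue_integral_def)
qed

end


section \<open>Truncations and cutoff functions\<close>

text \<open>
  Truncation also turns extended real functions into real ones.
\<close>
definition trunc :: "real \<Rightarrow> ereal \<Rightarrow> real" where
  "trunc n a = real_of_ereal (max (- ereal n) (min a (ereal n)))"

lemma trunc_simps [simp]:
  "0 \<le> n \<Longrightarrow> trunc n (ereal r) = max (- n) (min r n)"
  "trunc n \<infinity> = max (- n) n" "0 \<le> n \<Longrightarrow> trunc n (- \<infinity>) = - n"
  by (auto simp: trunc_def max_def min_def)

lemma trunc_abs_le: "0 \<le> n \<Longrightarrow> \<bar>trunc n a\<bar> \<le> n"
  by (cases a) auto

lemma trunc_measurable [measurable]: "trunc n \<in> borel_measurable borel"
  unfolding trunc_def by measurable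

lemma trunc_diff_le: "0 \<le> n \<Longrightarrow> ennreal \<bar>trunc n a - trunc n b\<bar> \<le> ext_diff a b"
  by (cases a; cases b) (auto simp: ext_diff_def e2ennreal_ereal intro!: ennreal_leI)

lemma trunc_size_le: "0 \<le> n \<Longrightarrow> ennreal \<bar>trunc n a\<bar> \<le> e2ennreal \<bar>a\<bar>"
  by (cases a) (auto simp: e2ennreal_ereal intro!: ennreal_leI)

lemma trunc_tendsto: "(\<lambda>n. ereal (trunc (real n) a)) \<longlonglongrightarrow> a"
proof (cases a)
  case (real r)
  obtain N where N: "\<bar>r\<bar> \<le> real N" using real_arch_simple by blast
  have "eventually (\<lambda>n. ereal (trunc (real n) a) = a) sequentially"
    by (rule eventually_sequentiallyI[of N]) (use real N in auto)
  then show ?thesis by (rule tendsto_eventually)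
next
  case PInf
  have "(\<lambda>n. ereal (real n)) \<longlonglongrightarrow> \<infinity>" by (rule id_nat_ereal_tendsto_PInf)
  then show ?thesis using PInf by simp
next
  case MInf
  have "(\<lambda>n. - ereal (real n)) \<longlonglongrightarrow> - \<infinity>" by (intro tendsto_uminus_ereal id_nat_ereal_tendsto_PInf)
  then show ?thesis using MInf by simp
qed

lemma trunc_eq_imp_eq: "(\<And>n::nat. trunc (real n) a = trunc (real n) b) \<Longrightarrow> a = b"
  using trunc_tendsto[of a] trunc_tendsto[of b] by (simp add: LIMSEQ_unique)

lemma real_of_ereal_diff_le: "ennreal \<bar>real_of_ereal a - real_of_ereal b\<bar> \<le> ext_diff a b"
  by (cases a; cases b) (auto simp: ext_diff_def e2ennreal_ereal)

context newton_space
begin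

lemma newt_contraction:
  assumes u: "u \<in> newtonian p M UNIV" and F: "F \<in> borel_measurable borel"
    and diff: "\<And>a b. ennreal \<bar>F a - F b\<bar> \<le> ext_diff a b" and size: "\<And>a. ennreal \<bar>F a\<bar> \<le> e2ennreal \<bar>a\<bar>"
  shows "(\<lambda>x. F (u x)) \<in> newt"
proof -
  obtain g where g: "g \<in> borel_measurable borel" "upper_gradient UNIV u g" "energy p M g < \<infinity>"
    "energy p M (\<lambda>x. e2ennreal \<bar>u x\<bar>) < \<infinity>" and [measurable]: "u \<in> borel_measurable M"
    using newtonian_UNIV_D[OF u] .
  note [measurable] = F
  show ?thesis
  proof (rule newtI[of _ g])
    show "(\<lambda>x. F (u x)) \<in> borel_measurable M" by measurable
    have "energy p M (\<lambda>x. ennreal \<bar>F (u x)\<bar>) \<le> energy p M (\<lambda>x. e2ennreal \<bar>u x\<bar>)"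
      by (intro energy_mono p_pos size)
    then show "energy p M (\<lambda>x. ennreal \<bar>F (u x)\<bar>) < \<infinity>" using g(4) by order
    fix l and \<gamma> :: "real \<Rightarrow> 'a" assume "arc_length_curve UNIV l \<gamma>"
    then have "ext_diff (u (\<gamma> 0)) (u (\<gamma> l)) \<le> line_integral l \<gamma> g"
      using g(2) by (auto simp: upper_gradient_def)
    then show "ennreal \<bar>F (u (\<gamma> 0)) - F (u (\<gamma> l))\<bar> \<le> line_integral l \<gamma> g"
      using diff order_trans by blast
  qed (use g in auto)
qed

lemma newt_real_part: "u \<in> newtonian p M UNIV \<Longrightarrow> (\<lambda>x. real_of_ereal (u x)) \<in> newt"
proof (rule newt_contraction)
  show "ennreal \<bar>real_of_ereal a\<bar> \<le> e2ennreal \<bar>a\<bar>" for a by (cases a) (auto simp: e2ennreal_ereal)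
qed (auto intro: real_of_ereal_diff_le)

lemma newt_trunc: "u \<in> newtonian p M UNIV \<Longrightarrow> 0 \<le> n \<Longrightarrow> (\<lambda>x. trunc n (u x)) \<in> newt"
  by (rule newt_contraction) (auto intro: trunc_diff_le trunc_size_le)

text \<open>
  The constant \<open>m\<close> is an upper gradient, but it may fail to be \<open>p\<close>-integrable on an unbounded space;
  therefore it is restricted to the set \<open>G\<close> off which the function vanishes.
\<close>
lemma newt_cutoff:
  assumes G: "open G" "emeasure M G < \<infinity>" "- G \<noteq> {}" and m: "0 < m"
  shows "(\<lambda>x. min 1 (m * infdist x (- G))) \<in> newt"
proof -
  let ?\<eta> = "\<lambda>x. min 1 (m * infdist x (- G))"
  have [measurable]: "G \<in> sets borel" using G(1) by simp
  have lip: "\<bar>?\<eta> x - ?\<eta> y\<bar> \<le> m * dist x y" for x y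
  proof -
    have "\<bar>?\<eta> x - ?\<eta> y\<bar> \<le> \<bar>m * infdist x (- G) - m * infdist y (- G)\<bar>" by linarith
    also have "\<dots> = m * \<bar>infdist x (- G) - infdist y (- G)\<bar>"
      using m by (simp add: abs_mult flip: right_diff_distrib)
    also have "\<dots> \<le> m * dist x y" using m infdist_triangle_abs by (intro mult_left_mono) auto
    finally show ?thesis .
  qed
  have zero: "?\<eta> x = 0" if "x \<notin> G" for x using that by simp
  have \<eta>01: "0 \<le> ?\<eta> x" "?\<eta> x \<le> 1" for x using m by (simp_all add: infdist_nonneg)
  let ?g = "\<lambda>x. ennreal m * indicator G x"
  have Gint: "energy p M (\<lambda>x. indicator G x) < \<infinity>"
  proof -
    have "energy p M (\<lambda>x. indicator G x) = (\<integral>\<^sup>+x. indicator G x \<partial>M)"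
      unfolding energy_def by (intro nn_integral_cong) (auto simp: indicator_def epowr_ennreal[of 1, simplified])
    then show ?thesis using G(2) borel_sets_M[of G] by simp
  qed
  show ?thesis
  proof (rule newtI[of _ ?g])
    have "continuous_on UNIV ?\<eta>" by (intro continuous_intros)
    then show "?\<eta> \<in> borel_measurable M" by (intro borel_measurable_M borel_measurable_continuous_onI)
    show "?g \<in> borel_measurable borel" by measurable
    show "energy p M ?g < \<infinity>"
    proof -
      have "(\<lambda>x. indicator G x :: ennreal) \<in> borel_measurable M" by (intro borel_measurable_M) measurable
      from energy_cmult[OF m this, of p] show ?thesis using Gint by (simp add: ennreal_mult_less_top)
    qed
    have "energy p M (\<lambda>x. ennreal \<bar>?\<eta> x\<bar>) \<le> energy p M (\<lambda>x. indicator G x)"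
    proof (intro energy_mono p_pos)
      fix x show "ennreal \<bar>?\<eta> x\<bar> \<le> indicator G x"
        using \<eta>01[of x] zero[of x] by (cases "x \<in> G") auto
    qed
    then show "energy p M (\<lambda>x. ennreal \<bar>?\<eta> x\<bar>) < \<infinity>" using Gint by order
    fix l and \<gamma> :: "real \<Rightarrow> 'a" assume \<gamma>: "arc_length_curve UNIV l \<gamma>"
    then have l: "0 \<le> l" and cont: "continuous_on {0..l} \<gamma>" by (auto simp: arc_length_curve_def)
    let ?Z = "{0..l} \<inter> \<gamma> -` (- G)"
    have "closed ?Z" using cont G(1) by (intro continuous_closed_preimage) auto
    have "ennreal \<bar>?\<eta> (\<gamma> 0) - ?\<eta> (\<gamma> l)\<bar> \<le> seg_integral (\<lambda>t. ennreal m * indicator (- ?Z) t) 0 l"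
    proof (rule seg_integral_off_zeros[OF _ l _ \<open>closed ?Z\<close>])
      fix a b assume ab: "0 \<le> a" "a \<le> b" "b \<le> l"
      have "\<bar>?\<eta> (\<gamma> a) - ?\<eta> (\<gamma> b)\<bar> \<le> m * (b - a)"
        using lip[of "\<gamma> a" "\<gamma> b"] mult_left_mono[OF arc_length_curve_dist[OF \<gamma> ab], of m] m by linarith
      then show "ennreal \<bar>?\<eta> (\<gamma> a) - ?\<eta> (\<gamma> b)\<bar> \<le> seg_integral (\<lambda>t. ennreal m) a b"
        using ab m by (simp add: seg_integral_const ennreal_leI flip: ennreal_mult)
    qed (use zero in auto)
    also have "\<dots> = line_integral l \<gamma> ?g"
      unfolding line_integral_eq_seg by (intro seg_integral_cong) (auto simp: indicator_def)
    finally show "ennreal \<bar>?\<eta> (\<gamma> 0) - ?\<eta> (\<gamma> l)\<bar> \<le> line_integral l \<gamma> ?g" .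
  qed
qed

text \<open>
  A function on \<open>\<Omega>\<close> becomes a global one after multiplication with a cutoff function. On a curve that
  leaves \<open>\<Omega>\<close> nothing is known about \<open>u\<close> across the exit, but \<open>\<psi>\<close> vanishes at the exit point, so the
  product is controlled at both ends of the curve by \<open>\<psi>\<close> alone.
\<close>
lemma newt_times_local:
  assumes \<Omega>: "open \<Omega>" and \<psi>: "\<psi> \<in> newt" "\<And>x. 0 \<le> \<psi> x" "\<And>x. \<psi> x \<le> 1" "\<And>x. x \<notin> \<Omega> \<Longrightarrow> \<psi> x = 0"
    and u: "u \<in> newtonian p M \<Omega>" and n: "0 \<le> n"
  shows "(\<lambda>x. \<psi> x * trunc n (u x)) \<in> newt"
proof -
  have \<Omega>s [measurable]: "\<Omega> \<in> sets borel" "\<Omega> \<in> sets M" using \<Omega> by (auto simp: borel_sets_M)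
  let ?w = "\<lambda>x. \<psi> x * trunc n (u x)"
  have w0: "?w x = 0" if "x \<notin> \<Omega>" for x using \<psi>(4) that by simp
  have w_le: "\<bar>?w x\<bar> \<le> n * \<psi> x" for x
    using mult_left_mono[OF trunc_abs_le[OF n, of "u x"] \<psi>(2)[of x]] \<psi>(2)[of x] by (simp add: abs_mult mult.commute)
  obtain g\<psi> where g\<psi>: "\<psi> \<in> borel_measurable M" "g\<psi> \<in> borel_measurable borel" "energy p M g\<psi> < \<infinity>"
    "energy p M (\<lambda>x. ennreal \<bar>\<psi> x\<bar>) < \<infinity>"
    and seg: "\<And>l (\<gamma> :: real \<Rightarrow> 'a) a b. arc_length_curve UNIV l \<gamma> \<Longrightarrow> 0 \<le> a \<Longrightarrow> a \<le> b \<Longrightarrow> b \<le> l \<Longrightarrow>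
       ennreal \<bar>\<psi> (\<gamma> a) - \<psi> (\<gamma> b)\<bar> \<le> seg_integral (\<lambda>t. g\<psi> (\<gamma> t)) a b"
    using newtD[OF \<psi>(1)] by metis
  obtain g where g: "g \<in> borel_measurable borel" "upper_gradient \<Omega> u g"
    "energy p M g < \<infinity>" "(\<integral>\<^sup>+x\<in>\<Omega>. epowr (e2ennreal \<bar>u x\<bar>) p \<partial>M) < \<infinity>"
    "u \<in> borel_measurable (restrict_space M \<Omega>)"
    by (rule newtonianD[OF u \<Omega>s(1)]) (rule that)
  note [measurable] = g\<psi>(1,2) g(1)
  \<comment> \<open>one factor \<open>n\<close> for each end point of a curve that leaves \<open>\<Omega>\<close>\<close>
  let ?N = "ennreal (2 * n)"
  let ?h = "\<lambda>x. ?N * g\<psi> x + g x"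
  have Ng: "energy p M (\<lambda>x. ?N * g\<psi> x) < \<infinity>"
  proof (cases "n = 0")
    case False
    then have "0 < 2 * n" using n by simp
    from energy_cmult[OF this borel_measurable_M[OF g\<psi>(2)], of p] show ?thesis
      using g\<psi>(3) by (simp add: ennreal_mult_less_top)
  qed (simp add: energy_def)
  have N_split: "ennreal (n * a) + ennreal (n * b) \<le> ?N * s"
    if "ennreal a \<le> s" "ennreal b \<le> s" "0 \<le> a" "0 \<le> b" for a b s
  proof -
    have "ennreal (n * a) + ennreal (n * b) = ennreal n * ennreal a + ennreal n * ennreal b"
      using that n by (simp add: ennreal_mult)
    also have "\<dots> \<le> ennreal n * s + ennreal n * s" using that by (intro add_mono mult_left_mono) auto
    also have "\<dots> = (ennreal n + ennreal n) * s" by (simp only: distrib_right)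
    also have "ennreal n + ennreal n = ?N" using n by (subst ennreal_plus[symmetric]) auto
    finally show ?thesis .
  qed
  show ?thesis
  proof (rule newtI[of _ ?h])
    have "(\<lambda>x. trunc n (u x)) \<in> borel_measurable (restrict_space M \<Omega>)" using g(5) by measurable
    then have [measurable]: "(\<lambda>x. indicator \<Omega> x *\<^sub>R trunc n (u x)) \<in> borel_measurable M"
      by (subst (asm) borel_measurable_restrict_space_iff) auto
    have w_eq: "?w = (\<lambda>x. \<psi> x * (indicator \<Omega> x *\<^sub>R trunc n (u x)))"
    proof
      fix x show "?w x = \<psi> x * (indicator \<Omega> x *\<^sub>R trunc n (u x))" using \<psi>(4)[of x] by (cases "x \<in> \<Omega>") auto
    qed
    show "?w \<in> borel_measurable M" unfolding w_eq by measurable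
    show "?h \<in> borel_measurable borel" by measurable
    show "energy p M ?h < \<infinity>"
      using Ng g(3) by (intro energy_add_finite p_pos borel_measurable_M) auto
    have "energy p M (\<lambda>x. ennreal \<bar>?w x\<bar>) \<le> energy p M (\<lambda>x. ennreal (n + 1) * ennreal \<bar>\<psi> x\<bar>)"
    proof (intro energy_mono p_pos)
      fix x
      have "n * \<psi> x \<le> (n + 1) * \<bar>\<psi> x\<bar>" using n \<psi>(2)[of x] by (intro mult_mono) auto
      then have "ennreal \<bar>?w x\<bar> \<le> ennreal ((n + 1) * \<bar>\<psi> x\<bar>)" using w_le[of x] by (intro ennreal_leI) linarith
      also have "\<dots> = ennreal (n + 1) * ennreal \<bar>\<psi> x\<bar>" using n by (intro ennreal_mult) auto
      finally show "ennreal \<bar>?w x\<bar> \<le> ennreal (n + 1) * ennreal \<bar>\<psi> x\<bar>" .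
    qed
    also have "\<dots> = ennreal ((n + 1) powr p) * energy p M (\<lambda>x. ennreal \<bar>\<psi> x\<bar>)"
      using n by (intro energy_cmult) auto
    also have "\<dots> < \<infinity>" using g\<psi>(4) by (simp add: ennreal_mult_less_top)
    finally show "energy p M (\<lambda>x. ennreal \<bar>?w x\<bar>) < \<infinity>" .
    fix l and \<gamma> :: "real \<Rightarrow> 'a" assume \<gamma>: "arc_length_curve UNIV l \<gamma>"
    then have l: "0 \<le> l" by (simp add: arc_length_curve_def)
    let ?S = "line_integral l \<gamma> g\<psi>"
    have seg_le: "ennreal \<bar>\<psi> (\<gamma> a) - \<psi> (\<gamma> b)\<bar> \<le> ?S" if "0 \<le> a" "a \<le> b" "b \<le> l" for a b
      using seg[OF \<gamma> that] seg_integral_subset[of 0 a b l "\<lambda>t. g\<psi> (\<gamma> t)"] that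
      unfolding line_integral_eq_seg by auto
    have h_eq: "line_integral l \<gamma> ?h = ?N * ?S + line_integral l \<gamma> g"
      using line_integral_add[OF \<gamma>, of "\<lambda>x. ?N * g\<psi> x" g 0 l] line_integral_cmult[OF \<gamma>, of g\<psi> 0 l ?N]
      by (simp add: line_integral_eq_seg)
    show "ennreal \<bar>?w (\<gamma> 0) - ?w (\<gamma> l)\<bar> \<le> line_integral l \<gamma> ?h"
    proof (cases "\<gamma> ` {0..l} \<subseteq> \<Omega>")
      case True
      then have "arc_length_curve \<Omega> l \<gamma>" using \<gamma> by (auto simp: arc_length_curve_def)
      then have gu: "ext_diff (u (\<gamma> 0)) (u (\<gamma> l)) \<le> line_integral l \<gamma> g"
        using g(2) by (auto simp: upper_gradient_def)
      let ?a = "trunc n (u (\<gamma> 0))" and ?b = "trunc n (u (\<gamma> l))"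
      let ?d = "\<bar>\<psi> (\<gamma> 0) - \<psi> (\<gamma> l)\<bar>"
      have "\<bar>?w (\<gamma> 0) - ?w (\<gamma> l)\<bar> \<le> n * ?d + n * ?d + \<bar>?a - ?b\<bar>"
      proof -
        have "?w (\<gamma> 0) - ?w (\<gamma> l) = (\<psi> (\<gamma> 0) - \<psi> (\<gamma> l)) * ?a + \<psi> (\<gamma> l) * (?a - ?b)"
          by (simp add: algebra_simps)
        then have "\<bar>?w (\<gamma> 0) - ?w (\<gamma> l)\<bar> \<le> ?d * \<bar>?a\<bar> + \<psi> (\<gamma> l) * \<bar>?a - ?b\<bar>"
          using \<psi>(2)[of "\<gamma> l"] by (simp add: abs_mult order_trans[OF abs_triangle_ineq])
        also have "?d * \<bar>?a\<bar> \<le> ?d * n" using n by (intro mult_left_mono trunc_abs_le) auto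
        also have "\<psi> (\<gamma> l) * \<bar>?a - ?b\<bar> \<le> 1 * \<bar>?a - ?b\<bar>" using \<psi>(3) by (intro mult_right_mono) auto
        finally show ?thesis using n by (simp add: mult.commute) (smt (verit) mult_nonneg_nonneg abs_ge_zero)
      qed
      then have "ennreal \<bar>?w (\<gamma> 0) - ?w (\<gamma> l)\<bar> \<le> ennreal (n * ?d + n * ?d + \<bar>?a - ?b\<bar>)" by (rule ennreal_leI)
      also have "\<dots> = ennreal (n * ?d) + ennreal (n * ?d) + ennreal \<bar>?a - ?b\<bar>"
        by (simp only: ennreal_plus mult_nonneg_nonneg add_nonneg_nonneg abs_ge_zero n)
      also have "\<dots> \<le> ?N * ?S + line_integral l \<gamma> g"
        using seg_le[of 0 l] l order_trans[OF trunc_diff_le[OF n] gu]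
        by (intro add_mono N_split) auto
      finally show ?thesis unfolding h_eq .
    next
      case False
      then obtain s where "s \<in> {0..l}" and s\<Omega>: "\<gamma> s \<notin> \<Omega>" by blast
      then have s: "0 \<le> s" "s \<le> l" by auto
      have "ennreal \<bar>?w (\<gamma> 0) - ?w (\<gamma> l)\<bar> \<le> ennreal (n * \<psi> (\<gamma> 0) + n * \<psi> (\<gamma> l))"
        using w_le[of "\<gamma> 0"] w_le[of "\<gamma> l"] by (intro ennreal_leI) linarith
      also have "\<dots> = ennreal (n * \<psi> (\<gamma> 0)) + ennreal (n * \<psi> (\<gamma> l))"
        using n \<psi>(2) by (intro ennreal_plus) auto
      also have "\<dots> \<le> ?N * ?S"
        using seg_le[of 0 s] seg_le[of s l] s \<psi>(2) \<psi>(4)[OF s\<Omega>] by (intro N_split) auto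
      also have "\<dots> \<le> line_integral l \<gamma> ?h" unfolding h_eq by simp
      finally show ?thesis .
    qed
  qed
qed

text \<open>
  Let \<open>G\<^sub>j\<close> be open sets of small capacity with \<open>G\<^sub>j \<union> U\<close> open, \<open>w\<^sub>j\<close> a function of small norm that is \<open>1\<close>
  on \<open>G\<^sub>j\<close>, and \<open>\<eta>\<^sub>j\<^sub>m\<close> the distance cutoffs of \<open>G\<^sub>j \<union> U\<close>. Then \<open>max 0 (\<eta>\<^sub>j\<^sub>m - w\<^sub>j)\<close> vanishes off \<open>U\<close>: points
  outside \<open>G\<^sub>j \<union> U\<close> are killed by \<open>\<eta>\<^sub>j\<^sub>m\<close>, points of \<open>G\<^sub>j\<close> by \<open>w\<^sub>j\<close>. At a point of \<open>U\<close> where all these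
  functions vanish every \<open>w\<^sub>j\<close> is at least \<open>1\<close>, and such points form a polar set.
\<close>
lemma quasiopen_cutoffs:
  assumes \<Omega>: "open \<Omega>" "emeasure M \<Omega> < \<infinity>" "- \<Omega> \<noteq> {}" and U: "U \<subseteq> \<Omega>" "quasiopen p M U"
  obtains \<psi> :: "nat \<Rightarrow> nat \<Rightarrow> 'a \<Rightarrow> real" where
    "\<And>j m. \<psi> j m \<in> newt" "\<And>j m x. 0 \<le> \<psi> j m x" "\<And>j m x. \<psi> j m x \<le> 1"
    "\<And>j m x. x \<notin> U \<Longrightarrow> \<psi> j m x = 0" "polar {x \<in> U. \<forall>j m. \<psi> j m x = 0}"
proof -
  \<comment> \<open>the smallness required by \<open>polar_of_caps\<close>\<close>
  define e where "e j = (1/2) ^ Suc j / (2 ^ j) powr p" for j :: nat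
  have e_pos: "0 < e j" for j by (simp add: e_def)
  have "\<forall>j. \<exists>G. sobolev_cap p M G < ennreal (e j) \<and> open (G \<union> U)"
    using U(2)[unfolded quasiopen_def, rule_format, OF e_pos] by blast
  from choice[OF this] obtain G where
    capG: "\<And>j. sobolev_cap p M (G j) < ennreal (e j)" and G: "\<And>j. open (G j \<union> U)" by blast
  have "\<exists>w. w \<in> newtonian p M UNIV \<and> (\<forall>x\<in>G j. 1 \<le> w x) \<and> epowr (newton_norm p M UNIV w) p < ennreal (e j)" for j
    by (rule sobolev_cap_less[OF capG[of j]]) blast
  then have "\<forall>j. \<exists>w. w \<in> newtonian p M UNIV \<and> (\<forall>x\<in>G j. 1 \<le> w x) \<and>
      epowr (newton_norm p M UNIV w) p < ennreal (e j)" by (rule allI)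
  from choice[OF this] obtain w where w: "\<And>j. w j \<in> newtonian p M UNIV" "\<And>j x. x \<in> G j \<Longrightarrow> 1 \<le> w j x"
      "\<And>j. epowr (newton_norm p M UNIV (w j)) p < ennreal (e j)" by blast
  \<comment> \<open>intersecting with \<open>\<Omega>\<close> keeps the open sets of finite measure\<close>
  define O' where "O' j = (G j \<union> U) \<inter> \<Omega>" for j
  define w' where "w' j x = max 0 (trunc 1 (w j x))" for j x
  define \<eta> where "\<eta> j m x = min 1 (real (Suc m) * infdist x (- O' j))" for j m x
  have O': "open (O' j)" "- O' j \<noteq> {}" "emeasure M (O' j) < \<infinity>" "U \<subseteq> O' j" for j
  proof -
    show "open (O' j)" using G \<Omega>(1) by (auto simp: O'_def)
    show "- O' j \<noteq> {}" using \<Omega>(3) by (auto simp: O'_def)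
    have "emeasure M (O' j) \<le> emeasure M \<Omega>" using \<Omega>(1) by (intro emeasure_mono) (auto simp: O'_def)
    then show "emeasure M (O' j) < \<infinity>" using \<Omega>(2) by order
    show "U \<subseteq> O' j" using U(1) by (auto simp: O'_def)
  qed
  have \<eta>: "\<eta> j m \<in> newt" "0 \<le> \<eta> j m x" "\<eta> j m x \<le> 1" for j m x
    unfolding \<eta>_def[abs_def] using O' by (auto intro!: newt_cutoff simp: infdist_nonneg)
  have w': "w' j \<in> newt" "0 \<le> w' j x" "w' j x \<le> 1" for j x
  proof -
    show "w' j \<in> newt" unfolding w'_def[abs_def] using w(1) by (intro newt_pos_part newt_trunc) auto
    show "0 \<le> w' j x" "w' j x \<le> 1" using trunc_abs_le[of 1 "w j x"] by (auto simp: w'_def)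
  qed
  have w'1: "w' j x = 1 \<longleftrightarrow> 1 \<le> w j x" for j x
    by (cases "w j x") (auto simp: w'_def one_ereal_def)
  show thesis
  proof (rule that[of "\<lambda>j m x. max 0 (\<eta> j m x - w' j x)"])
    show "(\<lambda>x. max 0 (\<eta> j m x - w' j x)) \<in> newt" for j m by (intro newt_pos_part newt_diff \<eta> w')
    show "max 0 (\<eta> j m x - w' j x) \<le> 1" for j m x using \<eta>(3)[of j m x] w'(2)[of j x] by simp
    show "max 0 (\<eta> j m x - w' j x) = 0" if "x \<notin> U" for j m x
    proof (cases "x \<in> G j")
      case True
      then have "w' j x = 1" using w(2) w'1 by simp
      then show ?thesis using \<eta>(3)[of j m x] by simp
    next
      case False
      then have "x \<in> - O' j" using that by (auto simp: O'_def)
      then have "\<eta> j m x = 0" by (simp add: \<eta>_def)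
      then show ?thesis using w'(2)[of j x] by simp
    qed
    have "1 \<le> w j x" if x: "x \<in> U" "\<forall>j m. max 0 (\<eta> j m x - w' j x) = 0" for x j
    proof -
      have "0 < infdist x (- O' j)"
        using O'[of j] x(1) by (intro infdist_pos_not_in_closed) auto
      then obtain m where m: "1 / real (Suc m) < infdist x (- O' j)" using nat_approx_posE by metis
      then have "1 \<le> real (Suc m) * infdist x (- O' j)" by (simp add: field_simps)
      then have "\<eta> j m x = 1" by (simp add: \<eta>_def)
      moreover have "max 0 (\<eta> j m x - w' j x) = 0" using x(2) by blast
      ultimately have "w' j x = 1" using w'(3)[of j x] by simp
      then show ?thesis using w'1 by simp
    qed
    then show "polar {x \<in> U. \<forall>j m. max 0 (\<eta> j m x - w' j x) = 0}"
      by (intro polar_subset[OF polar_of_caps[OF w(1) w(3)[unfolded e_def]]]) auto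
  qed auto
qed

lemma quasiopen_open: "open U \<Longrightarrow> quasiopen p M U"
  unfolding quasiopen_def
proof (intro allI impI exI[of _ "{}"])
  fix e :: real assume "0 < e" "open U"
  then show "open {} \<and> sobolev_cap p M {} < ennreal e \<and> open ({} \<union> U)"
    using polar_iff[of "{}"] polar_empty by simp
qed

lemma newtonian_const:
  assumes "open \<Omega>" "emeasure M \<Omega> < \<infinity>"
  shows "(\<lambda>x. ereal c) \<in> newtonian p M \<Omega>"
proof -
  have [measurable]: "\<Omega> \<in> sets M" using assms(1) by measurable
  have "upper_gradient \<Omega> (\<lambda>x. ereal c) (\<lambda>x. 0)"
    by (auto simp: upper_gradient_def)
  then have "(INF g\<in>{g. upper_gradient \<Omega> (\<lambda>x. ereal c) g}. \<integral>\<^sup>+x\<in>\<Omega>. epowr (g x) p \<partial>M)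
      \<le> (\<integral>\<^sup>+x\<in>\<Omega>. epowr 0 p \<partial>M)"
    by (intro INF_lower2[of "\<lambda>x. 0"]) auto
  then have "(INF g\<in>{g. upper_gradient \<Omega> (\<lambda>x. ereal c) g}. \<integral>\<^sup>+x\<in>\<Omega>. epowr (g x) p \<partial>M) = 0" by simp
  moreover have "(\<integral>\<^sup>+x\<in>\<Omega>. epowr (e2ennreal \<bar>ereal c\<bar>) p \<partial>M) < \<infinity>"
    using assms(2) by (simp add: e2ennreal_ereal nn_integral_cmult_indicator ennreal_mult_less_top)
  ultimately show ?thesis by (simp add: newtonian_def newton_norm_def)
qed

end


section \<open>The capacitary measure\<close>

lemma ext_integral_cong_AE:
  assumes "AE x in N. x \<in> A \<longrightarrow> u x = v x"
  shows "ext_integral N A u = ext_integral N A v"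
proof -
  have "(\<integral>\<^sup>+x\<in>A. e2ennreal (u x) \<partial>N) = (\<integral>\<^sup>+x\<in>A. e2ennreal (v x) \<partial>N)"
    using assms by (intro nn_integral_cong_AE) (auto simp: indicator_def elim: eventually_mono)
  moreover have "(\<integral>\<^sup>+x\<in>A. e2ennreal (- u x) \<partial>N) = (\<integral>\<^sup>+x\<in>A. e2ennreal (- v x) \<partial>N)"
    using assms by (intro nn_integral_cong_AE) (auto simp: indicator_def elim: eventually_mono)
  ultimately show ?thesis by (simp add: ext_integral_def)
qed

lemma ext_integral_exists_cong_AE:
  assumes "AE x in N. x \<in> A \<longrightarrow> u x = v x" "v \<in> borel_measurable N" "ext_integral_exists N A u"
  shows "ext_integral_exists N A v"
proof -
  have "(\<integral>\<^sup>+x\<in>A. e2ennreal (u x) \<partial>N) = (\<integral>\<^sup>+x\<in>A. e2ennreal (v x) \<partial>N)"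
    using assms by (intro nn_integral_cong_AE) (auto simp: indicator_def elim: eventually_mono)
  moreover have "(\<integral>\<^sup>+x\<in>A. e2ennreal (- u x) \<partial>N) = (\<integral>\<^sup>+x\<in>A. e2ennreal (- v x) \<partial>N)"
    using assms by (intro nn_integral_cong_AE) (auto simp: indicator_def elim: eventually_mono)
  ultimately show ?thesis
    using assms(2,3) by (auto simp: ext_integral_exists_def intro: measurable_restrict_space1)
qed

locale capacitary_setting = cheeger_space +
  fixes \<Omega> E :: "'a set" and u_E :: "'a \<Rightarrow> ereal" and \<nu> :: "'a measure"
  assumes open_\<Omega>: "open \<Omega>" and bounded_\<Omega>: "bounded \<Omega>" and cap_compl: "0 < sobolev_cap p M (- \<Omega>)"
    and E_subset: "E \<subseteq> \<Omega>" and potential: "capacitary_potential p M ip D \<Omega> E u_E"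
    and measure_T: "is_T_measure p M ip D \<Omega> u_E \<nu>"
begin

lemma \<Omega>_sets [measurable]: "\<Omega> \<in> sets M" using open_\<Omega> by measurable

lemma compl_\<Omega>: "- \<Omega> \<noteq> {}"
  using cap_compl polar_iff[of "{}"] polar_empty by auto

lemma M_\<Omega>: "emeasure M \<Omega> < \<infinity>"
proof -
  obtain x0 R where R: "\<Omega> \<subseteq> cball x0 R" using bounded_\<Omega> by (auto simp: bounded_subset_cball)
  have "\<Omega> \<subseteq> ball x0 (\<bar>R\<bar> + 1)"
  proof
    fix x assume "x \<in> \<Omega>"
    then show "x \<in> ball x0 (\<bar>R\<bar> + 1)" using R by force
  qed
  then have "emeasure M \<Omega> \<le> emeasure M (ball x0 (\<bar>R\<bar> + 1))" by (intro emeasure_mono) auto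
  also have "\<dots> < \<infinity>" using balls[of "\<bar>R\<bar> + 1" x0] by simp
  finally show ?thesis .
qed

lemma \<nu>_dual: "\<phi> \<in> newtonian0 p M \<Omega> \<Longrightarrow> ext_integrable \<nu> \<Omega> \<phi>"
  "\<exists>C. \<forall>\<phi>\<in>newtonian0 p M \<Omega>. e2ennreal \<bar>ext_integral \<nu> \<Omega> \<phi>\<bar> \<le> ennreal C * newton_norm p M UNIV \<phi>"
  "\<phi> \<in> newtonian0 p M \<Omega> \<Longrightarrow>
     ereal (LINT x:\<Omega>|M. ip_norm (ip x) (D u_E x) powr (p - 2) * ip x (D u_E x) (D \<phi> x)) = ext_integral \<nu> \<Omega> \<phi>"
  using measure_T unfolding is_T_measure_def in_dual_newtonian0_def by blast+

lemma \<nu>_completion: obtains N where "sets N = sets (restrict_space borel \<Omega>)" "\<nu> = completion N"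
  using measure_T by (auto simp: is_T_measure_def radon_measure_def complete_borel_measure_def)

lemma space_\<nu>: "space \<nu> = \<Omega>"
proof (rule \<nu>_completion)
  fix N assume "sets N = sets (restrict_space borel \<Omega>)" "\<nu> = completion N"
  then show ?thesis using sets_eq_imp_space_eq[of N "restrict_space borel \<Omega>"]
    by (simp add: space_restrict_space)
qed

lemma complete_\<nu>: "complete_measure \<nu>"
  by (rule \<nu>_completion) (simp add: completion.complete_measure_axioms)

lemma measurable_restrict_\<nu>: "measurable (restrict_space \<nu> \<Omega>) N = measurable \<nu> N"
proof (rule measurable_cong_sets)
  show "sets (restrict_space \<nu> \<Omega>) = sets \<nu>"
    using sets.sets_into_space[of _ \<nu>] unfolding sets_restrict_space space_\<nu>
    by (auto simp: image_iff Int_absorb1 intro!: bexI)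
qed simp

lemma nn_integral_\<nu>: "(\<integral>\<^sup>+x\<in>\<Omega>. f x \<partial>\<nu>) = (\<integral>\<^sup>+x. f x \<partial>\<nu>)"
  by (intro nn_integral_cong) (auto simp: space_\<nu>)

lemma \<nu>_measurable: "\<phi> \<in> newtonian0 p M \<Omega> \<Longrightarrow> \<phi> \<in> borel_measurable \<nu>"
  using \<nu>_dual(1) by (auto simp: ext_integrable_def measurable_restrict_\<nu>)

lemma newtonian0_I: "f \<in> newt \<Longrightarrow> (\<And>x. x \<notin> \<Omega> \<Longrightarrow> f x = 0) \<Longrightarrow> er f \<in> newtonian0 p M \<Omega>"
  by (auto simp: newtonian0_def newt_iff)

text \<open>
  The indicator of a polar set has Newtonian norm zero, so the bounded functional \<open>\<nu>\<close> annihilates it.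
\<close>
lemma polar_\<nu>_null:
  assumes "polar A"
  shows "AE x in \<nu>. x \<notin> A"
proof -
  let ?\<chi> = "\<lambda>x. indicator (A \<inter> \<Omega>) x :: ereal"
  have pol: "polar (A \<inter> \<Omega>)" using assms by (rule polar_subset) auto
  have mem: "?\<chi> \<in> newtonian0 p M \<Omega>"
    using indicator_polar_norm(1)[OF pol] by (auto simp: newtonian0_def)
  have [measurable]: "?\<chi> \<in> borel_measurable \<nu>" by (rule \<nu>_measurable[OF mem])
  have "e2ennreal \<bar>ext_integral \<nu> \<Omega> ?\<chi>\<bar> \<le> 0"
    using \<nu>_dual(2) mem indicator_polar_norm(2)[OF pol] by auto
  moreover have "ext_integral \<nu> \<Omega> ?\<chi> = enn2ereal (\<integral>\<^sup>+x. e2ennreal (?\<chi> x) \<partial>\<nu>)"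
  proof -
    have "e2ennreal (- ?\<chi> x) = 0" for x by (simp add: indicator_def e2ennreal_neg)
    then show ?thesis by (simp add: ext_integral_def nn_integral_\<nu> zero_ennreal.rep_eq)
  qed
  ultimately have "(\<integral>\<^sup>+x. e2ennreal (?\<chi> x) \<partial>\<nu>) = 0" by simp
  then have "AE x in \<nu>. e2ennreal (?\<chi> x) = 0" by (subst (asm) nn_integral_0_iff_AE) auto
  then show ?thesis using AE_space
    by eventually_elim (auto simp: space_\<nu> indicator_def split: if_splits)
qed

text \<open>
  A real-valued nonnegative version of \<open>u\<^sub>E\<close>; the two functions differ only on a polar set, so they
  have the same gradient and the same \<open>\<nu>\<close>-integrals.
\<close>
definition w_E :: "'a \<Rightarrow> real" where
  "w_E x = max 0 (real_of_ereal (u_E x))"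

lemma u_E_newtonian: "u_E \<in> newtonian p M UNIV" and u_E_zero: "x \<notin> \<Omega> \<Longrightarrow> u_E x = 0"
  and u_E_qe: "holds_qe p M \<Omega> (\<lambda>x. indicator E x \<le> u_E x)"
  using potential by (auto simp: capacitary_potential_def obstacle_class_def newtonian0_def)

lemma w_E_newt: "w_E \<in> newt"
  unfolding w_E_def[abs_def] by (intro newt_pos_part newt_real_part u_E_newtonian)

lemma w_E_zero: "x \<notin> \<Omega> \<Longrightarrow> w_E x = 0"
  by (simp add: w_E_def u_E_zero)

lemma w_E_nonneg: "0 \<le> w_E x" by (simp add: w_E_def)

lemma polar_w_E: "polar {x. u_E x \<noteq> ereal (w_E x)}"
proof -
  have pol: "polar ({x. \<bar>u_E x\<bar> = \<infinity>} \<union> {x \<in> \<Omega>. \<not> indicator E x \<le> u_E x})"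
    using u_E_qe by (intro polar_Un polar_infinite u_E_newtonian) (simp add: holds_qe_def polar_iff)
  show ?thesis
  proof (rule polar_subset[OF pol], intro subsetI, rule ccontr)
    fix x assume "x \<in> {x. u_E x \<noteq> ereal (w_E x)}"
      "x \<notin> {x. \<bar>u_E x\<bar> = \<infinity>} \<union> {x \<in> \<Omega>. \<not> indicator E x \<le> u_E x}"
    then have x: "u_E x \<noteq> ereal (w_E x)" "x \<notin> \<Omega> \<or> indicator E x \<le> u_E x" "\<bar>u_E x\<bar> \<noteq> \<infinity>"
      by auto
    have "0 \<le> u_E x"
    proof (cases "x \<in> \<Omega>")
      case True
      have "(0::ereal) \<le> indicator E x" by (simp add: indicator_def)
      then show ?thesis using x(2) True by (meson order_trans)
    qed (simp add: u_E_zero)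
    then show False using x(1,3) by (cases "u_E x") (auto simp: w_E_def)
  qed
qed

lemma polar_w_E_obstacle: "polar {x \<in> E. w_E x < 1}"
proof -
  have pol: "polar ({x. u_E x \<noteq> ereal (w_E x)} \<union> {x \<in> \<Omega>. \<not> indicator E x \<le> u_E x})"
    using u_E_qe by (intro polar_Un polar_w_E) (simp add: holds_qe_def polar_iff)
  show ?thesis
  proof (rule polar_subset[OF pol], intro subsetI, rule ccontr)
    fix x assume "x \<in> {x \<in> E. w_E x < 1}"
      "x \<notin> {x. u_E x \<noteq> ereal (w_E x)} \<union> {x \<in> \<Omega>. \<not> indicator E x \<le> u_E x}"
    then show False using E_subset by (auto simp: one_ereal_def)
  qed
qed

lemma AE_w_E: "AE x in M. u_E x = er w_E x"
proof -
  have "{x. u_E x \<noteq> ereal (w_E x)} \<in> null_sets M" using polar_w_E by (simp add: polar_def)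
  then show ?thesis by (simp add: AE_iff_null_sets)
qed

lemma w_E_minimal:
  assumes w: "w \<in> newt" "\<And>x. x \<notin> \<Omega> \<Longrightarrow> w x = 0" "\<And>x. 0 \<le> w x" "polar {x \<in> E. w x < 1}"
  shows "(\<integral>\<^sup>+x\<in>\<Omega>. ennreal (Dnorm (er w_E) x powr p) \<partial>M) \<le> (\<integral>\<^sup>+x\<in>\<Omega>. ennreal (Dnorm (er w) x powr p) \<partial>M)"
proof -
  have "polar {x \<in> \<Omega>. \<not> indicator E x \<le> er w x}"
    using w(4) by (rule polar_subset) (use w(3) in \<open>auto simp: indicator_def one_ereal_def split: if_splits\<close>)
  then have "er w \<in> obstacle_class p M \<Omega> E"
    using newtonian0_I[OF w(1,2)] by (simp add: obstacle_class_def holds_qe_def polar_iff)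
  then have "(\<integral>\<^sup>+x\<in>\<Omega>. ennreal (Dnorm u_E x powr p) \<partial>M) \<le> (\<integral>\<^sup>+x\<in>\<Omega>. ennreal (Dnorm (er w) x powr p) \<partial>M)"
    using potential unfolding capacitary_potential_def Dnorm_def by blast
  also have "(\<integral>\<^sup>+x\<in>\<Omega>. ennreal (Dnorm u_E x powr p) \<partial>M) = (\<integral>\<^sup>+x\<in>\<Omega>. ennreal (Dnorm (er w_E) x powr p) \<partial>M)"
    using D_AE_cong[OF u_E_newtonian w_E_newt AE_w_E]
    by (intro nn_integral_cong_AE) (auto elim: eventually_mono)
  finally show ?thesis .
qed

lemma \<nu>_integral_eq_flux:
  assumes f: "f \<in> newt" "\<And>x. x \<notin> \<Omega> \<Longrightarrow> f x = 0"
  shows "ext_integral \<nu> \<Omega> (er f) = ereal (LINT x:\<Omega>|M. flux (er w_E) (er f) x)"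
proof -
  have ms: "Dnorm u_E \<in> borel_measurable M" "Dprod u_E (er f) \<in> borel_measurable M"
    "Dnorm (er w_E) \<in> borel_measurable M" "Dprod (er w_E) (er f) \<in> borel_measurable M"
    using u_E_newtonian w_E_newt f(1) by (auto simp: newt_iff intro!: Dnorm_measurable Dprod_measurable)
  note [measurable] = ms
  have "(LINT x:\<Omega>|M. flux u_E (er f) x) = (LINT x:\<Omega>|M. flux (er w_E) (er f) x)"
    unfolding set_lebesgue_integral_def
  proof (rule integral_cong_AE)
    show "(\<lambda>x. indicator \<Omega> x *\<^sub>R flux u_E (er f) x) \<in> borel_measurable M" unfolding flux_def by measurable
    show "(\<lambda>x. indicator \<Omega> x *\<^sub>R flux (er w_E) (er f) x) \<in> borel_measurable M" unfolding flux_def by measurable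
    show "AE x in M. indicator \<Omega> x *\<^sub>R flux u_E (er f) x = indicator \<Omega> x *\<^sub>R flux (er w_E) (er f) x"
      using D_AE_cong[OF u_E_newtonian w_E_newt AE_w_E] by eventually_elim (simp add: flux_def)
  qed
  moreover have "ereal (LINT x:\<Omega>|M. flux u_E (er f) x) = ext_integral \<nu> \<Omega> (er f)"
    using \<nu>_dual(3)[OF newtonian0_I[OF f]] unfolding flux_def Dnorm_def Dprod_def .
  ultimately show ?thesis by simp
qed

text \<open>
  If moving from \<open>u\<^sub>E\<close> in direction \<open>- f\<close> does not decrease the energy to first order, then
  \<open>\<integral> f d\<nu> \<le> 0\<close>, which forces \<open>f = 0\<close> \<open>\<nu>\<close>-almost everywhere.
\<close>
lemma \<nu>_null_of_flux:
  assumes f: "f \<in> newt" "\<And>x. x \<notin> \<Omega> \<Longrightarrow> f x = 0" "\<And>x. 0 \<le> f x"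
    and flux: "0 \<le> (LINT x:\<Omega>|M. flux (er w_E) (er (\<lambda>x. - f x)) x)"
  shows "AE x in \<nu>. f x = 0"
proof -
  have g: "(\<lambda>x. - f x) \<in> newt" "\<And>x. x \<notin> \<Omega> \<Longrightarrow> - f x = 0" using newt_scale[OF f(1), of "-1"] f(2) by auto
  have "er f \<in> borel_measurable \<nu>" by (intro \<nu>_measurable newtonian0_I f)
  then have [measurable]: "f \<in> borel_measurable \<nu>" by (simp add: borel_measurable_ereal_iff)
  have "ext_integral \<nu> \<Omega> (er (\<lambda>x. - f x)) = ereal (LINT x:\<Omega>|M. flux (er w_E) (er (\<lambda>x. - f x)) x)"
    by (rule \<nu>_integral_eq_flux[OF g])
  then have "0 \<le> ext_integral \<nu> \<Omega> (er (\<lambda>x. - f x))" using flux by simp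
  also have "ext_integral \<nu> \<Omega> (er (\<lambda>x. - f x)) = - enn2ereal (\<integral>\<^sup>+x. ennreal (f x) \<partial>\<nu>)"
    using f(3) by (simp add: ext_integral_def nn_integral_\<nu> e2ennreal_ereal ennreal_neg zero_ennreal.rep_eq)
  finally have "(\<integral>\<^sup>+x. ennreal (f x) \<partial>\<nu>) = 0"
    by (simp add: less_eq_ennreal.rep_eq zero_ennreal.rep_eq flip: le_zero_eq)
  then have "AE x in \<nu>. ennreal (f x) = 0" by (subst (asm) nn_integral_0_iff_AE) auto
  then show ?thesis by eventually_elim (use f(3) in \<open>simp add: antisym\<close>)
qed

text \<open>
  The measure \<open>\<nu>\<close> lives on \<open>E\<close> in the following sense. The competitor is the positive part of
  \<open>u\<^sub>E - t f\<close>: subtracting \<open>t f\<close> does no harm on \<open>E\<close>, and the positive part restores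
  nonnegativity off \<open>E\<close>.
\<close>
lemma \<nu>_null_off_E:
  assumes f: "f \<in> newt" "\<And>x. x \<notin> \<Omega> \<Longrightarrow> f x = 0" "\<And>x. 0 \<le> f x" and E: "polar {x \<in> E. f x \<noteq> 0}"
  shows "AE x in \<nu>. f x = 0"
proof (rule \<nu>_null_of_flux[OF f])
  have g: "(\<lambda>x. - f x) \<in> newt" using newt_scale[OF f(1), of "-1"] by simp
  show "0 \<le> (LINT x:\<Omega>|M. flux (er w_E) (er (\<lambda>x. - f x)) x)"
  proof (rule variation_inequality[OF w_E_newt g \<Omega>_sets])
    fix t :: real assume t: "0 < t" "t \<le> 1"
    define v where "v x = w_E x + t * - f x" for x
    have v: "v \<in> newt" unfolding v_def[abs_def] by (intro newt_add newt_scale w_E_newt g)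
    have "(\<integral>\<^sup>+x\<in>\<Omega>. ennreal (Dnorm (er w_E) x powr p) \<partial>M)
        \<le> (\<integral>\<^sup>+x\<in>\<Omega>. ennreal (Dnorm (er (\<lambda>x. max 0 (v x))) x powr p) \<partial>M)"
    proof (rule w_E_minimal)
      show "(\<lambda>x. max 0 (v x)) \<in> newt" by (rule newt_pos_part[OF v])
      show "max 0 (v x) = 0" if "x \<notin> \<Omega>" for x using w_E_zero[OF that] f(2)[OF that] by (simp add: v_def)
      show "polar {x \<in> E. max 0 (v x) < 1}"
        by (rule polar_subset[OF polar_Un[OF polar_w_E_obstacle E]]) (auto simp: v_def)
    qed simp
    also have "\<dots> \<le> (\<integral>\<^sup>+x\<in>\<Omega>. ennreal (Dnorm (er v) x powr p) \<partial>M)"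
    proof (rule nn_integral_mono_AE)
      show "AE x in M. ennreal (Dnorm (er (\<lambda>x. max 0 (v x))) x powr p) * indicator \<Omega> x
          \<le> ennreal (Dnorm (er v) x powr p) * indicator \<Omega> x"
        using Dnorm_pos_part_le[OF v] Dnorm_nonneg_AE[of "er (\<lambda>x. max 0 (v x))"]
        by eventually_elim (auto intro!: mult_right_mono ennreal_leI powr_mono2 simp: p_pos less_imp_le)
    qed
    finally show "(\<integral>\<^sup>+x\<in>\<Omega>. ennreal (Dnorm (er w_E) x powr p) \<partial>M)
        \<le> (\<integral>\<^sup>+x\<in>\<Omega>. ennreal (Dnorm (er (\<lambda>x. w_E x + t * - f x)) x powr p) \<partial>M)"
      by (simp add: v_def)
  qed
qed

text \<open>
  The competitor \<open>u\<^sub>E - t max 0 (u\<^sub>E - 1)\<close> with \<open>t \<le> 1\<close> stays above \<open>min 1 u\<^sub>E\<close>, hence is admissible.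
\<close>
lemma w_E_le_1: "AE x in \<nu>. w_E x \<le> 1"
proof -
  let ?f = "\<lambda>x. max 0 (w_E x - 1)"
  have f: "?f \<in> newt"
    by (rule newt_lipschitz_image[OF w_E_newt, of "\<lambda>s. max 0 (s - 1)" 1]) auto
  have g: "(\<lambda>x. - ?f x) \<in> newt" using newt_scale[OF f, of "-1"] by simp
  have "AE x in \<nu>. ?f x = 0"
  proof (rule \<nu>_null_of_flux[OF f])
    show "0 \<le> (LINT x:\<Omega>|M. flux (er w_E) (er (\<lambda>x. - ?f x)) x)"
    proof (rule variation_inequality[OF w_E_newt g \<Omega>_sets])
      fix t :: real assume t: "0 < t" "t \<le> 1"
      let ?v = "\<lambda>x. w_E x + t * - ?f x"
      have ge: "min 1 (w_E x) \<le> ?v x" for x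
      proof (cases "w_E x \<le> 1")
        case False
        then have "t * (w_E x - 1) \<le> 1 * (w_E x - 1)" using t by (intro mult_right_mono) auto
        also have "1 * (w_E x - 1) = w_E x - 1" by simp
        finally have "t * (w_E x - 1) \<le> w_E x - 1" .
        moreover have "?v x = w_E x - t * (w_E x - 1)" using False by (simp add: algebra_simps)
        ultimately have "1 \<le> ?v x" by linarith
        then show ?thesis by linarith
      qed simp
      show "(\<integral>\<^sup>+x\<in>\<Omega>. ennreal (Dnorm (er w_E) x powr p) \<partial>M)
          \<le> (\<integral>\<^sup>+x\<in>\<Omega>. ennreal (Dnorm (er ?v) x powr p) \<partial>M)"
      proof (rule w_E_minimal)
        show "?v \<in> newt" by (intro newt_add newt_scale w_E_newt g)
        show "?v x = 0" if "x \<notin> \<Omega>" for x using w_E_zero[OF that] by simp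
        show "0 \<le> ?v x" for x using ge[of x] w_E_nonneg[of x] by linarith
        show "polar {x \<in> E. ?v x < 1}"
        proof (rule polar_subset[OF polar_w_E_obstacle], safe)
          fix x assume "?v x < 1"
          then show "w_E x < 1" using ge[of x] by linarith
        qed
      qed
    qed
  qed (auto simp: w_E_zero)
  then show ?thesis by eventually_elim simp
qed

lemma \<Omega>_cutoff_tendsto:
  assumes "x \<in> \<Omega>"
  shows "eventually (\<lambda>m. min 1 (real (Suc m) * infdist x (- \<Omega>)) = 1) sequentially"
proof -
  have "0 < infdist x (- \<Omega>)"
    using open_\<Omega> compl_\<Omega> assms by (intro infdist_pos_not_in_closed) auto
  then obtain m where m: "1 / real (Suc m) < infdist x (- \<Omega>)" using nat_approx_posE by metis
  show ?thesis
  proof (rule eventually_sequentiallyI)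
    fix k assume "m \<le> k"
    have "1 < infdist x (- \<Omega>) * real (Suc m)" using m by (simp add: field_simps)
    also have "\<dots> \<le> infdist x (- \<Omega>) * real (Suc k)" using \<open>m \<le> k\<close> by (intro mult_left_mono) (auto simp: infdist_nonneg)
    finally show "min 1 (real (Suc k) * infdist x (- \<Omega>)) = 1" by (simp add: mult.commute)
  qed
qed

text \<open>
  A function of \<open>N(\<Omega>)\<close> is measurable for the completion of \<open>\<mu>\<close>, which says nothing about \<open>\<nu>\<close>. But
  functions of \<open>N\<^sub>0(\<Omega>)\<close> are \<open>\<nu>\<close>-integrable because \<open>\<nu>\<close> belongs to the dual space, and \<open>u\<close> is a pointwise
  limit of such functions.
\<close>
lemma newtonian_\<nu>_measurable:
  assumes u: "u \<in> newtonian p M \<Omega>"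
  shows "u \<in> borel_measurable \<nu>"
proof -
  have tr: "(\<lambda>x. trunc (real n) (u x)) \<in> borel_measurable \<nu>" for n
  proof (rule borel_measurable_LIMSEQ_real)
    let ?\<eta> = "\<lambda>m x. min 1 (real (Suc m) * infdist x (- \<Omega>))"
    let ?w = "\<lambda>m x. ?\<eta> m x * trunc (real n) (u x)"
    have z: "?\<eta> m x = 0" if "x \<notin> \<Omega>" for m x using that by simp
    have "?w m \<in> newt" for m
      by (rule newt_times_local[OF open_\<Omega> newt_cutoff[OF open_\<Omega> M_\<Omega> compl_\<Omega>] _ _ z u]) (simp_all add: infdist_nonneg)
    then have "er (?w m) \<in> borel_measurable \<nu>" for m
      using z by (intro \<nu>_measurable newtonian0_I) auto
    then show "?w m \<in> borel_measurable \<nu>" for m by (simp add: borel_measurable_ereal_iff)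
    fix x assume "x \<in> space \<nu>"
    then have "eventually (\<lambda>m. ?\<eta> m x = 1) sequentially" by (simp add: space_\<nu> \<Omega>_cutoff_tendsto del: of_nat_Suc)
    then have "eventually (\<lambda>m. ?w m x = trunc (real n) (u x)) sequentially" by eventually_elim simp
    then show "(\<lambda>m. ?w m x) \<longlonglongrightarrow> trunc (real n) (u x)" by (rule tendsto_eventually)
  qed
  show ?thesis
    by (rule borel_measurable_LIMSEQ_order[of \<nu> "\<lambda>n x. ereal (trunc (real n) (u x))"])
       (use trunc_tendsto tr in auto)
qed

text \<open>
  The heart of the theorem. Since \<open>\<psi> |u\<^sub>n - v\<^sub>n|\<close> vanishes off \<open>U\<close> and q.e. on \<open>U \<inter> E\<close>, it vanishes q.e.
  on \<open>E\<close>, hence \<open>\<nu>\<close>-almost everywhere; now vary \<open>\<psi>\<close> and \<open>n\<close>.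
\<close>
lemma agree_\<nu>:
  assumes U: "U \<subseteq> \<Omega>" "quasiopen p M U" and uv: "u \<in> newtonian p M \<Omega>" "v \<in> newtonian p M \<Omega>"
    and qe: "holds_qe p M (U \<inter> E) (\<lambda>x. u x = v x)"
  shows "AE x in \<nu>. x \<in> U \<longrightarrow> u x = v x" "U \<in> sets \<nu>"
proof -
  obtain \<psi> :: "nat \<Rightarrow> nat \<Rightarrow> 'a \<Rightarrow> real" where
    \<psi>: "\<And>j m. \<psi> j m \<in> newt" "\<And>j m x. 0 \<le> \<psi> j m x" "\<And>j m x. \<psi> j m x \<le> 1"
    "\<And>j m x. x \<notin> U \<Longrightarrow> \<psi> j m x = 0" "polar {x \<in> U. \<forall>j m. \<psi> j m x = 0}"
    by (rule quasiopen_cutoffs[OF open_\<Omega> M_\<Omega> compl_\<Omega> U]) (rule that)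
  have \<psi>\<Omega>: "\<psi> j m x = 0" if "x \<notin> \<Omega>" for j m x using \<psi>(4) U(1) that by blast
  let ?f = "\<lambda>j m n x. \<bar>\<psi> j m x * trunc (real n) (u x) - \<psi> j m x * trunc (real n) (v x)\<bar>"
  have "AE x in \<nu>. ?f j m n x = 0" for j m n
  proof (rule \<nu>_null_off_E)
    show "?f j m n \<in> newt"
      by (intro newt_abs newt_diff newt_times_local[OF open_\<Omega> \<psi>(1-3) \<psi>\<Omega>] uv) auto
    have "polar {x \<in> U \<inter> E. u x \<noteq> v x}" using qe by (simp add: holds_qe_def polar_iff)
    then show "polar {x \<in> E. ?f j m n x \<noteq> 0}"
    proof (rule polar_subset, safe)
      fix x assume "?f j m n x \<noteq> 0"
      then show "x \<in> U" using \<psi>(4) by (cases "x \<in> U") auto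
    next
      fix x assume "?f j m n x \<noteq> 0" "u x = v x"
      then show False by simp
    qed
  qed (use \<psi>\<Omega> in auto)
  then have "AE x in \<nu>. \<forall>j m n. ?f j m n x = 0" by (simp only: AE_all_countable) auto
  then show "AE x in \<nu>. x \<in> U \<longrightarrow> u x = v x"
    using polar_\<nu>_null[OF \<psi>(5)]
  proof eventually_elim
    case (elim x)
    show ?case
    proof
      assume "x \<in> U"
      then obtain j m where jm: "\<psi> j m x \<noteq> 0" using elim(2) by blast
      have "trunc (real n) (u x) = trunc (real n) (v x)" for n
        using elim(1)[rule_format, of j m n] jm by (simp flip: right_diff_distrib)
      then show "u x = v x" by (rule trunc_eq_imp_eq)
    qed
  qed
  have "er (\<psi> j m) \<in> borel_measurable \<nu>" for j m
    by (intro \<nu>_measurable newtonian0_I \<psi>(1) \<psi>\<Omega>)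
  then have [measurable]: "\<psi> j m \<in> borel_measurable \<nu>" for j m by (simp add: borel_measurable_ereal_iff)
  interpret nu: complete_measure \<nu> by (rule complete_\<nu>)
  have "{x \<in> space \<nu>. \<exists>j m. \<psi> j m x \<noteq> 0} \<in> sets \<nu>" by measurable
  then show "U \<in> sets \<nu>"
  proof (rule nu.in_sets_AE[rotated])
    show "AE x in \<nu>. (x \<in> {x \<in> space \<nu>. \<exists>j m. \<psi> j m x \<noteq> 0}) = (x \<in> U)"
      using polar_\<nu>_null[OF \<psi>(5)] AE_space
    proof eventually_elim
      case (elim x)
      then show ?case using \<psi>(4)[of x] by auto
    qed
    show "U \<subseteq> space \<nu>" using U(1) by (simp add: space_\<nu>)
  qed
qed

text \<open>
  The function \<open>min u\<^sub>E 1\<close> agrees with \<open>1\<close> q.e. on \<open>E\<close>.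
\<close>
lemma u_E_eq_1: "AE x in \<nu>. u_E x = 1"
proof -
  have m: "(\<lambda>x. min (w_E x) 1) \<in> newt"
    by (rule newt_lipschitz_image[OF w_E_newt, of "\<lambda>s. min s 1" 1]) auto
  have m\<Omega>: "er (\<lambda>x. min (w_E x) 1) \<in> newtonian p M \<Omega>"
    by (rule newtonian_restrict[OF m[unfolded newt_iff] borel_open[OF open_\<Omega>]])
  have "polar {x \<in> \<Omega> \<inter> E. ereal (min (w_E x) 1) \<noteq> ereal 1}"
    by (rule polar_subset[OF polar_w_E_obstacle]) (auto simp: min_def split: if_splits)
  then have "AE x in \<nu>. x \<in> \<Omega> \<longrightarrow> ereal (min (w_E x) 1) = ereal 1"
    by (intro agree_\<nu>(1)[OF subset_refl quasiopen_open[OF open_\<Omega>] m\<Omega> newtonian_const[OF open_\<Omega> M_\<Omega>]])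
       (simp only: holds_qe_def polar_iff)
  then show ?thesis using AE_space w_E_le_1 polar_\<nu>_null[OF polar_w_E]
    by eventually_elim (auto simp: space_\<nu> one_ereal_def)
qed

text \<open>
  As \<open>u\<^sub>E = 1\<close> \<open>\<nu>\<close>-almost everywhere, the total mass is the integral of \<open>u\<^sub>E\<close>.
\<close>
lemma \<nu>_finite: "emeasure \<nu> \<Omega> < \<infinity>"
proof -
  have "(\<integral>\<^sup>+x\<in>\<Omega>. e2ennreal \<bar>u_E x\<bar> \<partial>\<nu>) < \<infinity>"
    using \<nu>_dual(1)[of u_E] u_E_newtonian u_E_zero by (auto simp: newtonian0_def ext_integrable_def)
  also have "(\<integral>\<^sup>+x\<in>\<Omega>. e2ennreal \<bar>u_E x\<bar> \<partial>\<nu>) = (\<integral>\<^sup>+x. 1 \<partial>\<nu>)"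
    unfolding nn_integral_\<nu>
  proof (rule nn_integral_cong_AE)
    show "AE x in \<nu>. e2ennreal \<bar>u_E x\<bar> = 1" using u_E_eq_1 by eventually_elim simp
  qed
  finally show ?thesis by (simp add: space_\<nu>)
qed

lemma ext_integral_exists_bounded_below:
  assumes U: "U \<in> sets \<nu>" and u: "u \<in> newtonian p M \<Omega>" and m: "\<And>x. x \<in> \<Omega> \<Longrightarrow> ereal m \<le> u x"
  shows "ext_integral_exists \<nu> U u"
proof -
  have "(\<integral>\<^sup>+x\<in>U. e2ennreal (- u x) \<partial>\<nu>) \<le> (\<integral>\<^sup>+x. ennreal (- m) \<partial>\<nu>)"
  proof (rule nn_integral_mono)
    fix x assume "x \<in> space \<nu>"
    then have "- u x \<le> ereal (- m)" using m[of x] by (cases "u x") (auto simp: space_\<nu>)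
    then have "e2ennreal (- u x) \<le> ennreal (- m)" using e2ennreal_mono[of "- u x" "ereal (- m)"] by (simp add: e2ennreal_ereal)
    then show "e2ennreal (- u x) * indicator U x \<le> ennreal (- m)" by (simp add: indicator_def)
  qed
  also have "\<dots> < \<infinity>" using \<nu>_finite by (simp add: space_\<nu> ennreal_mult_less_top)
  finally show ?thesis
    using U newtonian_\<nu>_measurable[OF u] by (simp add: ext_integral_exists_def measurable_restrict_space1)
qed

lemma ext_integral_exists_integrable:
  assumes U: "U \<in> sets \<nu>" and u: "u \<in> newtonian p M \<Omega>" and int: "ext_integrable \<nu> \<Omega> u"
  shows "ext_integral_exists \<nu> U u"
proof -
  have "(\<integral>\<^sup>+x\<in>U. e2ennreal (- u x) \<partial>\<nu>) \<le> (\<integral>\<^sup>+x\<in>\<Omega>. e2ennreal \<bar>u x\<bar> \<partial>\<nu>)"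
  proof (rule nn_integral_mono)
    fix x assume "x \<in> space \<nu>"
    moreover have "e2ennreal (- u x) \<le> e2ennreal \<bar>u x\<bar>" by (intro e2ennreal_mono) (cases "u x", auto)
    ultimately show "e2ennreal (- u x) * indicator U x \<le> e2ennreal \<bar>u x\<bar> * indicator \<Omega> x"
      by (auto simp: indicator_def space_\<nu>)
  qed
  also have "\<dots> < \<infinity>" using int by (simp add: ext_integrable_def)
  finally show ?thesis
    using U newtonian_\<nu>_measurable[OF u] by (simp add: ext_integral_exists_def measurable_restrict_space1)
qed

end

theorem theorem9p1:
  fixes p :: real
    and M :: "'a::complete_space measure"
    and I :: "nat set" and W :: "nat \<Rightarrow> 'a set" and k :: "nat \<Rightarrow> nat"
    and Y :: "nat \<Rightarrow> 'a \<Rightarrow> nat \<Rightarrow> real"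
    and ip :: "'a \<Rightarrow> (nat \<Rightarrow> real) \<Rightarrow> (nat \<Rightarrow> real) \<Rightarrow> real"
    and D :: "('a \<Rightarrow> ereal) \<Rightarrow> 'a \<Rightarrow> nat \<Rightarrow> real"
    and \<Omega> E U :: "'a set"
    and u_E v :: "'a \<Rightarrow> ereal"
    and \<nu>_E :: "'a measure"
  assumes "1 < p"
    and "complete_borel_measure UNIV M"
    and "\<And>x r. 0 < r \<Longrightarrow> 0 < emeasure M (ball x r) \<and> emeasure M (ball x r) < \<infinity>"
    and "doubling M"
    and "poincare p M"
    and "cheeger_structure p M I W k Y ip"
    and "cheeger_gradient p M I W k Y ip D"
    and "\<Omega> \<noteq> {}" and "bounded \<Omega>" and "open \<Omega>"
    and "0 < sobolev_cap p M (- \<Omega>)"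
    and "E \<subseteq> \<Omega>"
    and "variational_cap p M E \<Omega> < \<infinity>"
    and "capacitary_potential p M ip D \<Omega> E u_E"
    and "is_T_measure p M ip D \<Omega> u_E \<nu>_E"
    and "U \<subseteq> \<Omega>" and "quasiopen p M U"
    and "v \<in> newtonian p M \<Omega>"
  shows
    "(\<forall>u\<in>newtonian p M \<Omega>.
        ((\<exists>m::real. \<forall>x\<in>\<Omega>. ereal m \<le> u x) \<or> ext_integrable \<nu>_E \<Omega> u) \<and>
        holds_qe p M (U \<inter> E) (\<lambda>x. u x = v x) \<longrightarrow>
        ext_integral_exists \<nu>_E U u \<and> ext_integral_exists \<nu>_E U v \<and>
        ext_integral \<nu>_E U u = ext_integral \<nu>_E U v) \<and>
     (holds_qe p M (U \<inter> E) (\<lambda>x. v x = 1) \<longrightarrow>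
        U \<in> sets \<nu>_E \<and> ext_integral_exists \<nu>_E U v \<and> ext_integral_exists \<nu>_E U u_E \<and>
        enn2ereal (emeasure \<nu>_E U) = ext_integral \<nu>_E U v \<and>
        ext_integral \<nu>_E U v = ext_integral \<nu>_E U u_E) \<and>
     (sobolev_cap p M (U \<inter> E) = 0 \<longrightarrow> U \<in> sets \<nu>_E \<and> emeasure \<nu>_E U = 0)"
proof -
  interpret capacitary_setting p M I W k Y ip D \<Omega> E u_E \<nu>_E
    by unfold_locales (use assms in auto)
  have U: "U \<subseteq> \<Omega>" "quasiopen p M U" and v: "v \<in> newtonian p M \<Omega>" using assms by auto
  show ?thesis
  proof (intro conjI)
    have one: "(\<lambda>x. ereal c) \<in> newtonian p M \<Omega>" for c using newtonian_const[OF open_\<Omega> M_\<Omega>] .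
    have Us: "U \<in> sets \<nu>_E"
      by (rule agree_\<nu>(2)[OF U one[of 0] one[of 0]]) (simp add: holds_qe_def polar_iff polar_empty)
    show "\<forall>u\<in>newtonian p M \<Omega>.
          ((\<exists>m::real. \<forall>x\<in>\<Omega>. ereal m \<le> u x) \<or> ext_integrable \<nu>_E \<Omega> u) \<and>
          holds_qe p M (U \<inter> E) (\<lambda>x. u x = v x) \<longrightarrow>
          ext_integral_exists \<nu>_E U u \<and> ext_integral_exists \<nu>_E U v \<and>
          ext_integral \<nu>_E U u = ext_integral \<nu>_E U v"
    proof (intro ballI impI)
      fix u assume u: "u \<in> newtonian p M \<Omega>"
        and *: "((\<exists>m::real. \<forall>x\<in>\<Omega>. ereal m \<le> u x) \<or> ext_integrable \<nu>_E \<Omega> u) \<and>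
          holds_qe p M (U \<inter> E) (\<lambda>x. u x = v x)"
      have AE: "AE x in \<nu>_E. x \<in> U \<longrightarrow> u x = v x" using * by (intro agree_\<nu>(1)[OF U u v]) simp
      have "ext_integral_exists \<nu>_E U u"
        using * ext_integral_exists_bounded_below[OF Us u] ext_integral_exists_integrable[OF Us u] by blast
      then show "ext_integral_exists \<nu>_E U u \<and> ext_integral_exists \<nu>_E U v \<and>
          ext_integral \<nu>_E U u = ext_integral \<nu>_E U v"
        using ext_integral_exists_cong_AE[OF AE newtonian_\<nu>_measurable[OF v]] ext_integral_cong_AE[OF AE] by blast
    qed
    show "holds_qe p M (U \<inter> E) (\<lambda>x. v x = 1) \<longrightarrow>
          U \<in> sets \<nu>_E \<and> ext_integral_exists \<nu>_E U v \<and> ext_integral_exists \<nu>_E U u_E \<and>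
          enn2ereal (emeasure \<nu>_E U) = ext_integral \<nu>_E U v \<and>
          ext_integral \<nu>_E U v = ext_integral \<nu>_E U u_E"
    proof
      assume "holds_qe p M (U \<inter> E) (\<lambda>x. v x = 1)"
      then have "AE x in \<nu>_E. x \<in> U \<longrightarrow> v x = ereal 1"
        by (intro agree_\<nu>(1)[OF U v one]) (simp add: one_ereal_def)
      then have v1: "AE x in \<nu>_E. x \<in> U \<longrightarrow> ereal 1 = v x" by eventually_elim auto
      have u1: "AE x in \<nu>_E. x \<in> U \<longrightarrow> ereal 1 = u_E x"
        using u_E_eq_1 by eventually_elim (auto simp: one_ereal_def)
      have u\<Omega>: "u_E \<in> newtonian p M \<Omega>"
        by (rule newtonian_restrict[OF u_E_newtonian borel_open[OF open_\<Omega>]])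
      have ex: "ext_integral_exists \<nu>_E U (\<lambda>x. ereal 1)"
        by (rule ext_integral_exists_bounded_below[OF Us one, of 1]) simp
      have "ext_integral \<nu>_E U (\<lambda>x. ereal 1) = enn2ereal (emeasure \<nu>_E U)"
        using Us by (simp add: ext_integral_def e2ennreal_ereal ennreal_neg zero_ennreal.rep_eq)
      then show "U \<in> sets \<nu>_E \<and> ext_integral_exists \<nu>_E U v \<and> ext_integral_exists \<nu>_E U u_E \<and>
          enn2ereal (emeasure \<nu>_E U) = ext_integral \<nu>_E U v \<and>
          ext_integral \<nu>_E U v = ext_integral \<nu>_E U u_E"
        using Us ext_integral_exists_cong_AE[OF v1 newtonian_\<nu>_measurable[OF v] ex]
          ext_integral_exists_cong_AE[OF u1 newtonian_\<nu>_measurable[OF u\<Omega>] ex]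
          ext_integral_cong_AE[OF v1] ext_integral_cong_AE[OF u1] by simp
    qed
    show "sobolev_cap p M (U \<inter> E) = 0 \<longrightarrow> U \<in> sets \<nu>_E \<and> emeasure \<nu>_E U = 0"
    proof (intro impI conjI Us)
      assume "sobolev_cap p M (U \<inter> E) = 0"
      then have "AE x in \<nu>_E. x \<in> U \<longrightarrow> ereal 1 = ereal 0"
        by (intro agree_\<nu>(1)[OF U one one]) (simp add: holds_qe_def Int_def)
      then have "AE x in \<nu>_E. x \<notin> U" by eventually_elim simp
      then show "emeasure \<nu>_E U = 0" using AE_iff_measurable[OF Us, of "\<lambda>x. x \<notin> U"] sets.sets_into_space[OF Us] by auto
    qed
  qed
qed

end
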